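(* If $G$ is a planar subcubic graph with girth $g(G)\geq 21$, then $\chi^2(G)\leq 4$; that is, $G$ admits a $2$-distance $4$-coloring.
   Context: Graphs are finite and simple. A graph is subcubic if its maximum degree is $3$. The girth $g(G)$ is the length of a shortest cycle of $G$. A $2$-distance $k$-coloring of $G$ is a map $\phi:V(G)\to\{1,\dots,k\}$ such that any two distinct vertices at distance at most $2$ in $G$ receive different colors. The $2$-distance chromatic number $\chi^2(G)$ is the smallest $k$ such that $G$ has a $2$-distance $k$-coloring. *)

theory Defs
  imports "HOL-Analysis.Analysis" "HOL-Library.Extended_Nat" "Graph_Theory.Graph_Theory"
begin

text \<open>
  A finite simple graph is a \<^locale>\<open>pair_graph\<close>: a finite, loop-free, symmetric digraph whose arcs
  are ordered pairs of vertices. An undirected edge \<open>{u, v}\<close> is thus the pair of arcs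
  \<open>(u, v)\<close> and \<open>(v, u)\<close>.
\<close>

definition edges :: "'a pair_pre_digraph \<Rightarrow> 'a set set" where
  "edges G = (\<lambda>(u, v). {u, v}) ` parcs G"

text \<open>
  Each undirected edge is drawn as a simple curve (\<^const>\<open>arc\<close>, in either orientation) joining its
  endpoints; the curve passes through no other vertex, and the curves of distinct edges meet at
  most in a common endpoint.
\<close>

definition plane_drawing ::
    "'a pair_pre_digraph \<Rightarrow> ('a \<Rightarrow> complex) \<Rightarrow> ('a set \<Rightarrow> real \<Rightarrow> complex) \<Rightarrow> bool" where
  "plane_drawing G p c \<longleftrightarrow>
     inj_on p (pverts G) \<and>
     (\<forall>e\<in>edges G. arc (c e) \<and> {pathstart (c e), pathfinish (c e)} = p ` e \<and>
        path_image (c e) \<inter> p ` pverts G = p ` e) \<and>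
     (\<forall>e\<in>edges G. \<forall>f\<in>edges G. e \<noteq> f \<longrightarrow>
        path_image (c e) \<inter> path_image (c f) = p ` (e \<inter> f))"

definition planar :: "'a pair_pre_digraph \<Rightarrow> bool" where
  "planar G \<longleftrightarrow> (\<exists>p c. plane_drawing G p c)"

text \<open>By symmetry, the out-degree of a vertex is its degree in the undirected graph.\<close>

definition max_degree :: "'a pair_pre_digraph \<Rightarrow> nat" where
  "max_degree G = Max (insert 0 (out_degree (with_proj G) ` pverts G))"

definition subcubic :: "'a pair_pre_digraph \<Rightarrow> bool" where
  "subcubic G \<longleftrightarrow> max_degree G = 3"

text \<open>
  In a symmetric digraph, traversing an edge back and forth is a directed cycle of length 2; the
  condition on the length excludes these. The girth of an acyclic graph is \<open>\<infinity>\<close>.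
\<close>

definition girth :: "'a pair_pre_digraph \<Rightarrow> enat" where
  "girth G = (INF p\<in>{p. pre_digraph.cycle (with_proj G) p \<and> 3 \<le> length p}. enat (length p))"

text \<open>The distance is the cost of a shortest walk when every arc has weight 1.\<close>

definition graph_dist :: "'a pair_pre_digraph \<Rightarrow> 'a \<Rightarrow> 'a \<Rightarrow> ereal" where
  "graph_dist G u v = wf_digraph.\<mu> (with_proj G) (\<lambda>_. 1) u v"

definition two_distance_coloring :: "'a pair_pre_digraph \<Rightarrow> nat \<Rightarrow> ('a \<Rightarrow> nat) \<Rightarrow> bool" where
  "two_distance_coloring G k \<phi> \<longleftrightarrow>
     \<phi> ` pverts G \<subseteq> {1..k} \<and>
     (\<forall>u\<in>pverts G. \<forall>v\<in>pverts G. u \<noteq> v \<and> graph_dist G u v \<le> 2 \<longrightarrow> \<phi> u \<noteq> \<phi> v)"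

text \<open>A finite graph has some coloring, so the minimum below is attained.\<close>

definition two_distance_chromatic_number :: "'a pair_pre_digraph \<Rightarrow> nat" where
  "two_distance_chromatic_number G = (LEAST k. \<exists>\<phi>. two_distance_coloring G k \<phi>)"

end

theory Submission
  imports Defs "HOL-Complex_Analysis.Winding_Numbers"
begin

text \<open>
  Take a minimal counterexample. It is connected, has no bridge, has minimum degree \<open>2\<close>, and its
  \<open>2\<close>-vertices form threads of at most five vertices between \<open>3\<close>-vertices. Since every cycle has length
  at least \<open>21\<close>, cutting a largest cycle repeatedly along ears (Jordan curves, winding numbers) gives
  \<open>21 (|E| + 2) \<le> 2 |E| + 21 |V|\<close>, the inequality that Euler's formula would provide. So on average the
  three threads at a \<open>3\<close>-vertex have more than \<open>15/2\<close> inner vertices in total, each thread being counted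
  at both of its ends.

  The opposite bound comes from reducible configurations. What matters about a tree that hangs on a
  \<open>3\<close>-vertex is which colors of that vertex and of its neighbor extend to the tree; the possible answers
  form a finite family of sets of color pairs, which is computed from the lengths of the threads. Three
  trees at a vertex are reducible if every choice of answers admits a common coloring. The girth ensures
  that the trees that occur are disjoint. A discharging argument over the irreducible configurations
  bounds the average by \<open>15/2\<close>.
\<close>

section \<open>Theta curves\<close>

text \<open>The threshold comes from the girth. With \<open>n\<close> vertices of degree 3 and
  \<open>m\<close> of degree 2, \<open>2 |E| = 3 n + 2 m\<close> turns the inequality for girth 21
  into \<open>15 n + 84 \<le> 4 m\<close>, and each 2-vertex is an inner vertex of one thread,
  counted once from each end. The obstacle on the coloring side is that a piece cannot be chosen
  freely: once it is removed, an adversary colors the rest, and a hanging tree answers with a set of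
  extendable pairs that depends on this coloring. Hence the families, which list sets of which at
  least one is guaranteed. A family may be replaced by a coarser one, so few families are needed and
  all their combinations can be evaluated. The girth is used a second time here: the 3-vertices of a
  tree are within distance 6 of the vertex where it hangs and its attachments within 12, and
  \<open>6 + 12 < 21\<close> keeps different trees apart.\<close>

lemma connected_subset_inside:
  assumes "Topological_Spaces.connected T" "T \<inter> S = {}" "T \<inter> inside S \<noteq> {}"
  shows "T \<subseteq> inside S"
proof
  fix t assume t: "t \<in> T"
  from assms(3) obtain x where x: "x \<in> T" "x \<in> inside S" by blast
  have "connected_component (- S) x t"
    unfolding connected_component_def using assms(1,2) t x(1) by blast
  with x(2) show "t \<in> inside S" by (meson inside_same_component)
qed

lemma connected_subset_outside:
  assumes "Topological_Spaces.connected T" "T \<inter> S = {}" "T \<inter> outside S \<noteq> {}"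
  shows "T \<subseteq> outside S"
proof
  fix t assume t: "t \<in> T"
  from assms(3) obtain x where x: "x \<in> T" "x \<in> outside S" by blast
  have "connected_component (- S) x t"
    unfolding connected_component_def using assms(1,2) t x(1) by blast
  with x(2) show "t \<in> outside S" by (meson outside_same_component)
qed

text \<open>Continuity maps the closure of the open unit interval into the closure of the open arc.
  With it the ends of an edge are located from the side on which the rest of the edge lies.\<close>

lemma arc_subset_closure_endless:
  fixes c :: "real \<Rightarrow> complex"
  assumes "arc c"
  shows "path_image c \<subseteq> closure (path_image c - {pathstart c, pathfinish c})"
proof -
  have inj: "inj_on c {0..1}" and cont: "continuous_on {0..1} c"
    using assms by (auto simp: arc_def path_def)
  have eq: "path_image c - {pathstart c, pathfinish c} = c ` {0<..<1}"
  proof -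
    have "path_image c = c ` {0..1}" by (simp add: path_image_def)
    moreover have "c ` {0..1} - {c 0, c 1} = c ` ({0..1} - {0, 1})"
      using inj by (subst inj_on_image_set_diff[OF inj]) auto
    moreover have "{0..1} - {0, 1} = {0<..<1::real}" by auto
    ultimately show ?thesis by (simp add: pathstart_def pathfinish_def)
  qed
  have "c ` closure {0<..<1::real} \<subseteq> closure (c ` {0<..<1})"
    using cont by (intro image_closure_subset) (auto simp: closure_subset)
  then show ?thesis unfolding eq by (simp add: path_image_def)
qed

lemma theta_loop:
  fixes c1 c2 :: "real \<Rightarrow> complex"
  assumes "arc c1" "pathstart c1 = a" "pathfinish c1 = b"
    and "arc c2" "pathstart c2 = a" "pathfinish c2 = b"
    and "path_image c1 \<inter> path_image c2 = {a, b}"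
  shows "simple_path (c1 +++ reversepath c2)"
    "pathfinish (c1 +++ reversepath c2) = pathstart (c1 +++ reversepath c2)"
    "path_image (c1 +++ reversepath c2) = path_image c1 \<union> path_image c2"
proof -
  show "simple_path (c1 +++ reversepath c2)"
    using assms by (intro simple_path_join_loop) (auto simp: arc_reversepath)
qed (use assms in \<open>auto simp: path_image_join\<close>)

text \<open>The inside of the first loop is connected and avoids \<open>c2\<close> and
  \<open>c\<close>, so it lies on one side of the second loop, decided by \<open>z\<close>. Its
  frontier contains \<open>c1\<close>; hence \<open>c1\<close> lies in the closure of that side and,
  apart from its ends, off the loop itself.\<close>

lemma theta_half:
  fixes c1 c2 c :: "real \<Rightarrow> complex"
  assumes 1: "arc c1" "pathstart c1 = a" "pathfinish c1 = b"
    and 2: "arc c2" "pathstart c2 = a" "pathfinish c2 = b"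
    and 3: "arc c" "pathstart c = a" "pathfinish c = b"
    and 12: "path_image c1 \<inter> path_image c2 = {a, b}"
    and 13: "path_image c1 \<inter> path_image c = {a, b}"
    and 23: "path_image c2 \<inter> path_image c = {a, b}"
    and out: "path_image c - {a, b} \<subseteq> outside (path_image c1 \<union> path_image c2)"
    and z: "z \<in> inside (path_image c1 \<union> path_image c2)" "z \<in> inside (path_image c2 \<union> path_image c)"
  shows "inside (path_image c1 \<union> path_image c2) \<subseteq> inside (path_image c2 \<union> path_image c)"
    "path_image c1 - {a, b} \<subseteq> inside (path_image c2 \<union> path_image c)"
proof -
  note L = Jordan_inside_outside[OF theta_loop(1,2)[OF 1 2 12], unfolded theta_loop(3)[OF 1 2 12]]
  note L' = Jordan_inside_outside[OF theta_loop(1,2)[OF 2 3 23], unfolded theta_loop(3)[OF 2 3 23]]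
  let ?I = "inside (path_image c1 \<union> path_image c2)" and ?J = "inside (path_image c2 \<union> path_image c)"
  have ab: "a \<in> path_image c1" "b \<in> path_image c1" using 12 by auto
  have "?I \<inter> path_image c = {}"
    using out ab by (auto simp: inside_def outside_def)
  then have d: "?I \<inter> (path_image c2 \<union> path_image c) = {}"
    using inside_no_overlap[of "path_image c1 \<union> path_image c2"] by blast
  show sub: "?I \<subseteq> ?J"
    using z d L by (intro connected_subset_inside) auto
  have "path_image c1 \<subseteq> frontier ?I" using L by auto
  also have "\<dots> \<subseteq> closure ?J" using sub by (auto simp: frontier_def dest: closure_mono[THEN subsetD])
  also have "\<dots> \<subseteq> ?J \<union> frontier ?J" by (simp add: closure_Un_frontier)
  also have "\<dots> = ?J \<union> (path_image c2 \<union> path_image c)" using L' by auto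
  finally show "path_image c1 - {a, b} \<subseteq> ?J" using 12 13 by blast
qed

text \<open>Additivity of winding numbers shows that a point inside the first loop is inside one of the
  other two.\<close>

lemma theta_outside:
  fixes c1 c2 c :: "real \<Rightarrow> complex"
  assumes 1: "arc c1" "pathstart c1 = a" "pathfinish c1 = b"
    and 2: "arc c2" "pathstart c2 = a" "pathfinish c2 = b"
    and 3: "arc c" "pathstart c = a" "pathfinish c = b"
    and 12: "path_image c1 \<inter> path_image c2 = {a, b}"
    and 13: "path_image c1 \<inter> path_image c = {a, b}"
    and 23: "path_image c2 \<inter> path_image c = {a, b}"
    and out: "path_image c - {a, b} \<subseteq> outside (path_image c1 \<union> path_image c2)"
  shows "inside (path_image c1 \<union> path_image c2) \<subseteq> inside (path_image c2 \<union> path_image c) \<and>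
      path_image c1 - {a, b} \<subseteq> inside (path_image c2 \<union> path_image c) \<or>
     inside (path_image c1 \<union> path_image c2) \<subseteq> inside (path_image c1 \<union> path_image c) \<and>
      path_image c2 - {a, b} \<subseteq> inside (path_image c1 \<union> path_image c)"
proof -
  note L = theta_loop[OF 1 2 12]
  note J = Jordan_inside_outside[OF L(1,2), unfolded L(3)]
  obtain z where z: "z \<in> inside (path_image c1 \<union> path_image c2)" using J by blast
  have ab: "a \<in> path_image c1" "b \<in> path_image c1" using 12 by auto
  have zn: "z \<notin> path_image c1" "z \<notin> path_image c2" "z \<notin> path_image c"
    using z inside_no_overlap[of "path_image c1 \<union> path_image c2"] out ab
    by (auto simp: inside_def outside_def)
  have p: "path c1" "path c2" "path c" using 1 2 3 by (auto simp: arc_imp_path)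
  have w: "winding_number (u +++ reversepath v) z = winding_number u z - winding_number v z"
    if "path u" "path v" "z \<notin> path_image u" "z \<notin> path_image v" "pathfinish u = pathfinish v" for u v
    using that by (simp add: winding_number_join winding_number_reversepath)
  have "winding_number (c1 +++ reversepath c2) z \<noteq> 0"
    using simple_closed_path_winding_number_inside[OF L(1)] z L(3)
    by (metis L(2) one_neq_zero neg_equal_0_iff_equal simple_closed_path_norm_winding_number_inside norm_zero)
  then have "winding_number (c1 +++ reversepath c) z \<noteq> 0 \<or> winding_number (c2 +++ reversepath c) z \<noteq> 0"
    using w p zn 1 2 3 by auto
  moreover have "z \<in> inside (path_image u \<union> path_image c)"
    if "arc u" "pathstart u = a" "pathfinish u = b" "path_image u \<inter> path_image c = {a, b}"
      "z \<notin> path_image u" "winding_number (u +++ reversepath c) z \<noteq> 0" for u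
  proof -
    note K = theta_loop[OF that(1-3) 3 that(4)]
    have "z \<notin> outside (path_image u \<union> path_image c)"
      using winding_number_zero_in_outside[OF simple_path_imp_path[OF K(1)] K(2)] K(3) that(6) by metis
    then show ?thesis using that(5) zn(3) inside_Un_outside[of "path_image u \<union> path_image c"] by blast
  qed
  ultimately have "z \<in> inside (path_image c1 \<union> path_image c) \<or> z \<in> inside (path_image c2 \<union> path_image c)"
    using 1 2 13 23 zn by blast
  then show ?thesis
  proof
    assume "z \<in> inside (path_image c2 \<union> path_image c)"
    from theta_half[OF 1 2 3 12 13 23 out z this] show ?thesis by blast
  next
    assume *: "z \<in> inside (path_image c1 \<union> path_image c)"
    have 21: "path_image c2 \<inter> path_image c1 = {a, b}" using 12 by blast
    from theta_half[OF 2 1 3 21 23 13, of z] out z * show ?thesis by (simp add: Un_commute)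
  qed
qed

section \<open>Paths and cycles as vertex lists\<close>

fun path_edges :: "'a list \<Rightarrow> 'a set set" where
  "path_edges (x # y # r) = insert {x, y} (path_edges (y # r))"
| "path_edges _ = {}"

lemma path_edges_Cons: "r \<noteq> [] \<Longrightarrow> path_edges (x # r) = insert {x, hd r} (path_edges r)"
  by (cases r) auto

lemma path_edges_split: "path_edges (xs @ y # ys) = path_edges (xs @ [y]) \<union> path_edges (y # ys)"
proof (induction xs)
  case (Cons a xs)
  show ?case
    by (cases xs) (use Cons in auto)
qed auto

lemma path_edges_snoc: "r \<noteq> [] \<Longrightarrow> path_edges (r @ [x]) = insert {last r, x} (path_edges r)"
  by (induction r rule: path_edges.induct) auto

lemma path_edges_rev [simp]: "path_edges (rev xs) = path_edges xs"
proof (induction xs)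
  case (Cons a xs)
  show ?case
    by (cases "xs = []") (use Cons in \<open>simp_all add: path_edges_snoc path_edges_Cons last_rev insert_commute\<close>)
qed simp

lemma path_edges_subset: "e \<in> path_edges xs \<Longrightarrow> e \<subseteq> set xs"
  by (induction xs rule: path_edges.induct) auto

lemma path_edges_cover: "2 \<le> length xs \<Longrightarrow> v \<in> set xs \<Longrightarrow> \<exists>e\<in>path_edges xs. v \<in> e"
proof (induction xs rule: path_edges.induct)
  case (1 x y r)
  show ?case
    by (cases r) (use 1 in auto)
qed auto

lemma finite_path_edges [simp]: "finite (path_edges xs)"
  by (induction xs rule: path_edges.induct) auto

lemma card_path_edges: "distinct xs \<Longrightarrow> card (path_edges xs) = length xs - 1"
proof (induction xs rule: path_edges.induct)
  case (1 x y r)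
  have "{x, y} \<notin> path_edges (y # r)" using 1(2) path_edges_subset[of "{x, y}" "y # r"] by auto
  then show ?case using 1 by simp
qed auto

lemma path_edges_ends: "distinct (a # m @ [b]) \<Longrightarrow> {a, b} \<in> path_edges (a # m @ [b]) \<Longrightarrow> m = []"
proof (cases m)
  case (Cons x r)
  assume d: "distinct (a # m @ [b])" and "{a, b} \<in> path_edges (a # m @ [b])"
  then have "{a, b} \<in> path_edges (m @ [b])" using Cons by (auto simp: doubleton_eq_iff)
  from path_edges_subset[OF this] d show ?thesis by auto
qed

definition cycle_edges :: "'a list \<Rightarrow> 'a set set" where
  "cycle_edges vs = path_edges (vs @ [hd vs])"

lemma cycle_edges_subset: "e \<in> cycle_edges vs \<Longrightarrow> vs \<noteq> [] \<Longrightarrow> e \<subseteq> set vs"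
  unfolding cycle_edges_def by (drule path_edges_subset) auto

lemma cycle_edges_rotate: "cycle_edges (us @ a # ws) = cycle_edges (a # ws @ us)"
proof (cases us)
  case (Cons u r)
  have "cycle_edges (us @ a # ws) = path_edges (us @ [a]) \<union> path_edges (a # ws @ [u])"
    using path_edges_split[of us a "ws @ [u]"] Cons by (simp add: cycle_edges_def)
  also have "\<dots> = path_edges (a # ws @ [u]) \<union> path_edges (u # r @ [a])"
    using Cons by auto
  also have "\<dots> = cycle_edges (a # ws @ us)"
    using path_edges_split[of "a # ws" u "r @ [a]"] Cons by (simp add: cycle_edges_def)
  finally show ?thesis .
qed (simp add: cycle_edges_def)

text \<open>Both arcs of the cycle are read from \<open>a\<close> to \<open>b\<close>, so that each
  can be joined with a third path from \<open>a\<close> to \<open>b\<close>. The two ends belong to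
  both lists, whence the 2 in the last equation.\<close>

locale cycle_parts =
  fixes vs :: "'a list" and a b :: 'a and xs ys :: "'a list"
  assumes parts: "distinct xs" "distinct ys" "hd xs = a" "last xs = b" "hd ys = a" "last ys = b"
    "2 \<le> length xs" "2 \<le> length ys" "set xs \<inter> set ys = {a, b}" "set xs \<union> set ys = set vs"
    "path_edges xs \<union> path_edges ys = cycle_edges vs" "path_edges xs \<inter> path_edges ys = {}"
    "length xs + length ys = length vs + 2"

lemma cycle_split:
  assumes vs: "distinct vs" "3 \<le> length vs" and ab: "a \<in> set vs" "b \<in> set vs" "a \<noteq> b"
  obtains xs ys where "cycle_parts vs a b xs ys"
proof -
  from ab(1) obtain us ws where us: "vs = us @ a # ws" by (auto simp: in_set_conv_decomp)
  with ab have "b \<in> set (ws @ us)" by auto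
  then obtain m1 m2 where m: "ws @ us = m1 @ b # m2" by (meson split_list)
  let ?xs = "a # m1 @ [b]" and ?ys = "a # rev m2 @ [b]"
  have d: "distinct (a # m1 @ b # m2)" using vs(1) us unfolding m[symmetric] by auto
  have s: "set vs = set (a # m1 @ b # m2)" using us unfolding m[symmetric] by auto
  have l: "length vs = length (a # m1 @ b # m2)" using us unfolding m[symmetric] by auto
  have pys: "path_edges ?ys = path_edges (b # m2 @ [a])"
    using path_edges_rev[of ?ys] by simp
  have ce: "cycle_edges vs = path_edges ?xs \<union> path_edges (b # m2 @ [a])"
    unfolding us cycle_edges_rotate m using path_edges_split[of "a # m1" b "m2 @ [a]"]
    by (simp add: cycle_edges_def)
  \<comment> \<open>A common edge could only be \<open>{a, b}\<close>; then neither arc has an inner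
    vertex and the cycle would have length 2.\<close>
  have "path_edges ?xs \<inter> path_edges ?ys = {}"
  proof (rule ccontr)
    assume "\<not> ?thesis"
    then obtain e where e: "e \<in> path_edges ?xs" "e \<in> path_edges ?ys" by blast
    have "e \<subseteq> {a, b}" using path_edges_subset[OF e(1)] path_edges_subset[OF e(2)] d by auto
    moreover have "card e = 2"
      using e(1) d
    proof -
      have "card f = 2" if "f \<in> path_edges zs" "distinct zs" for f and zs :: "'a list"
        using that by (induction zs rule: path_edges.induct) auto
      from this[OF e(1)] d show ?thesis by auto
    qed
    ultimately have "e = {a, b}" using ab(3) card_subset_eq[of "{a, b}" e] by auto
    with e have "m1 = []" "rev m2 = []" using path_edges_ends[of a m1 b] path_edges_ends[of a "rev m2" b] d by auto
    then show False using l vs(2) by simp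
  qed
  then show thesis
    using d s l ce pys by (intro that[of ?xs ?ys] cycle_parts.intro) auto
qed

lemma card_cycle_edges:
  assumes "distinct vs" "3 \<le> length vs"
  shows "card (cycle_edges vs) = length vs"
proof -
  obtain a b r where r: "vs = a # b # r" using assms(2) by (cases vs; cases "tl vs") auto
  with assms(1) have "a \<in> set vs" "b \<in> set vs" "a \<noteq> b" by auto
  from cycle_split[OF assms this] obtain xs ys where "cycle_parts vs a b xs ys" .
  note * = cycle_parts.parts[OF this]
  have "card (cycle_edges vs) = card (path_edges xs) + card (path_edges ys)"
    using *(11,12) by (metis card_Un_disjoint finite_path_edges)
  then show ?thesis using *(7,8,13) card_path_edges[OF *(1)] card_path_edges[OF *(2)] by linarith
qed

text \<open>Edge-disjointness excludes that both paths are the single edge \<open>{a, b}\<close>, so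
  a third vertex exists.\<close>

lemma cycle_join:
  assumes xs: "distinct xs" "hd xs = a" "last xs = b" "2 \<le> length xs"
    and ys: "distinct ys" "hd ys = a" "last ys = b" "2 \<le> length ys"
    and i: "set xs \<inter> set ys = {a, b}" "path_edges xs \<inter> path_edges ys = {}"
  obtains vs where "distinct vs" "3 \<le> length vs" "cycle_edges vs = path_edges xs \<union> path_edges ys"
    "set vs = set xs \<union> set ys" "length vs + 2 = length xs + length ys"
proof -
  have decomp: "\<exists>m. zs = a # m @ [b]" if "hd zs = a" "last zs = b" "2 \<le> length zs" for zs :: "'a list"
  proof -
    from that have "zs = hd zs # tl zs" "tl zs \<noteq> []" by (cases zs; force)+
    with that show ?thesis by (metis append_butlast_last_id last_ConsR list.sel(1))
  qed
  obtain m where m: "ys = a # m @ [b]" using decomp[OF ys(2-4)] by blast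
  obtain k where k: "xs = a # k @ [b]" using decomp[OF xs(2-4)] by blast
  let ?vs = "xs @ rev m"
  have "path_edges ys = path_edges (b # rev m @ [a])" unfolding m using path_edges_rev[of "a # m @ [b]"] by simp
  then have ce: "cycle_edges ?vs = path_edges xs \<union> path_edges ys"
    using path_edges_split[of "a # k" b "rev m @ [a]"] by (simp add: cycle_edges_def k)
  have "k \<noteq> [] \<or> m \<noteq> []" using i(2) k m by auto
  then have "3 \<le> length ?vs" using k by (cases k; cases m) auto
  moreover have "distinct ?vs" using xs(1) ys(1) i(1) k m by auto
  moreover have "set ?vs = set xs \<union> set ys" using i(1) k m by auto
  moreover have "length ?vs + 2 = length xs + length ys" using m by simp
  ultimately show thesis using ce by (intro that[of ?vs])
qed

text \<open>The path is built backwards from the end of the walk. If the new start already occurs,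
  only the part from its occurrence on is kept, so the path stays simple and meets \<open>T\<close>
  only at its end.\<close>

lemma rtrancl_first_hit:
  assumes "(z, c) \<in> A\<^sup>*" "z \<notin> T" "c \<in> T"
  shows "\<exists>qs. distinct qs \<and> 2 \<le> length qs \<and> hd qs = z \<and> last qs \<in> T \<and> set (butlast qs) \<inter> T = {} \<and>
    successively (\<lambda>x y. (x, y) \<in> A) qs"
  using assms
proof (induction rule: converse_rtrancl_induct)
  case (step z z')
  show ?case
  proof (cases "z' \<in> T")
    case True
    then show ?thesis using step by (intro exI[of _ "[z, z']"]) auto
  next
    case False
    with step obtain qs where qs: "distinct qs" "2 \<le> length qs" "hd qs = z'" "last qs \<in> T"
      "set (butlast qs) \<inter> T = {}" "successively (\<lambda>x y. (x, y) \<in> A) qs" by auto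
    show ?thesis
    proof (cases "z \<in> set qs")
      case True
      then obtain us ws where us: "qs = us @ z # ws" by (auto simp: in_set_conv_decomp)
      have "ws \<noteq> []" using us qs(4) step(4) by auto
      then show ?thesis
        using qs us by (intro exI[of _ "z # ws"]) (auto simp: butlast_append successively_append_iff Suc_le_eq)
    next
      case False
      have "qs \<noteq> []" using qs(2) by auto
      then show ?thesis using qs False step
        by (intro exI[of _ "z # qs"]) (auto simp: successively_Cons)
    qed
  qed
qed auto

lemma path_edges_successively:
  "path_edges xs \<subseteq> E \<longleftrightarrow> successively (\<lambda>x y. {x, y} \<in> E) xs"
  by (induction xs rule: path_edges.induct) auto

section \<open>Cycles in plane graphs\<close>

locale plane_graph =
  fixes V :: "'a set" and E :: "'a set set" and p :: "'a \<Rightarrow> complex" and c :: "'a set \<Rightarrow> real \<Rightarrow> complex"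
  assumes finite_V: "finite V"
    and edgeE: "e \<in> E \<Longrightarrow> \<exists>x y. x \<noteq> y \<and> e = {x, y} \<and> x \<in> V \<and> y \<in> V"
    and inj_p: "inj_on p V"
    and arc_c: "e \<in> E \<Longrightarrow> arc (c e)"
    and ends_c: "e \<in> E \<Longrightarrow> {pathstart (c e), pathfinish (c e)} = p ` e"
    and verts_c: "e \<in> E \<Longrightarrow> path_image (c e) \<inter> p ` V = p ` e"
    and cross_c: "e \<in> E \<Longrightarrow> f \<in> E \<Longrightarrow> e \<noteq> f \<Longrightarrow> path_image (c e) \<inter> path_image (c f) = p ` (e \<inter> f)"
begin

definition im :: "'a set \<Rightarrow> complex set" where "im e = path_image (c e)"
definition gim :: "'a set set \<Rightarrow> complex set" where "gim F = (\<Union>e\<in>F. im e)"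
text \<open>Open edges are connected and avoid all other edges, so a cycle that does not contain the
  edge leaves it on one side.\<close>

definition io :: "'a set \<Rightarrow> complex set" where "io e = im e - p ` e"

lemma E_subset:
  assumes "e \<in> E" shows "e \<subseteq> V"
  using edgeE[OF assms] by blast

lemma finite_E: "finite E"
proof (rule finite_subset)
  show "E \<subseteq> Pow V" using E_subset by blast
qed (use finite_V in simp)

lemma im_vertex:
  assumes "e \<in> E" "v \<in> V"
  shows "p v \<in> im e \<longleftrightarrow> v \<in> e"
proof -
  have "p v \<in> im e \<longleftrightarrow> p v \<in> p ` e"
    using verts_c[OF assms(1)] assms(2) unfolding im_def by blast
  then show ?thesis using inj_on_image_mem_iff[OF inj_p assms(2) E_subset[OF assms(1)]] by simp
qed

lemma gim_vertex:
  assumes "F \<subseteq> E" "v \<in> V"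
  shows "p v \<in> gim F \<longleftrightarrow> v \<in> \<Union>F"
  using im_vertex[OF _ assms(2)] assms(1) unfolding gim_def by blast

lemma gim_Un: "gim (F \<union> F') = gim F \<union> gim F'" by (auto simp: gim_def)

lemma io_connected: "e \<in> E \<Longrightarrow> Topological_Spaces.connected (io e)"
  using connected_simple_path_endless[OF arc_imp_simple_path[OF arc_c]] ends_c
  by (simp add: io_def im_def)

lemma im_subset_closure: "e \<in> E \<Longrightarrow> im e \<subseteq> closure (io e)"
  using arc_subset_closure_endless[OF arc_c] ends_c by (simp add: io_def im_def)

lemma io_nonempty:
  assumes "e \<in> E" shows "io e \<noteq> {}"
proof
  assume "io e = {}"
  then have "im e = {}" using im_subset_closure[OF assms] by simp
  then show False by (simp add: im_def)
qed

lemma io_gim: "e \<in> E \<Longrightarrow> F \<subseteq> E \<Longrightarrow> e \<notin> F \<Longrightarrow> io e \<inter> gim F = {}"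
proof -
  assume *: "e \<in> E" "F \<subseteq> E" "e \<notin> F"
  have "im e \<inter> im f \<subseteq> p ` e" if "f \<in> F" for f
  proof -
    have "f \<in> E" "e \<noteq> f" using * that by auto
    from cross_c[OF *(1) this] show ?thesis by (auto simp: im_def)
  qed
  then show ?thesis unfolding io_def gim_def by blast
qed

lemma gim_Int:
  assumes "F \<subseteq> E" "F' \<subseteq> E" "F \<inter> F' = {}"
  shows "gim F \<inter> gim F' = p ` (\<Union>F \<inter> \<Union>F')"
proof
  show "gim F \<inter> gim F' \<subseteq> p ` (\<Union>F \<inter> \<Union>F')"
  proof
    fix z assume "z \<in> gim F \<inter> gim F'"
    then obtain e f where ef: "e \<in> F" "f \<in> F'" "z \<in> im e" "z \<in> im f" by (auto simp: gim_def)
    then have "e \<in> E" "f \<in> E" "e \<noteq> f" using assms by auto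
    from cross_c[OF this] have "z \<in> p ` (e \<inter> f)" using ef(3,4) unfolding im_def by blast
    then show "z \<in> p ` (\<Union>F \<inter> \<Union>F')" using ef(1,2) by auto
  qed
  show "p ` (\<Union>F \<inter> \<Union>F') \<subseteq> gim F \<inter> gim F'"
  proof
    fix z assume "z \<in> p ` (\<Union>F \<inter> \<Union>F')"
    then obtain v where v: "z = p v" "v \<in> \<Union>F" "v \<in> \<Union>F'" by auto
    then have "v \<in> V" using assms(1) E_subset by blast
    then show "z \<in> gim F \<inter> gim F'" using v gim_vertex[OF assms(1)] gim_vertex[OF assms(2)] by simp
  qed
qed

lemma path_arc:
  assumes "distinct xs" "2 \<le> length xs" "path_edges xs \<subseteq> E"
  shows "\<exists>g. arc g \<and> pathstart g = p (hd xs) \<and> pathfinish g = p (last xs) \<and> path_image g = gim (path_edges xs)"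
  using assms
proof (induction xs rule: path_edges.induct)
  case (1 x y r)
  let ?e = "{x, y}"
  have e: "?e \<in> E" using 1 by auto
  have "{pathstart (c ?e), pathfinish (c ?e)} = {p x, p y}" using ends_c[OF e] by simp
  then consider "pathstart (c ?e) = p x" "pathfinish (c ?e) = p y" | "pathstart (c ?e) = p y" "pathfinish (c ?e) = p x"
    unfolding doubleton_eq_iff by blast
  then obtain g where g: "arc g" "pathstart g = p x" "pathfinish g = p y" "path_image g = im ?e"
  proof cases
    case 1
    then show thesis using arc_c[OF e] that[of "c ?e"] by (simp add: im_def)
  next
    case 2
    then show thesis using arc_c[OF e] that[of "reversepath (c ?e)"] by (simp add: im_def arc_reversepath)
  qed
  show ?case
  proof (cases r)
    case Nil
    then show ?thesis using g by (intro exI[of _ g]) (auto simp: gim_def)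
  next
    case (Cons z s)
    then obtain h where h: "arc h" "pathstart h = p y" "pathfinish h = p (last (y # r))"
      "path_image h = gim (path_edges (y # r))"
    proof -
      have "distinct (y # r)" "2 \<le> length (y # r)" "path_edges (y # r) \<subseteq> E" using 1(2,4) Cons by simp_all
      from 1(1)[OF this] show thesis using that by (elim exE conjE) simp
    qed
    have "?e \<notin> path_edges (y # r)" using 1(2) path_edges_subset[of ?e "y # r"] by auto
    then have "gim {?e} \<inter> gim (path_edges (y # r)) = p ` (\<Union>{?e} \<inter> \<Union>(path_edges (y # r)))"
      using 1(4) by (intro gim_Int) auto
    moreover have "\<Union>(path_edges (y # r)) \<subseteq> set (y # r)" using path_edges_subset by blast
    ultimately have "im ?e \<inter> gim (path_edges (y # r)) \<subseteq> {p y}" using 1(2) by (auto simp: gim_def)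
    then have "arc (g +++ h)" using g h by (intro arc_join) auto
    then show ?thesis using g h
      by (intro exI[of _ "g +++ h"]) (auto simp: path_image_join gim_def)
  qed
qed auto

definition is_cycle :: "'a list \<Rightarrow> bool" where
  "is_cycle vs \<longleftrightarrow> distinct vs \<and> 3 \<le> length vs \<and> cycle_edges vs \<subseteq> E"

definition curve :: "'a list \<Rightarrow> complex set" where "curve vs = gim (cycle_edges vs)"

lemma Union_path_edges:
  assumes "2 \<le> length xs" shows "\<Union>(path_edges xs) = set xs"
proof
  show "\<Union>(path_edges xs) \<subseteq> set xs" using path_edges_subset by fast
  show "set xs \<subseteq> \<Union>(path_edges xs)" using path_edges_cover[OF assms] by fast
qed

lemma two_paths:
  assumes "distinct xs" "distinct ys" "hd xs = a" "last xs = b" "hd ys = a" "last ys = b"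
    "2 \<le> length xs" "2 \<le> length ys" "set xs \<inter> set ys = {a, b}" "path_edges xs \<inter> path_edges ys = {}"
    "path_edges xs \<subseteq> E" "path_edges ys \<subseteq> E"
  shows "gim (path_edges xs) \<inter> gim (path_edges ys) = {p a, p b}"
proof -
  have "gim (path_edges xs) \<inter> gim (path_edges ys) = p ` (set xs \<inter> set ys)"
    using gim_Int[OF assms(11,12,10)] by (simp only: Union_path_edges[OF assms(7)] Union_path_edges[OF assms(8)])
  then show ?thesis unfolding assms(9) by simp
qed

lemma Union_cycle_edges:
  assumes "is_cycle vs" shows "\<Union>(cycle_edges vs) = set vs"
proof -
  have "vs \<noteq> []" using assms by (auto simp: is_cycle_def)
  then show ?thesis unfolding cycle_edges_def
    by (subst Union_path_edges) (auto simp: Suc_le_eq neq_Nil_conv)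
qed

lemma cycle_in_V:
  assumes "is_cycle vs" shows "set vs \<subseteq> V"
proof -
  have "cycle_edges vs \<subseteq> E" using assms by (simp add: is_cycle_def)
  then have "\<Union>(cycle_edges vs) \<subseteq> V" using E_subset by blast
  then show ?thesis by (simp add: Union_cycle_edges[OF assms])
qed

lemma curve_vertex: "is_cycle vs \<Longrightarrow> v \<in> V \<Longrightarrow> p v \<in> curve vs \<longleftrightarrow> v \<in> set vs"
  unfolding curve_def using gim_vertex[of "cycle_edges vs" v] Union_cycle_edges[of vs]
  by (simp add: is_cycle_def)

lemma cycle_parts_E:
  assumes "is_cycle vs" "cycle_parts vs a b xs ys" shows "path_edges xs \<subseteq> E" "path_edges ys \<subseteq> E"
  using assms(1) cycle_parts.parts(11)[OF assms(2)] unfolding is_cycle_def by blast+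

lemma cycle_two_paths:
  assumes "is_cycle vs" "a \<in> set vs" "b \<in> set vs" "a \<noteq> b"
  obtains xs ys where "cycle_parts vs a b xs ys"
  using assms cycle_split[of vs a b] unfolding is_cycle_def by blast

text \<open>The two arcs of the cycle between its first two vertices form a loop of two curves, to
  which the Jordan curve theorem applies.\<close>

lemma curve_jordan:
  assumes "is_cycle vs"
  shows "open (inside (curve vs))" "Topological_Spaces.connected (inside (curve vs))" "open (outside (curve vs))"
    "frontier (inside (curve vs)) = curve vs" "frontier (outside (curve vs)) = curve vs"
proof -
  obtain a b r where r: "vs = a # b # r"
    using assms unfolding is_cycle_def by (cases vs; cases "tl vs") auto
  have ab: "a \<in> set vs" "b \<in> set vs" "a \<noteq> b" using r assms by (auto simp: is_cycle_def)
  obtain xs ys where xy: "cycle_parts vs a b xs ys" by (rule cycle_two_paths[OF assms ab])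
  note * = cycle_parts.parts[OF xy] cycle_parts_E[OF assms xy]
  obtain g where g: "arc g" "pathstart g = p a" "pathfinish g = p b" "path_image g = gim (path_edges xs)"
    using path_arc[OF *(1,7,14), unfolded *(3,4)] by (elim exE conjE)
  obtain h where h: "arc h" "pathstart h = p a" "pathfinish h = p b" "path_image h = gim (path_edges ys)"
    using path_arc[OF *(2,8,15), unfolded *(5,6)] by (elim exE conjE)
  have i: "path_image g \<inter> path_image h = {p a, p b}" unfolding g h by (rule two_paths[OF *(1-9,12,14,15)])
  have cv: "path_image g \<union> path_image h = curve vs"
    unfolding g h curve_def *(11)[symmetric] gim_Un ..
  note J = Jordan_inside_outside[OF theta_loop(1,2)[OF g(1-3) h(1-3) i], unfolded theta_loop(3)[OF g(1-3) h(1-3) i] cv]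
  show "open (inside (curve vs))" using J by (elim conjE)
  show "Topological_Spaces.connected (inside (curve vs))" using J by (elim conjE)
  show "open (outside (curve vs))" using J by (elim conjE)
  show "frontier (inside (curve vs)) = curve vs" using J by (elim conjE)
  show "frontier (outside (curve vs)) = curve vs" using J by (elim conjE)
qed

lemma side:
  assumes "is_cycle vs" "e \<in> E" "e \<notin> cycle_edges vs"
  shows "io e \<subseteq> inside (curve vs) \<or> io e \<subseteq> outside (curve vs)"
proof -
  have d: "io e \<inter> curve vs = {}" using assms io_gim[of e "cycle_edges vs"] by (simp add: curve_def is_cycle_def)
  then have "io e \<inter> inside (curve vs) \<noteq> {} \<or> io e \<inter> outside (curve vs) \<noteq> {}"
    using io_nonempty[OF assms(2)] inside_Un_outside[of "curve vs"] by blast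
  then show ?thesis
    using connected_subset_inside[OF io_connected[OF assms(2)] d]
      connected_subset_outside[OF io_connected[OF assms(2)] d] by blast
qed

lemma side_inside:
  assumes "is_cycle vs" "e \<in> E" "io e \<subseteq> inside (curve vs)"
  shows "im e \<subseteq> curve vs \<union> inside (curve vs)"
proof -
  have "im e \<subseteq> closure (inside (curve vs))"
    using im_subset_closure[OF assms(2)] closure_mono[OF assms(3)] by blast
  also have "\<dots> = inside (curve vs) \<union> curve vs"
    using curve_jordan(4)[OF assms(1)] closure_Un_frontier[of "inside (curve vs)"] by (metis (no_types))
  finally show ?thesis by blast
qed

lemma side_outside:
  assumes "is_cycle vs" "e \<in> E" "io e \<subseteq> outside (curve vs)"
  shows "im e \<subseteq> curve vs \<union> outside (curve vs)"
proof -
  have "im e \<subseteq> closure (outside (curve vs))"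
    using im_subset_closure[OF assms(2)] closure_mono[OF assms(3)] by blast
  also have "\<dots> = outside (curve vs) \<union> curve vs"
    using curve_jordan(5)[OF assms(1)] closure_Un_frontier[of "outside (curve vs)"] by (metis (no_types))
  finally show ?thesis by blast
qed

text \<open>The closure of a side adds only points of the curve, so an end off the cycle cannot be
  on the other side than its edge. Sides therefore propagate along any walk that stays off the
  cycle.\<close>

lemma side_vertex:
  assumes "is_cycle vs" "e \<in> E" "x \<in> e" "x \<notin> set vs" and R: "R = inside (curve vs) \<or> R = outside (curve vs)"
  shows "io e \<subseteq> R \<longleftrightarrow> p x \<in> R"
proof -
  have "x \<in> V" using subsetD[OF E_subset[OF assms(2)] assms(3)] .
  then have px: "p x \<notin> curve vs" "p x \<in> im e"
    using curve_vertex[OF assms(1)] im_vertex[OF assms(2)] assms(3,4) by simp_all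
  have "vs \<noteq> []" using assms(1) by (auto simp: is_cycle_def)
  then have "e \<notin> cycle_edges vs" using cycle_edges_subset[of e vs] assms(3,4) by auto
  from side[OF assms(1,2) this] consider "io e \<subseteq> inside (curve vs)" "p x \<in> inside (curve vs)" |
      "io e \<subseteq> outside (curve vs)" "p x \<in> outside (curve vs)"
    using side_inside[OF assms(1,2)] side_outside[OF assms(1,2)] px by blast
  then show ?thesis
  proof cases
    case 1
    then show ?thesis using R io_nonempty[OF assms(2)] inside_Int_outside[of "curve vs"] by blast
  next
    case 2
    then show ?thesis using R io_nonempty[OF assms(2)] inside_Int_outside[of "curve vs"] by blast
  qed
qed

text \<open>The closed disc bounded by the cycle. With closed discs, the counts of two adjacent
  discs overlap exactly in the path that separates them.\<close>

definition region :: "'a list \<Rightarrow> complex set" where "region vs = curve vs \<union> inside (curve vs)"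
definition E_in :: "'a list \<Rightarrow> 'a set set" where "E_in vs = {e \<in> E. im e \<subseteq> region vs}"
definition V_in :: "'a list \<Rightarrow> 'a set" where "V_in vs = {v \<in> V. p v \<in> region vs}"

lemma E_in_iff:
  assumes c: "is_cycle vs" and e: "e \<in> E"
  shows "e \<in> E_in vs \<longleftrightarrow> e \<in> cycle_edges vs \<or> io e \<subseteq> inside (curve vs)"
proof
  assume "e \<in> E_in vs"
  then have "im e \<subseteq> region vs" by (simp add: E_in_def)
  moreover obtain z where z: "z \<in> io e" using io_nonempty[OF e] by blast
  ultimately have "z \<in> region vs" by (auto simp: io_def)
  then have "z \<notin> outside (curve vs)" by (auto simp: region_def inside_def outside_def)
  then have "\<not> io e \<subseteq> outside (curve vs)" using z by blast
  then show "e \<in> cycle_edges vs \<or> io e \<subseteq> inside (curve vs)" using side[OF c e] by blast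
next
  assume "e \<in> cycle_edges vs \<or> io e \<subseteq> inside (curve vs)"
  then show "e \<in> E_in vs"
  proof
    assume "e \<in> cycle_edges vs"
    then show ?thesis using e by (auto simp: E_in_def region_def curve_def gim_def)
  next
    assume "io e \<subseteq> inside (curve vs)"
    from side_inside[OF c e this] show ?thesis using e by (simp add: E_in_def region_def)
  qed
qed

end

section \<open>Cutting the disc of a cycle along an ear\<close>

lemma (in plane_graph) io_subset_gim: "F \<subseteq> E \<Longrightarrow> e \<in> F \<Longrightarrow> io e \<subseteq> gim F - p ` V"
proof -
  assume "F \<subseteq> E" "e \<in> F"
  then have e: "e \<in> E" by auto
  have "p v \<notin> io e" if "v \<in> V" for v
    using im_vertex[OF e that] by (auto simp: io_def)
  moreover have "io e \<subseteq> gim F" using \<open>e \<in> F\<close> by (auto simp: io_def gim_def)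
  ultimately show ?thesis by blast
qed

text \<open>The last condition does not follow from the one before it: a path of one edge has no
  inner vertex and could be an edge of the cycle.\<close>

locale ear = plane_graph +
  fixes vs :: "'a list" and a b :: 'a and ps :: "'a list"
  assumes vs: "is_cycle vs" "a \<in> set vs" "b \<in> set vs" "a \<noteq> b"
    and ps: "distinct ps" "2 \<le> length ps" "hd ps = a" "last ps = b" "path_edges ps \<subseteq> E"
    and i: "set ps \<inter> set vs = {a, b}" "path_edges ps \<inter> cycle_edges vs = {}"

text \<open>The two arcs of the cycle and the ear as curves \<open>g\<close>, \<open>h\<close>,
  \<open>k\<close> with common ends; \<open>us\<close> and \<open>ws\<close> are the two cycles
  through the ear. The length inequalities provide the decrease for the later induction.\<close>

locale theta = ear +
  fixes us ws :: "'a list" and X Y :: "'a set set" and g h k :: "real \<Rightarrow> complex"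
  assumes theta: "is_cycle us" "is_cycle ws"
    "arc g" "pathstart g = p a" "pathfinish g = p b"
    "arc h" "pathstart h = p a" "pathfinish h = p b"
    "arc k" "pathstart k = p a" "pathfinish k = p b"
    "path_image g \<inter> path_image h = {p a, p b}" "path_image g \<inter> path_image k = {p a, p b}"
    "path_image h \<inter> path_image k = {p a, p b}"
    "curve vs = path_image g \<union> path_image h" "curve us = path_image g \<union> path_image k"
    "curve ws = path_image h \<union> path_image k" "path_image k = gim (path_edges ps)"
    "cycle_edges vs = X \<union> Y" "cycle_edges us = X \<union> path_edges ps" "cycle_edges ws = Y \<union> path_edges ps"
    "X \<inter> Y = {}" "length us + length ws + 2 = length vs + 2 * length ps"
    "length ps \<le> length us" "length ps \<le> length ws"

context ear
begin

lemma ex_theta: "\<exists>us ws X Y g h k. theta V E p c vs a b ps us ws X Y g h k"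
proof -
  obtain xs ys where xy: "cycle_parts vs a b xs ys" by (rule cycle_two_paths[OF vs])
  note * = cycle_parts.parts[OF xy] cycle_parts_E[OF vs(1) xy]
  have xp: "set xs \<inter> set ps = {a, b}" "set ys \<inter> set ps = {a, b}" using *(9,10) i(1) by blast+
  have ep: "path_edges xs \<inter> path_edges ps = {}" "path_edges ys \<inter> path_edges ps = {}"
    using *(11) i(2) by blast+
  obtain us where us: "distinct us" "3 \<le> length us" "cycle_edges us = path_edges xs \<union> path_edges ps"
    "set us = set xs \<union> set ps" "length us + 2 = length xs + length ps"
    by (rule cycle_join[OF *(1,3,4,7) ps(1,3,4,2) xp(1) ep(1)])
  obtain ws where ws: "distinct ws" "3 \<le> length ws" "cycle_edges ws = path_edges ys \<union> path_edges ps"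
    "set ws = set ys \<union> set ps" "length ws + 2 = length ys + length ps"
    by (rule cycle_join[OF *(2,5,6,8) ps(1,3,4,2) xp(2) ep(2)])
  obtain g where g: "arc g" "pathstart g = p a" "pathfinish g = p b" "path_image g = gim (path_edges xs)"
    using path_arc[OF *(1,7,14), unfolded *(3,4)] by (elim exE conjE)
  obtain h where h: "arc h" "pathstart h = p a" "pathfinish h = p b" "path_image h = gim (path_edges ys)"
    using path_arc[OF *(2,8,15), unfolded *(5,6)] by (elim exE conjE)
  obtain k where k: "arc k" "pathstart k = p a" "pathfinish k = p b" "path_image k = gim (path_edges ps)"
    using path_arc[OF ps(1,2,5), unfolded ps(3,4)] by (elim exE conjE)
  have "path_image g \<inter> path_image h = {p a, p b}"
    unfolding g h by (rule two_paths[OF *(1-9,12,14,15)])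
  moreover have "path_image g \<inter> path_image k = {p a, p b}"
    unfolding g k by (rule two_paths[OF *(1) ps(1) *(3,4) ps(3,4) *(7) ps(2) xp(1) ep(1) *(14) ps(5)])
  moreover have "path_image h \<inter> path_image k = {p a, p b}"
    unfolding h k by (rule two_paths[OF *(2) ps(1) *(5,6) ps(3,4) *(8) ps(2) xp(2) ep(2) *(15) ps(5)])
  moreover have "is_cycle us" "is_cycle ws" using us ws *(14,15) ps(5) by (auto simp: is_cycle_def)
  moreover have "curve vs = path_image g \<union> path_image h" "curve us = path_image g \<union> path_image k"
    "curve ws = path_image h \<union> path_image k"
    unfolding g h k curve_def us ws *(11)[symmetric] gim_Un by simp_all
  moreover have "length us + length ws + 2 = length vs + 2 * length ps"
    "length ps \<le> length us" "length ps \<le> length ws"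
    using us(5) ws(5) *(7,8,13) by linarith+
  ultimately have "theta V E p c vs a b ps us ws (path_edges xs) (path_edges ys) g h k"
    using ear_axioms g h k us(3) ws(3) *(11,12) by (simp add: theta_def theta_axioms_def)
  then show ?thesis by blast
qed

end

context theta
begin

lemma first_edge: "\<exists>e. e \<in> path_edges ps"
  using path_edges_cover[OF ps(2), of "hd ps"] ps(2) by (cases ps) auto

text \<open>The ear divides the closed disc of \<open>vs\<close> into those of \<open>us\<close> and
  \<open>ws\<close>, which share exactly the ear, so both counts are inclusion and exclusion. A path
  has one edge less than vertices, hence the \<open>+ 1\<close>. The decrease is strict because each
  new disc contains its boundary cycle, which has at least \<open>length ps\<close> edges.\<close>

lemma count_split:
  assumes ins: "gim (path_edges ps) - {p a, p b} \<subseteq> inside (curve vs)"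
  shows "card (E_in us) + card (E_in ws) + 1 = card (E_in vs) + length ps"
    "card (V_in us) + card (V_in ws) = card (V_in vs) + length ps"
    "card (E_in us) < card (E_in vs)" "card (E_in ws) < card (E_in vs)"
proof -
  note * = theta
  have ab: "a \<in> V" "b \<in> V" "p a \<noteq> p b"
    using cycle_in_V[OF vs(1)] vs(2-4) inj_p by (auto simp: inj_on_def)
  let ?I = "inside (curve vs)" and ?Iu = "inside (curve us)" and ?Iw = "inside (curve ws)"
  let ?P = "path_image k"
  obtain e0 where e0: "e0 \<in> path_edges ps" using first_edge ..
  have ab_nI: "p a \<notin> ?I" "p b \<notin> ?I"
    using inside_no_overlap[of "curve vs"] *(12,15) by blast+
  have "io e0 \<subseteq> ?P" using io_subset_gim[OF ps(5) e0] *(18) by blast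
  moreover have "io e0 \<subseteq> ?I" using io_subset_gim[OF ps(5) e0] ins ab by blast
  ultimately have ne: "?P \<inter> inside (path_image g \<union> path_image h) \<noteq> {}"
    using io_nonempty[of e0] e0 ps(5) unfolding *(15) by blast
  have spl: "?Iu \<inter> ?Iw = {}" "?Iu \<union> ?Iw \<union> (?P - {p a, p b}) = ?I"
    using split_inside_simple_closed_curve[OF arc_imp_simple_path[OF *(3)] *(4,5)
        arc_imp_simple_path[OF *(6)] *(7,8) arc_imp_simple_path[OF *(9)] *(10,11) ab(3) *(12-14) ne]
    unfolding *(15-17) by blast+
  have disj: "?I \<inter> curve vs = {}" "?Iu \<inter> curve us = {}" "?Iw \<inter> curve ws = {}" by auto
  have XE: "X \<subseteq> E" "Y \<subseteq> E" using vs(1) *(19) by (auto simp: is_cycle_def)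
  have EI: "e \<in> E_in zs \<longleftrightarrow> e \<in> E \<and> (e \<in> cycle_edges zs \<or> io e \<subseteq> inside (curve zs))"
    if "is_cycle zs" for e zs
    using E_in_iff[OF that, of e] by (auto simp: E_in_def)
  have Pio: "io e \<subseteq> ?I" if "e \<in> path_edges ps" for e
    using io_subset_gim[OF ps(5) that] ins ab by blast
  have sideE: "e \<in> E_in zs" if "is_cycle zs" "e \<in> E" "z \<in> io e" "z \<in> inside (curve zs)" for e z zs
  proof (cases "e \<in> cycle_edges zs")
    case False
    from side[OF that(1,2) this] have "io e \<subseteq> inside (curve zs)"
      using that(3,4) inside_Int_outside[of "curve zs"] by blast
    then show ?thesis using EI[OF that(1)] that(2) by blast
  qed (use EI[OF that(1)] that(2) in blast)
  have un: "E_in us \<union> E_in ws = E_in vs"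
  proof
    show "E_in us \<union> E_in ws \<subseteq> E_in vs"
    proof
      fix e assume e: "e \<in> E_in us \<union> E_in ws"
      then have "e \<in> E" "e \<in> X \<union> Y \<union> path_edges ps \<or> io e \<subseteq> ?Iu \<or> io e \<subseteq> ?Iw"
        using EI[OF *(1)] EI[OF *(2)] *(20,21) by blast+
      moreover have "?Iu \<subseteq> ?I" "?Iw \<subseteq> ?I" using spl(2) by blast+
      ultimately show "e \<in> E_in vs" using EI[OF vs(1)] *(19) Pio[of e] by blast
    qed
    show "E_in vs \<subseteq> E_in us \<union> E_in ws"
    proof
      fix e assume e: "e \<in> E_in vs"
      then have eE: "e \<in> E" using EI[OF vs(1)] by blast
      show "e \<in> E_in us \<union> E_in ws"
      proof (cases "e \<in> X \<union> Y \<union> path_edges ps")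
        case True
        then show ?thesis using EI[OF *(1)] EI[OF *(2)] *(20,21) eE by blast
      next
        case False
        then have io: "io e \<subseteq> ?I" using e EI[OF vs(1)] *(19) by blast
        obtain z where z: "z \<in> io e" using io_nonempty[OF eE] by blast
        have "z \<notin> ?P" using io_gim[OF eE ps(5)] False z *(18) by blast
        then have "z \<in> ?Iu \<or> z \<in> ?Iw" using io z spl(2) by blast
        then show ?thesis using sideE[OF *(1) eE z] sideE[OF *(2) eE z] by blast
      qed
    qed
  qed
  have int: "E_in us \<inter> E_in ws = path_edges ps"
  proof
    show "path_edges ps \<subseteq> E_in us \<inter> E_in ws"
      using EI[OF *(1)] EI[OF *(2)] *(20,21) ps(5) by blast
    show "E_in us \<inter> E_in ws \<subseteq> path_edges ps"
    proof
      fix e assume e: "e \<in> E_in us \<inter> E_in ws"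
      then have eE: "e \<in> E" using EI[OF *(1)] by blast
      obtain z where z: "z \<in> io e" using io_nonempty[OF eE] by blast
      show "e \<in> path_edges ps"
      proof (rule ccontr)
        assume np: "e \<notin> path_edges ps"
        have 1: "e \<in> X \<or> z \<in> ?Iu" "e \<in> Y \<or> z \<in> ?Iw"
          using e EI[OF *(1)] EI[OF *(2)] *(20,21) np z by blast+
        have "z \<in> curve vs" if "e \<in> X \<union> Y"
          using io_subset_gim[of "X \<union> Y" e] XE that z *(19) by (auto simp: curve_def)
        moreover have "z \<in> ?I" if "z \<in> ?Iu \<or> z \<in> ?Iw" using that spl(2) by blast
        ultimately show False using 1 spl(1) *(22) disj(1) by blast
      qed
    qed
  qed
  have reg: "region us \<union> region ws = region vs" "region us \<inter> region ws = ?P"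
  proof -
    have kI: "?P \<subseteq> ?I \<union> {p a, p b}" using ins *(18) by blast
    have gab: "p a \<in> path_image g" "p b \<in> path_image g" using *(12) by blast+
    show "region us \<union> region ws = region vs"
      unfolding region_def *(15-17)
      using spl(2)[unfolded *(15-17)] kI[unfolded *(15)] gab by blast
    have d: "path_image g \<inter> ?Iw = {}" "path_image h \<inter> ?Iu = {}"
      using disj(1) spl(2) *(15) by blast+
    have "path_image g \<inter> path_image h \<subseteq> ?P" using *(12,13) by blast
    then show "region us \<inter> region ws = ?P"
      unfolding region_def using d spl(1) *(16,17) by blast
  qed
  have Vun: "V_in us \<union> V_in ws = V_in vs" unfolding V_in_def using reg(1) by blast
  have "V_in us \<inter> V_in ws = {v \<in> V. p v \<in> ?P}" unfolding V_in_def using reg(2) by blast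
  also have "\<dots> = set ps"
  proof -
    have "set ps \<subseteq> V" using Union_path_edges[OF ps(2)] ps(5) E_subset by blast
    then show ?thesis using gim_vertex[OF ps(5)] Union_path_edges[OF ps(2)] *(18) by auto
  qed
  finally have Vint: "V_in us \<inter> V_in ws = set ps" .
  have finE: "finite (E_in zs)" "finite (V_in zs)" for zs
    using finite_E finite_V by (auto simp: E_in_def V_in_def)
  have cE: "card (E_in us) + card (E_in ws) = card (E_in vs) + card (path_edges ps)"
    using card_Un_Int[OF finE(1)[of us] finE(1)[of ws]] un int by simp
  then have c1: "card (E_in us) + card (E_in ws) + 1 = card (E_in vs) + length ps"
    using card_path_edges[OF ps(1)] ps(2) by simp
  have cV: "card (V_in us) + card (V_in ws) = card (V_in vs) + length ps"
    using card_Un_Int[OF finE(2)[of us] finE(2)[of ws]] Vun Vint distinct_card[OF ps(1)] by simp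
  have len: "length zs \<le> card (E_in zs)" if "is_cycle zs" for zs
  proof -
    have "cycle_edges zs \<subseteq> E_in zs" using EI[OF that] that by (auto simp: is_cycle_def)
    from card_mono[OF finE(1) this] show ?thesis
      using card_cycle_edges[of zs] that by (simp add: is_cycle_def)
  qed
  show "card (E_in us) + card (E_in ws) + 1 = card (E_in vs) + length ps" by (rule c1)
  show "card (V_in us) + card (V_in ws) = card (V_in vs) + length ps" by (rule cV)
  show "card (E_in us) < card (E_in vs)" "card (E_in ws) < card (E_in vs)"
    by (use c1 len[OF *(1)] len[OF *(2)] *(24,25) in linarith)+
qed

text \<open>One of the two cycles through the ear encloses the whole disc of \<open>vs\<close>, and
  it also contains the edges of the ear, which lie outside that disc.\<close>

lemma outer_cycle:
  assumes outs: "gim (path_edges ps) - {p a, p b} \<subseteq> outside (curve vs)"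
  shows "\<exists>us. is_cycle us \<and> card (E_in vs) < card (E_in us)"
proof -
  note * = theta
  have "path_image k - {p a, p b} \<subseteq> outside (path_image g \<union> path_image h)"
    using outs unfolding *(15,18) .
  from theta_outside[OF *(3-14) this]
  have "region vs \<subseteq> region ws \<or> region vs \<subseteq> region us"
  proof
    assume t: "inside (path_image g \<union> path_image h) \<subseteq> inside (path_image h \<union> path_image k) \<and>
      path_image g - {p a, p b} \<subseteq> inside (path_image h \<union> path_image k)"
    have "{p a, p b} \<subseteq> path_image h" using *(12) by blast
    then show ?thesis using t unfolding region_def *(15-17) by blast
  next
    assume t: "inside (path_image g \<union> path_image h) \<subseteq> inside (path_image g \<union> path_image k) \<and>
      path_image h - {p a, p b} \<subseteq> inside (path_image g \<union> path_image k)"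
    have "{p a, p b} \<subseteq> path_image g" using *(12) by blast
    then show ?thesis using t unfolding region_def *(15-17) by blast
  qed
  then obtain zs where zs: "is_cycle zs" "region vs \<subseteq> region zs" "path_edges ps \<subseteq> cycle_edges zs"
    using *(1,2,20,21) by blast
  obtain e0 where e0: "e0 \<in> path_edges ps" using first_edge ..
  then have e0E: "e0 \<in> E" using ps(5) by blast
  have "io e0 \<subseteq> outside (curve vs)"
  proof -
    have "a \<in> V" "b \<in> V" using cycle_in_V[OF vs(1)] vs(2,3) by auto
    then show ?thesis using io_subset_gim[OF ps(5) e0] outs by blast
  qed
  then have "e0 \<notin> E_in vs"
    using E_in_iff[OF vs(1) e0E] e0 i(2) io_nonempty[OF e0E] inside_Int_outside[of "curve vs"] by blast
  moreover have "e0 \<in> E_in zs" using E_in_iff[OF zs(1) e0E] zs(3) e0 by blast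
  moreover have "E_in vs \<subseteq> E_in zs" using zs(2) by (auto simp: E_in_def)
  ultimately have "E_in vs \<subset> E_in zs" by blast
  moreover have "finite (E_in zs)" using finite_E by (simp add: E_in_def)
  ultimately show ?thesis using zs(1) psubset_card_mono by blast
qed

end

section \<open>The face bound for connected bridgeless plane graphs with degrees 2 and 3\<close>

locale plane_graph23 = plane_graph +
  fixes g :: nat
  assumes deg: "v \<in> V \<Longrightarrow> card {e \<in> E. v \<in> e} \<in> {2, 3}"
    and conn: "v \<in> V \<Longrightarrow> w \<in> V \<Longrightarrow> (v, w) \<in> {(x, y). {x, y} \<in> E}\<^sup>*"
    and bridgeless: "{x, y} \<in> E \<Longrightarrow> (x, y) \<in> {(u, v). {u, v} \<in> E \<and> {u, v} \<noteq> {x, y}}\<^sup>*"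
    and nonempty: "V \<noteq> {}"
    and girth: "is_cycle vs \<Longrightarrow> g \<le> length vs"
begin

lemma edge_exists:
  assumes "v \<in> V" shows "\<exists>e\<in>E. v \<in> e"
proof (rule ccontr)
  assume "\<not> ?thesis"
  then have "{e \<in> E. v \<in> e} = {}" by blast
  with deg[OF assms] show False by simp
qed

lemma cycle_exists: "\<exists>vs. is_cycle vs"
proof -
  obtain v e where e: "e \<in> E" using nonempty edge_exists by blast
  obtain x y where xy: "x \<noteq> y" "e = {x, y}" using edgeE[OF e] by blast
  have "(x, y) \<in> {(u, v). {u, v} \<in> E \<and> {u, v} \<noteq> {x, y}}\<^sup>*" using bridgeless e xy by simp
  from rtrancl_first_hit[OF this, of "{y}"] xy obtain qs where qs: "distinct qs" "2 \<le> length qs"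
    "hd qs = x" "last qs = y" "successively (\<lambda>u v. (u, v) \<in> {(u, v). {u, v} \<in> E \<and> {u, v} \<noteq> {x, y}}) qs" by auto
  have pe: "path_edges qs \<subseteq> E - {{x, y}}"
    using qs(5) unfolding path_edges_successively by simp
  obtain q r where q: "qs = q # r" "r \<noteq> []"
  proof -
    have "qs = hd qs # tl qs" "tl qs \<noteq> []" using qs(2) by (cases qs; force)+
    then show thesis by (rule that)
  qed
  have "length qs \<noteq> 2"
  proof
    assume "length qs = 2"
    then have "qs = [x, y]" using qs(3,4) q by (cases r) auto
    then show False using pe by auto
  qed
  moreover have "cycle_edges qs = insert {y, x} (path_edges qs)"
    unfolding cycle_edges_def using path_edges_snoc[of qs "hd qs"] qs(3,4) q by simp
  ultimately have "is_cycle qs"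
    using qs(1,2) pe e xy(2) by (auto simp: is_cycle_def insert_commute)
  then show ?thesis ..
qed

text \<open>On a walk from an end of \<open>f\<close> to the cycle, all vertices before the first
  contact lie in \<open>R\<close>, and so does the edge of contact.\<close>

lemma boundary_edge:
  assumes vs: "is_cycle vs" and R: "R = inside (curve vs) \<or> R = outside (curve vs)"
    and f: "f \<in> E" "f \<notin> cycle_edges vs" "io f \<subseteq> R"
  obtains a z where "a \<in> set vs" "{a, z} \<in> E" "a \<noteq> z" "{a, z} \<notin> cycle_edges vs" "io {a, z} \<subseteq> R"
proof -
  have vsne: "vs \<noteq> []" using vs by (auto simp: is_cycle_def)
  obtain x y where xy: "x \<noteq> y" "f = {x, y}" "x \<in> V" using edgeE[OF f(1)] by blast
  have *: "\<exists>a z. a \<in> set vs \<and> {a, z} \<in> E \<and> a \<noteq> z \<and> {a, z} \<notin> cycle_edges vs \<and> io {a, z} \<subseteq> R"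
    if "(x, hd vs) \<in> {(x, y). {x, y} \<in> E}\<^sup>*" "x \<notin> set vs" "p x \<in> R" for x
    using that
  proof (induction rule: converse_rtrancl_induct)
    case base
    then show ?case using vsne by simp
  next
    case (step x z)
    then have e: "{x, z} \<in> E" by simp
    have io: "io {x, z} \<subseteq> R" using side_vertex[OF vs e _ step(4) R] step(5) by simp
    have nc: "{x, z} \<notin> cycle_edges vs" using cycle_edges_subset[of "{x, z}" vs] vsne step(4) by auto
    show ?case
    proof (cases "z \<in> set vs")
      case True
      then show ?thesis using e io nc step(4)
        by (intro exI[of _ z] exI[of _ x]) (auto simp: insert_commute)
    next
      case False
      have "p z \<in> R" using side_vertex[OF vs e _ False R] io by simp
      with step(3)[OF False] show ?thesis by blast
    qed
  qed
  show thesis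
  proof (cases "x \<in> set vs")
    case True
    then show thesis using that[of x y] f xy by simp
  next
    case False
    have "p x \<in> R" using side_vertex[OF vs f(1) _ False R] f(3) xy(2) by simp
    moreover have "(x, hd vs) \<in> {(x, y). {x, y} \<in> E}\<^sup>*"
      using conn[OF xy(3), of "hd vs"] cycle_in_V[OF vs] hd_in_set[OF vsne] by blast
    ultimately show thesis using * False that by blast
  qed
qed

text \<open>A walk that leaves the cycle and comes back cannot return to its starting vertex, as that vertex
  has degree at most three.\<close>

lemma ear_exists:
  assumes vs: "is_cycle vs" and R: "R = inside (curve vs) \<or> R = outside (curve vs)"
    and f: "f \<in> E" "f \<notin> cycle_edges vs" "io f \<subseteq> R"
  obtains a b ps where "ear V E p c vs a b ps" "gim (path_edges ps) - {p a, p b} \<subseteq> R"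
proof -
  have vsne: "vs \<noteq> []" using vs by (auto simp: is_cycle_def)
  obtain a z where az: "a \<in> set vs" "{a, z} \<in> E" "a \<noteq> z" "{a, z} \<notin> cycle_edges vs" "io {a, z} \<subseteq> R"
    by (rule boundary_edge[OF vs R f])
  have "\<exists>b ps. b \<in> set vs \<and> a \<noteq> b \<and> distinct ps \<and> 2 \<le> length ps \<and> hd ps = a \<and> last ps = b \<and>
      path_edges ps \<subseteq> E \<and> set ps \<inter> set vs = {a, b} \<and> path_edges ps \<inter> cycle_edges vs = {} \<and>
      {a, z} \<in> path_edges ps"
  proof (cases "z \<in> set vs")
    case True
    then show ?thesis using az by (intro exI[of _ z] exI[of _ "[a, z]"]) auto
  next
    case False
    let ?A = "{(u, v). {u, v} \<in> E \<and> {u, v} \<noteq> {z, a}}"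
    \<comment> \<open>The edge \<open>{a, z}\<close> is no bridge, so \<open>z\<close> can get back
      to the cycle without it; the first vertex hit ends the ear.\<close>
    have "(z, a) \<in> ?A\<^sup>*" using bridgeless[of z a] az(2) by (simp add: insert_commute)
    from rtrancl_first_hit[OF this False az(1)] obtain qs where qs: "distinct qs" "2 \<le> length qs" "hd qs = z"
      "last qs \<in> set vs" "set (butlast qs) \<inter> set vs = {}" "successively (\<lambda>x y. (x, y) \<in> ?A) qs" by auto
    have pe: "path_edges qs \<subseteq> E - {{z, a}}"
      using qs(6) unfolding path_edges_successively by simp
    have qne: "qs \<noteq> []" using qs(2) by auto
    have sq: "set qs = insert (last qs) (set (butlast qs))"
      using qne by (metis append_butlast_last_id insert_code(1) rotate1.simps(2) set_rotate1 list.simps(15) Un_insert_right set_append sup_bot.right_neutral empty_set)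
    have nc: "e \<notin> cycle_edges vs" if "e \<in> path_edges qs" for e
    proof
      assume "e \<in> cycle_edges vs"
      then have "e \<subseteq> {last qs}"
        using cycle_edges_subset[OF _ vsne] path_edges_subset[OF that] qs(5) sq by blast
      moreover have "e \<in> E" using that pe by blast
      ultimately show False using edgeE[of e] by force
    qed
    have "last qs \<noteq> a"
    proof
      assume la: "last qs = a"
      obtain rs where rs: "qs = rs @ [a]" using qne la by (metis append_butlast_last_id)
      have rne: "rs \<noteq> []" using qs(2) rs by auto
      have e2: "{last rs, a} \<in> path_edges qs" unfolding rs using path_edges_snoc[OF rne] by simp
      have e2n: "{last rs, a} \<noteq> {a, z}" using e2 pe by (auto simp: insert_commute)
      have "\<exists>b\<in>set vs. b \<noteq> a"
      proof -
        have "distinct vs" "3 \<le> length vs" using vs by (auto simp: is_cycle_def)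
        then have "card (set vs) \<ge> 3" by (simp add: distinct_card)
        then have "\<not> set vs \<subseteq> {a}" using card_mono[of "{a}" "set vs"] by auto
        then show ?thesis by blast
      qed
      then obtain b where b: "b \<in> set vs" "a \<noteq> b" by blast
      obtain xs ys where xy: "cycle_parts vs a b xs ys" by (rule cycle_two_paths[OF vs az(1) b])
      note * = cycle_parts.parts[OF xy] cycle_parts_E[OF vs xy]
      have "a \<in> set xs" "a \<in> set ys" using *(9) by blast+
      then obtain e3 e4 where e34: "e3 \<in> path_edges xs" "a \<in> e3" "e4 \<in> path_edges ys" "a \<in> e4"
        using path_edges_cover[OF *(7)] path_edges_cover[OF *(8)] by blast
      have c34: "e3 \<in> cycle_edges vs" "e4 \<in> cycle_edges vs" "e3 \<noteq> e4" using e34 *(11,12) by blast+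
      have n: "{last rs, a} \<notin> cycle_edges vs" using nc e2 by blast
      have "{{a, z}, {last rs, a}, e3, e4} \<subseteq> {e \<in> E. a \<in> e}"
        using az(2) e2 pe e34 *(14,15) by blast
      moreover have "finite {e \<in> E. a \<in> e}" using finite_E by simp
      moreover have "card {{a, z}, {last rs, a}, e3, e4} = 4"
      proof -
        have "{a, z} \<noteq> e3" "{a, z} \<noteq> e4" "{last rs, a} \<noteq> e3" "{last rs, a} \<noteq> e4"
          using c34 n az(4) by blast+
        then show ?thesis using e2n[symmetric] c34(3) by simp
      qed
      ultimately have "4 \<le> card {e \<in> E. a \<in> e}" by (metis card_mono)
      then show False using deg[of a] cycle_in_V[OF vs] az(1) by auto
    qed
    moreover have "a \<notin> set (butlast qs)" using qs(5) az(1) by blast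
    ultimately have aq: "a \<notin> set qs" by (subst sq) simp
    have "path_edges (a # qs) = insert {a, z} (path_edges qs)" using path_edges_Cons[OF qne] qs(3) by simp
    moreover have "set (a # qs) \<inter> set vs = {a, last qs}" using sq qs(4,5) az(1) by auto
    ultimately show ?thesis
      using aq qs az pe nc \<open>last qs \<noteq> a\<close> qne
      by (intro exI[of _ "last qs"] exI[of _ "a # qs"]) auto
  qed
  then obtain b ps where *: "b \<in> set vs" "a \<noteq> b" "distinct ps" "2 \<le> length ps" "hd ps = a" "last ps = b"
      "path_edges ps \<subseteq> E" "set ps \<inter> set vs = {a, b}" "path_edges ps \<inter> cycle_edges vs = {}"
      "{a, z} \<in> path_edges ps" by blast
  obtain k where k: "arc k" "pathstart k = p a" "pathfinish k = p b" "path_image k = gim (path_edges ps)"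
    using path_arc[OF *(3,4,7), unfolded *(5,6)] by (elim exE conjE)
  let ?K = "gim (path_edges ps) - {p a, p b}"
  have con: "Topological_Spaces.connected ?K" using connected_simple_path_endless[OF arc_imp_simple_path[OF k(1)]] k by simp
  have ce: "cycle_edges vs \<subseteq> E" using vs by (simp add: is_cycle_def)
  have "gim (path_edges ps) \<inter> curve vs = p ` (set ps \<inter> set vs)"
    unfolding curve_def using gim_Int[OF *(7) ce *(9)] Union_path_edges[OF *(4)] Union_cycle_edges[OF vs] by simp
  then have d: "?K \<inter> curve vs = {}" using *(8) by auto
  have ab: "a \<in> V" "b \<in> V" using cycle_in_V[OF vs] az(1) *(1) by auto
  have "io {a, z} \<subseteq> ?K" using io_subset_gim[OF *(7,10)] ab by blast
  then have "?K \<inter> R \<noteq> {}" using az(5) io_nonempty[OF az(2)] by blast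
  then have "?K \<subseteq> R" using R connected_subset_inside[OF con d] connected_subset_outside[OF con d] by blast
  then show thesis
    using that[of a b ps] az(1) vs * plane_graph_axioms by (simp add: ear_def ear_axioms_def)
qed

text \<open>In terms of faces: with \<open>e\<close> edges and \<open>n\<close> vertices the disc
  consists of \<open>e - n + 1\<close> faces, whose lengths add up to \<open>2 e - length vs\<close>
  and are at least \<open>g\<close> each. An empty disc is a single face; otherwise an edge inside
  yields an ear that cuts the disc into two with fewer edges.\<close>

lemma count_inside:
  "is_cycle vs \<Longrightarrow> g * (card (E_in vs) + 1) + length vs \<le> 2 * card (E_in vs) + g * card (V_in vs)"
proof (induction "card (E_in vs)" arbitrary: vs rule: less_induct)
  case less
  note vs = less(2)
  have ce: "cycle_edges vs \<subseteq> E_in vs" using E_in_iff[OF vs] vs unfolding is_cycle_def by blast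
  show ?case
  proof (cases "E_in vs = cycle_edges vs")
    case True
    have "V_in vs = set vs"
    proof
      show "set vs \<subseteq> V_in vs" using curve_vertex[OF vs] cycle_in_V[OF vs] by (auto simp: V_in_def region_def)
      show "V_in vs \<subseteq> set vs"
      proof
        fix v assume v: "v \<in> V_in vs"
        then have vV: "v \<in> V" by (simp add: V_in_def)
        show "v \<in> set vs"
        proof (rule ccontr)
          assume nv: "v \<notin> set vs"
          then have "p v \<in> inside (curve vs)" using v curve_vertex[OF vs vV] by (auto simp: V_in_def region_def)
          moreover obtain e where e: "e \<in> E" "v \<in> e" using edge_exists[OF vV] by blast
          ultimately have "e \<in> E_in vs" using side_vertex[OF vs e nv] E_in_iff[OF vs e(1)] by blast
          then have "v \<in> set vs" using True e(2) Union_cycle_edges[OF vs] by blast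
          then show False using nv by contradiction
        qed
      qed
    qed
    moreover have "distinct vs" "3 \<le> length vs" using vs by (auto simp: is_cycle_def)
    ultimately show ?thesis
      using True card_cycle_edges[of vs] distinct_card[of vs] girth[OF vs] by (simp add: algebra_simps)
  next
    case False
    then obtain f where f: "f \<in> E_in vs" "f \<notin> cycle_edges vs" using ce by blast
    then have fE: "f \<in> E" by (simp add: E_in_def)
    have "io f \<subseteq> inside (curve vs)" using E_in_iff[OF vs fE] f by blast
    then obtain a b ps where ps: "ear V E p c vs a b ps" "gim (path_edges ps) - {p a, p b} \<subseteq> inside (curve vs)"
      using ear_exists[OF vs disjI1[OF refl] fE f(2)] by metis
    obtain us ws X Y h1 h2 h3 where th: "theta V E p c vs a b ps us ws X Y h1 h2 h3"
      using ear.ex_theta[OF ps(1)] by blast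
    note * = theta.theta(1,2,23)[OF th] theta.count_split[OF th ps(2)]
    have "g * (card (E_in us) + 1) + length us + (g * (card (E_in ws) + 1) + length ws)
        \<le> 2 * (card (E_in us) + card (E_in ws)) + g * (card (V_in us) + card (V_in ws))"
      using less(1)[OF *(6,1)] less(1)[OF *(7,2)] by (simp add: algebra_simps)
    also have "\<dots> = 2 * (card (E_in us) + card (E_in ws)) + g * card (V_in vs) + g * length ps"
      unfolding *(5) by (simp add: algebra_simps)
    finally have "g * (card (E_in us) + card (E_in ws) + 1) + g + (length us + length ws)
        \<le> 2 * (card (E_in us) + card (E_in ws)) + g * card (V_in vs) + g * length ps"
      by (simp add: algebra_simps)
    then have "g * (card (E_in vs) + 1) + (length us + length ws)
        \<le> 2 * (card (E_in us) + card (E_in ws)) + g * card (V_in vs)"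
      unfolding *(4) by (simp add: algebra_simps)
    moreover have "A + v \<le> 2 * z + B" if "A + (u + w) \<le> 2 * (x + y) + B" "u + w + 2 = v + 2 * q" "x + y + 1 = z + q"
      for A B u w x y v q z :: nat using that by presburger
    ultimately show ?thesis using *(3,4) by blast
  qed
qed

text \<open>This is \<open>g F \<le> 2 |E|\<close> for the number \<open>F = |E| - |V| + 2\<close> of faces.\<close>

theorem euler_bound: "g * (card E + 2) \<le> 2 * card E + g * card V"
proof -
  \<comment> \<open>A cycle with the most edges in its disc bounds the outer face: an edge outside
    would yield an ear outside and a larger disc.\<close>
  have "\<exists>vs. is_cycle vs \<and> (\<forall>us. is_cycle us \<longrightarrow> card (E_in us) \<le> card (E_in vs))"
  proof -
    have "card (E_in us) \<le> card E" for us using finite_E by (intro card_mono) (auto simp: E_in_def)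
    then show ?thesis
      using ex_has_greatest_nat[of is_cycle _ "\<lambda>us. card (E_in us)" "Suc (card E)"] cycle_exists
      by (auto simp: less_Suc_eq_le)
  qed
  then obtain vs where vs: "is_cycle vs" and mx: "\<And>us. is_cycle us \<Longrightarrow> card (E_in us) \<le> card (E_in vs)"
    by blast
  have "E_in vs = E"
  proof (rule ccontr)
    assume "E_in vs \<noteq> E"
    then obtain f where f: "f \<in> E" "f \<notin> E_in vs" by (auto simp: E_in_def)
    then have fc: "f \<notin> cycle_edges vs" "io f \<subseteq> outside (curve vs)"
      using E_in_iff[OF vs f(1)] side[OF vs f(1)] by blast+
    obtain a b ps where ps: "ear V E p c vs a b ps" "gim (path_edges ps) - {p a, p b} \<subseteq> outside (curve vs)"
      using ear_exists[OF vs disjI2[OF refl] f(1) fc] by metis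
    obtain us ws X Y h1 h2 h3 where th: "theta V E p c vs a b ps us ws X Y h1 h2 h3"
      using ear.ex_theta[OF ps(1)] by blast
    from theta.outer_cycle[OF th ps(2)] obtain us where "is_cycle us" "card (E_in vs) < card (E_in us)" by blast
    with mx show False by fastforce
  qed
  moreover from this have "V_in vs = V"
  proof -
    have "v \<in> V_in vs" if v: "v \<in> V" for v
    proof -
      obtain e where e: "e \<in> E" "v \<in> e" using edge_exists[OF v] by blast
      then have "im e \<subseteq> region vs" using \<open>E_in vs = E\<close> by (auto simp: E_in_def)
      then show ?thesis using im_vertex[OF e(1) v] e(2) v by (auto simp: V_in_def)
    qed
    then show ?thesis by (auto simp: V_in_def)
  qed
  \<comment> \<open>The summand \<open>length vs\<close> is at least \<open>g\<close> and accounts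
    for the outer face.\<close>
  ultimately show ?thesis using count_inside[OF vs] girth[OF vs] by (simp add: algebra_simps)
qed

end

section \<open>Pairs of colors along threads\<close>

datatype color = C1 | C2 | C3 | C4

definition colors :: "color list" where "colors = [C1, C2, C3, C4]"

definition pairs :: "(color \<times> color) list" where
  "pairs = [(C1,C2),(C1,C3),(C1,C4),(C2,C1),(C2,C3),(C2,C4),(C3,C1),(C3,C2),(C3,C4),(C4,C1),(C4,C2),(C4,C3)]"

lemma set_pairs: "set pairs = {(a, b). a \<noteq> b}"
proof -
  have "(a, b) \<in> set pairs \<longleftrightarrow> a \<noteq> b" for a b by (cases a; cases b) (simp_all add: pairs_def)
  then show ?thesis by auto
qed

text \<open>
  A thread with \<open>k\<close> inner vertices whose end has color \<open>a\<close> and whose next vertex has color \<open>b\<close> can be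
  colored such that \<open>(c, d)\<close> are the colors read in the same way from the other end.
\<close>

fun linked :: "nat \<Rightarrow> color \<times> color \<Rightarrow> color \<times> color \<Rightarrow> bool" where
  "linked 0 (a, b) q \<longleftrightarrow> q = (b, a)"
| "linked (Suc k) (a, b) q \<longleftrightarrow> (\<exists>x. x \<noteq> a \<and> x \<noteq> b \<and> linked k (b, x) q)"

text \<open>\<open>linked\<close> consumes a thread from one end; taking off a vertex at the other
  end is what makes its symmetry accessible to induction.\<close>

lemma linked_snoc:
  "a \<noteq> b \<Longrightarrow> c \<noteq> e \<Longrightarrow> linked (Suc k) (a, b) (c, e) \<longleftrightarrow> (\<exists>z. z \<noteq> c \<and> z \<noteq> e \<and> linked k (a, b) (e, z))"
proof (induction k arbitrary: a b)
  case (Suc k)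
  have "linked (Suc (Suc k)) (a, b) (c, e) \<longleftrightarrow> (\<exists>x. x \<noteq> a \<and> x \<noteq> b \<and> linked (Suc k) (b, x) (c, e))" by simp
  also have "\<dots> \<longleftrightarrow> (\<exists>x. x \<noteq> a \<and> x \<noteq> b \<and> (\<exists>z. z \<noteq> c \<and> z \<noteq> e \<and> linked k (b, x) (e, z)))"
    using Suc.IH Suc.prems(2) by metis
  also have "\<dots> \<longleftrightarrow> (\<exists>z. z \<noteq> c \<and> z \<noteq> e \<and> linked (Suc k) (a, b) (e, z))" by auto
  finally show ?case .
qed auto

lemma linked_sym: "a \<noteq> b \<Longrightarrow> c \<noteq> e \<Longrightarrow> linked k (a, b) (c, e) \<Longrightarrow> linked k (c, e) (a, b)"
proof (induction k arbitrary: a b)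
  case (Suc k)
  then obtain x where x: "x \<noteq> a" "x \<noteq> b" "linked k (b, x) (c, e)" by auto
  have "linked k (c, e) (b, x)" using Suc.IH[OF _ Suc.prems(2) x(3)] x(2) by simp
  then show ?case using linked_snoc[of c e a b k] Suc.prems(1,2) x(1,2) by blast
qed auto

text \<open>Sets of ordered pairs of distinct colors, as bit vectors indexed by \<open>pairs\<close>.\<close>

datatype pset = PS bool bool bool bool bool bool bool bool bool bool bool bool

definition mk :: "(color \<Rightarrow> color \<Rightarrow> bool) \<Rightarrow> pset" where
  "mk P = PS (P C1 C2) (P C1 C3) (P C1 C4) (P C2 C1) (P C2 C3) (P C2 C4)
     (P C3 C1) (P C3 C2) (P C3 C4) (P C4 C1) (P C4 C2) (P C4 C3)"

fun has :: "pset \<Rightarrow> color \<Rightarrow> color \<Rightarrow> bool" where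
  "has (PS a12 a13 a14 a21 a23 a24 a31 a32 a34 a41 a42 a43) x y = (case x of
     C1 \<Rightarrow> (case y of C1 \<Rightarrow> False | C2 \<Rightarrow> a12 | C3 \<Rightarrow> a13 | C4 \<Rightarrow> a14)
   | C2 \<Rightarrow> (case y of C1 \<Rightarrow> a21 | C2 \<Rightarrow> False | C3 \<Rightarrow> a23 | C4 \<Rightarrow> a24)
   | C3 \<Rightarrow> (case y of C1 \<Rightarrow> a31 | C2 \<Rightarrow> a32 | C3 \<Rightarrow> False | C4 \<Rightarrow> a34)
   | C4 \<Rightarrow> (case y of C1 \<Rightarrow> a41 | C2 \<Rightarrow> a42 | C3 \<Rightarrow> a43 | C4 \<Rightarrow> False))"

fun flip :: "pset \<Rightarrow> pset" where
  "flip (PS a12 a13 a14 a21 a23 a24 a31 a32 a34 a41 a42 a43) =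
     PS a21 a31 a41 a12 a32 a42 a13 a23 a43 a14 a24 a34"

text \<open>One more inner vertex in front: \<open>(x, y)\<close> is in the result if some
  \<open>(y, z)\<close> with \<open>z\<close> different from \<open>x\<close> is in the set. Written
  out bit by bit for evaluation.\<close>

fun step :: "pset \<Rightarrow> pset" where
  "step (PS a12 a13 a14 a21 a23 a24 a31 a32 a34 a41 a42 a43) =
     PS (a23 \<or> a24) (a32 \<or> a34) (a42 \<or> a43) (a13 \<or> a14) (a31 \<or> a34) (a41 \<or> a43)
        (a12 \<or> a14) (a21 \<or> a24) (a41 \<or> a42) (a12 \<or> a13) (a21 \<or> a23) (a31 \<or> a32)"

text \<open>For \<open>k = 0\<close> the ends are adjacent; each is the next vertex seen from the
  other, so the pair is swapped.\<close>

fun push :: "nat \<Rightarrow> pset \<Rightarrow> pset" where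
  "push 0 S = flip S"
| "push (Suc k) S = step (push k S)"

text \<open>A resulting pair gives the colors of a 3-vertex and of its third neighbor; the two
  branches must give the other neighbors the two remaining colors, in either order.\<close>

fun comb :: "pset \<Rightarrow> pset \<Rightarrow> pset" where
  "comb (PS a12 a13 a14 a21 a23 a24 a31 a32 a34 a41 a42 a43) (PS b12 b13 b14 b21 b23 b24 b31 b32 b34 b41 b42 b43) =
     PS (a13 \<and> b14 \<or> a14 \<and> b13) (a12 \<and> b14 \<or> a14 \<and> b12) (a12 \<and> b13 \<or> a13 \<and> b12)
        (a23 \<and> b24 \<or> a24 \<and> b23) (a21 \<and> b24 \<or> a24 \<and> b21) (a21 \<and> b23 \<or> a23 \<and> b21)
        (a32 \<and> b34 \<or> a34 \<and> b32) (a31 \<and> b34 \<or> a34 \<and> b31) (a31 \<and> b32 \<or> a32 \<and> b31)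
        (a42 \<and> b43 \<or> a43 \<and> b42) (a41 \<and> b43 \<or> a43 \<and> b41) (a41 \<and> b42 \<or> a42 \<and> b41)"

fun overlap :: "pset \<Rightarrow> pset \<Rightarrow> bool" where
  "overlap (PS a12 a13 a14 a21 a23 a24 a31 a32 a34 a41 a42 a43) (PS b12 b13 b14 b21 b23 b24 b31 b32 b34 b41 b42 b43) \<longleftrightarrow>
     a12 \<and> b12 \<or> a13 \<and> b13 \<or> a14 \<and> b14 \<or> a21 \<and> b21 \<or> a23 \<and> b23 \<or> a24 \<and> b24 \<or>
     a31 \<and> b31 \<or> a32 \<and> b32 \<or> a34 \<and> b34 \<or> a41 \<and> b41 \<or> a42 \<and> b42 \<or> a43 \<and> b43"

fun sub :: "pset \<Rightarrow> pset \<Rightarrow> bool" where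
  "sub (PS a12 a13 a14 a21 a23 a24 a31 a32 a34 a41 a42 a43) (PS b12 b13 b14 b21 b23 b24 b31 b32 b34 b41 b42 b43) \<longleftrightarrow>
     (a12 \<longrightarrow> b12) \<and> (a13 \<longrightarrow> b13) \<and> (a14 \<longrightarrow> b14) \<and> (a21 \<longrightarrow> b21) \<and> (a23 \<longrightarrow> b23) \<and> (a24 \<longrightarrow> b24) \<and>
     (a31 \<longrightarrow> b31) \<and> (a32 \<longrightarrow> b32) \<and> (a34 \<longrightarrow> b34) \<and> (a41 \<longrightarrow> b41) \<and> (a42 \<longrightarrow> b42) \<and> (a43 \<longrightarrow> b43)"

fun missing :: "pset \<Rightarrow> nat" where
  "missing (PS a12 a13 a14 a21 a23 a24 a31 a32 a34 a41 a42 a43) =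
     length (filter Not [a12, a13, a14, a21, a23, a24, a31, a32, a34, a41, a42, a43])"

lemma all_color: "(\<forall>x. P x) \<longleftrightarrow> P C1 \<and> P C2 \<and> P C3 \<and> P C4"
  by (metis color.exhaust)

lemma ex_color: "(\<exists>x. P x) \<longleftrightarrow> P C1 \<or> P C2 \<or> P C3 \<or> P C4"
  by (metis color.exhaust)

lemma has_mk [simp]: "has (mk P) x y \<longleftrightarrow> x \<noteq> y \<and> P x y"
  by (cases x; cases y) (simp_all add: mk_def)

lemma has_neq: "has S x y \<Longrightarrow> x \<noteq> y"
  by (cases S; cases x; cases y) simp_all

lemma has_flip: "has (flip S) x y \<longleftrightarrow> has S y x"
  by (cases S; cases x; cases y) simp_all

lemma has_step: "has (step S) x y \<longleftrightarrow> x \<noteq> y \<and> (\<exists>z. z \<noteq> x \<and> z \<noteq> y \<and> has S y z)"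
  by (cases S; cases x; cases y) (simp_all add: ex_color)

lemma has_push: "has (push k S) x y \<longleftrightarrow> x \<noteq> y \<and> (\<exists>a b. linked k (x, y) (a, b) \<and> has S a b)"
proof (induction k arbitrary: x y)
  case 0
  show ?case using has_neq by (auto simp: has_flip)
next
  case (Suc k)
  show ?case by (auto simp: has_step Suc)
qed

lemma has_comb: "has (comb S T) a b \<longleftrightarrow> a \<noteq> b \<and> (\<exists>x y. x \<noteq> a \<and> x \<noteq> b \<and> y \<noteq> a \<and> y \<noteq> b \<and> y \<noteq> x \<and> has S a x \<and> has T a y)"
  by (cases S; cases T; cases a; cases b) (simp_all add: ex_color)

lemma overlap_iff: "overlap S T \<longleftrightarrow> (\<exists>a b. has S a b \<and> has T a b)"
  by (cases S; cases T) (simp add: ex_color disj_ac)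

lemma sub_iff: "sub S T \<longleftrightarrow> (\<forall>a b. has S a b \<longrightarrow> has T a b)"
  by (cases S; cases T) (simp add: all_color)

definition meets :: "pset \<Rightarrow> pset \<Rightarrow> pset \<Rightarrow> bool" where
  "meets S T U \<longleftrightarrow> overlap (comb S T) U"

lemma meets_iff: "meets S T U \<longleftrightarrow> (\<exists>a x y z. a \<noteq> x \<and> a \<noteq> y \<and> a \<noteq> z \<and> x \<noteq> y \<and> x \<noteq> z \<and> y \<noteq> z \<and>
    has S a x \<and> has T a y \<and> has U a z)"
  unfolding meets_def overlap_iff has_comb by (smt (verit))

text \<open>A family lists the sets of which at least one consists of admissible pairs.\<close>

type_synonym family = "pset list"

text \<open>The far end of the thread is already colored: the color of the 3-vertex there and the
  color reserved for its neighbor on the thread form one of twelve pairs, unknown in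
  advance.\<close>

definition leaf :: "nat \<Rightarrow> family" where
  "leaf k = map (\<lambda>(a, b). push k (mk (\<lambda>x y. x = a \<and> y = b))) pairs"

definition node :: "nat \<Rightarrow> family \<Rightarrow> family \<Rightarrow> family" where
  "node k F G = concat (map (\<lambda>S. map (\<lambda>T. push k (comb S T)) G) F)"

text \<open>\<open>G\<close> is the weaker guarantee: whichever member of \<open>F\<close> is
  available, it contains a member of \<open>G\<close>.\<close>

definition covers :: "family \<Rightarrow> family \<Rightarrow> bool" where
  "covers F G \<longleftrightarrow> list_all (\<lambda>S. list_ex (\<lambda>T. sub T S) G) F"

definition reducible :: "family \<Rightarrow> family \<Rightarrow> family \<Rightarrow> bool" where
  "reducible F G H \<longleftrightarrow> list_all (\<lambda>S. list_all (\<lambda>T. list_all (overlap (comb S T)) H) G) F"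

definition missing_le :: "nat \<Rightarrow> family \<Rightarrow> bool" where
  "missing_le n F \<longleftrightarrow> list_all (\<lambda>S. missing S \<le> n) F"

text \<open>The families \<open>fam1\<close> to \<open>fam5\<close> were found by computer: each is small and covers the
  families of some trees.\<close>

definition fam1 :: family where
  "fam1 = map (\<lambda>(a, b). mk (\<lambda>x y. \<not> (x = a \<and> y = b))) pairs"
definition fam2 :: family where
  "fam2 = map (\<lambda>(a, b). mk (\<lambda>x y. x = a \<or> y \<noteq> b)) pairs"
definition fam3 :: family where
  "fam3 = map (\<lambda>b. mk (\<lambda>x y. y \<noteq> b)) colors"
definition fam4 :: family where
  "fam4 = map (\<lambda>(a, b). mk (\<lambda>x y. \<not> (x = a \<and> y = b) \<and> \<not> (x = b \<and> y = a))) pairs"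
definition fam5 :: family where
  "fam5 = map (\<lambda>(a, b). mk (\<lambda>x y. y = a \<or> y = b)) pairs @
     concat (map (\<lambda>(c, d). map (\<lambda>b. mk (\<lambda>x y. \<not> (x = c \<and> y = d) \<and> \<not> (x = d \<and> y = c) \<and> \<not> (x = d \<and> y = b)))
       (filter (\<lambda>b. b \<noteq> c \<and> b \<noteq> d) colors)) pairs)"
text \<open>The exact families of a \<open>(4,4,0)\<close>-vertex and of a
  \<open>(5,3,0)\<close>-vertex entered through the 0-thread, put together; only a bound on the
  missing pairs of its members is used later.\<close>

definition fam0 :: family where
  "fam0 = node 0 (leaf 4) (leaf 4) @ node 0 (leaf 5) (leaf 3)"

text \<open>\<open>node n (leaf a) (leaf b)\<close> is an \<open>(a,b,n)\<close>-vertex entered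
  through its \<open>n\<close>-thread. The fifth and the ninth line are trees with two 3-vertices,
  whose inner family has already been coarsened.\<close>

lemma covers_computed:
  "covers (node 0 (leaf 5) (leaf 5)) fam2"
  "covers (node 0 (leaf 5) (leaf 4)) fam2"
  "covers (node 2 (leaf 5) (leaf 2)) fam4"
  "covers (node 2 (leaf 4) (leaf 2)) fam4"
  "covers (node 0 (leaf 5) fam4) fam2"
  "covers (node 1 (leaf 5) (leaf 3)) fam1"
  "covers (node 1 (leaf 4) (leaf 4)) fam1"
  "covers (node 1 (leaf 5) (leaf 2)) fam5"
  "covers (node 2 (leaf 5) fam5) fam1"
  "covers (node 1 (leaf 4) (leaf 3)) fam3"
  "covers (node 2 (leaf 3) (leaf 3)) fam3"
  by code_simp+

section \<open>Branches\<close>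

text \<open>
  The darts are the threads with a direction and \<open>k\<close> counts the inner vertices. A coloring consists of
  the color \<open>a w\<close> of each \<open>3\<close>-vertex \<open>w\<close> and the color \<open>r d\<close> of the vertex after the source of each dart \<open>d\<close>.
\<close>

locale darts =
  fixes W :: "'w set" and D :: "'d set" and src :: "'d \<Rightarrow> 'w" and rv :: "'d \<Rightarrow> 'd" and k :: "'d \<Rightarrow> nat"
  assumes finite_W: "finite W" and finite_D: "finite D"
    and src_W: "d \<in> D \<Longrightarrow> src d \<in> W"
    and rv_D: "d \<in> D \<Longrightarrow> rv d \<in> D"
    and rv_rv: "d \<in> D \<Longrightarrow> rv (rv d) = d"
    and rv_neq: "d \<in> D \<Longrightarrow> rv d \<noteq> d"
    and three: "w \<in> W \<Longrightarrow> card {d \<in> D. src d = w} = 3"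
    and k_le: "d \<in> D \<Longrightarrow> k d \<le> 5"
    and k_rv: "d \<in> D \<Longrightarrow> k (rv d) = k d"
begin

abbreviation tgt :: "'d \<Rightarrow> 'w" where "tgt d \<equiv> src (rv d)"

definition locally_ok :: "'w set \<Rightarrow> ('w \<Rightarrow> color) \<Rightarrow> ('d \<Rightarrow> color) \<Rightarrow> bool" where
  "locally_ok X a r \<longleftrightarrow> (\<forall>d\<in>D. src d \<in> X \<longrightarrow> r d \<noteq> a (src d) \<and> (\<forall>e\<in>D. src e = src d \<and> e \<noteq> d \<longrightarrow> r e \<noteq> r d))"

definition dart_ok :: "'d \<Rightarrow> ('w \<Rightarrow> color) \<Rightarrow> ('d \<Rightarrow> color) \<Rightarrow> bool" where
  "dart_ok d a r \<longleftrightarrow> linked (k d) (a (src d), r d) (a (tgt d), r (rv d))"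

text \<open>The condition around the vertices of \<open>U\<close> includes the darts that leave
  \<open>U\<close>: colors are reserved for their first vertices, and these are the fixed data at
  the leaves of a removed tree.\<close>

definition valid :: "'w set \<Rightarrow> ('w \<Rightarrow> color) \<Rightarrow> ('d \<Rightarrow> color) \<Rightarrow> bool" where
  "valid U a r \<longleftrightarrow> locally_ok U a r \<and> (\<forall>d\<in>D. src d \<in> U \<and> tgt d \<in> U \<longrightarrow> dart_ok d a r)"

abbreviation recolors ::
    "'w set \<Rightarrow> ('w \<Rightarrow> color) \<Rightarrow> ('d \<Rightarrow> color) \<Rightarrow> ('w \<Rightarrow> color) \<Rightarrow> ('d \<Rightarrow> color) \<Rightarrow> bool" where
  "recolors X a r a' r' \<equiv> (\<forall>v. v \<notin> X \<longrightarrow> a' v = a v) \<and> (\<forall>e. src e \<notin> X \<longrightarrow> r' e = r e) \<and> locally_ok X a' r'"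

fun walk :: "'d list \<Rightarrow> bool" where
  "walk [] \<longleftrightarrow> True"
| "walk [d] \<longleftrightarrow> d \<in> D"
| "walk (d # e # r) \<longleftrightarrow> d \<in> D \<and> src e = tgt d \<and> e \<noteq> rv d \<and> walk (e # r)"

definition weight :: "'d list \<Rightarrow> nat" where "weight ds = (\<Sum>d\<leftarrow>ds. k d + 1)"

lemma weight_simps [simp]: "weight [] = 0" "weight (d # ds) = k d + 1 + weight ds"
  "weight (xs @ ys) = weight xs + weight ys"
  by (simp_all add: weight_def)

lemma walk_D: "walk ds \<Longrightarrow> d \<in> set ds \<Longrightarrow> d \<in> D"
  by (induction ds rule: walk.induct) auto

lemma walk_append:
  "walk xs \<Longrightarrow> walk (e # ys) \<Longrightarrow> xs = [] \<or> src e = tgt (last xs) \<and> e \<noteq> rv (last xs) \<Longrightarrow> walk (xs @ e # ys)"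
  by (induction xs rule: walk.induct) auto

lemma walk_rev: "walk ds \<Longrightarrow> walk (map rv (rev ds))"
proof (induction ds rule: walk.induct)
  case (3 d e r)
  have "walk (map rv (rev (e # r)))" using 3 by simp
  moreover have "walk [rv d]" using 3 rv_D by simp
  moreover have "last (map rv (rev (e # r))) = rv e" by simp
  moreover have "e \<in> D" "d \<in> D" using 3 walk_D[of "e # r" e] by auto
  ultimately have "walk (map rv (rev (e # r)) @ [rv d])"
    using 3(2) rv_rv by (intro walk_append) auto
  then show ?case by simp
qed (auto simp: rv_D)

lemma weight_rev: "set ds \<subseteq> D \<Longrightarrow> weight (map rv (rev ds)) = weight ds"
  by (induction ds) (auto simp: k_rv)

lemma dart_ok_rv:
  assumes "d \<in> D" "dart_ok d a r" "r d \<noteq> a (src d)" "r (rv d) \<noteq> a (tgt d)"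
  shows "dart_ok (rv d) a r"
  using linked_sym[of "a (src d)" "r d" "a (tgt d)" "r (rv d)" "k d"] assms(1,2) assms(3,4)[symmetric]
  by (simp add: dart_ok_def k_rv rv_rv)

end

section \<open>Trees that hang on a dart\<close>

locale long_darts = darts W D src rv k
  for W :: "'w set" and D :: "'d set" and src :: "'d \<Rightarrow> 'w" and rv :: "'d \<Rightarrow> 'd" and k :: "'d \<Rightarrow> nat" +
  assumes long: "walk ds \<Longrightarrow> ds \<noteq> [] \<Longrightarrow> tgt (last ds) = src (hd ds) \<Longrightarrow> 21 \<le> weight ds"
begin

text \<open>The reverse of the first walk followed by the second is closed and does not turn back at
  the junction, as \<open>d \<noteq> e\<close>. At the closing vertex \<open>long\<close> permits a
  turn.\<close>

lemma two_walks:
  assumes "walk (d # ds)" "walk (e # es)" "src d = src e" "d \<noteq> e"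
    "tgt (last (d # ds)) = tgt (last (e # es))"
  shows "21 \<le> weight (d # ds) + weight (e # es)"
proof -
  let ?r = "map rv (rev (d # ds))"
  have dD: "d \<in> D" "last (d # ds) \<in> D" using walk_D[OF assms(1)] by auto
  have l: "last ?r = rv d" "hd ?r = rv (last (d # ds))"
    by simp (metis hd_map hd_rev list.distinct(1) rev_is_Nil_conv)
  have "walk (?r @ e # es)"
    using l assms rv_rv[OF dD(1)] by (intro walk_append walk_rev) auto
  moreover have "hd (?r @ e # es) = rv (last (d # ds))"
    using hd_append2[of ?r "e # es"] l(2) by (metis Nil_is_map_conv list.distinct(1) rev_is_Nil_conv)
  ultimately have "21 \<le> weight (?r @ e # es)"
    using assms(5) by (intro long) auto
  moreover have "weight ?r = weight (d # ds)"
    using walk_D[OF assms(1)] by (intro weight_rev) auto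
  ultimately show ?thesis using weight_simps(3)[of ?r "e # es"] by linarith
qed

text \<open>
  The dart \<open>d\<close> leads into a tree with the set \<open>X\<close> of \<open>3\<close>-vertices. Those are at distance at most \<open>i\<close> from
  the source of \<open>d\<close>, and the \<open>3\<close>-vertices where the tree is attached to the rest are at distance at most
  \<open>j\<close>. However the rest is colored, some member of the family \<open>F\<close> contains only pairs that extend to \<open>X\<close>.
\<close>

inductive branch :: "'d \<Rightarrow> 'w set \<Rightarrow> family \<Rightarrow> nat \<Rightarrow> nat \<Rightarrow> bool" where
  leaf: "d \<in> D \<Longrightarrow> branch d {} (leaf (k d)) 0 (k d + 1)"
| node: "d \<in> D \<Longrightarrow> {e \<in> D. src e = tgt d} = {rv d, d1, d2} \<Longrightarrow> rv d \<noteq> d1 \<Longrightarrow> rv d \<noteq> d2 \<Longrightarrow> d1 \<noteq> d2 \<Longrightarrow>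
    branch d1 X1 F1 i1 o1 \<Longrightarrow> branch d2 X2 F2 i2 o2 \<Longrightarrow> o1 + i2 < 21 \<Longrightarrow> i1 + o2 < 21 \<Longrightarrow> o1 < 21 \<Longrightarrow> o2 < 21 \<Longrightarrow>
    branch d (insert (tgt d) (X1 \<union> X2)) (node (k d) F1 F2) (k d + 1 + max i1 i2) (k d + 1 + max o1 o2)"
| weaken: "branch d X F i j \<Longrightarrow> covers F G \<Longrightarrow> branch d X G i j"

lemma branch_le: "branch d X F i j \<Longrightarrow> i \<le> j"
  by (induction rule: branch.induct) auto

lemma branch_D: "branch d X F i j \<Longrightarrow> d \<in> D"
  by (induction rule: branch.induct) auto

lemma branch_W: "branch d X F i j \<Longrightarrow> X \<subseteq> W"
  by (induction rule: branch.induct) (auto intro!: src_W rv_D)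

lemma branch_walk:
  "branch d X F i j \<Longrightarrow> v \<in> X \<Longrightarrow> \<exists>ds. walk (d # ds) \<and> tgt (last (d # ds)) = v \<and> weight (d # ds) \<le> i"
proof (induction rule: branch.induct)
  case (node d d1 d2 X1 F1 i1 o1 X2 F2 i2 o2)
  have ext: "\<exists>ds. walk (d # ds) \<and> tgt (last (d # ds)) = v \<and> weight (d # ds) \<le> k d + 1 + max i1 i2"
    if ds: "\<exists>ds. walk (e # ds) \<and> tgt (last (e # ds)) = v \<and> weight (e # ds) \<le> m" and e: "src e = tgt d" "e \<noteq> rv d"
      "m \<le> max i1 i2" for e m
  proof -
    obtain ds where "walk (e # ds)" "tgt (last (e # ds)) = v" "weight (e # ds) \<le> m" using ds by blast
    then show ?thesis using e node.hyps(1) by (intro exI[of _ "e # ds"]) auto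
  qed
  have d12: "src d1 = tgt d" "src d2 = tgt d" using node.hyps(2) by auto
  consider "v = tgt d" | "v \<in> X1" | "v \<in> X2" using node.prems by blast
  then show ?case
  proof cases
    case 1
    then show ?thesis using node.hyps(1) by (intro exI[of _ "[]"]) simp
  next
    case 2
    then show ?thesis using ext[OF node.IH(1) d12(1) node.hyps(3)[symmetric]] by simp
  next
    case 3
    then show ?thesis using ext[OF node.IH(2) d12(2) node.hyps(4)[symmetric]] by simp
  qed
qed auto

text \<open>Apart from its root dart, a tree is joined to the rest only through its leaves, and
  their far ends are within distance \<open>j\<close>.\<close>

lemma branch_exit:
  "branch d X F i j \<Longrightarrow> e \<in> D \<Longrightarrow> src e \<in> X \<or> e = d \<Longrightarrow> e \<noteq> rv d \<Longrightarrow>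
    tgt e \<in> X \<or> (\<exists>ds. walk (d # ds) \<and> tgt (last (d # ds)) = tgt e \<and> weight (d # ds) \<le> j)"
proof (induction rule: branch.induct)
  case (leaf d)
  then show ?case by (intro disjI2 exI[of _ "[]"]) auto
next
  case (node d d1 d2 X1 F1 i1 o1 X2 F2 i2 o2)
  have d12: "src d1 = tgt d" "src d2 = tgt d" "d1 \<in> D" "d2 \<in> D" using node.hyps(2) by auto
  have sub: ?case
    if f: "f \<in> D" "src f = tgt d" "f \<noteq> rv d" and m: "m \<le> max o1 o2" and Z: "Z \<subseteq> X1 \<union> X2"
      and e: "e \<noteq> rv f \<Longrightarrow> tgt e \<in> Z \<or> (\<exists>ds. walk (f # ds) \<and> tgt (last (f # ds)) = tgt e \<and> weight (f # ds) \<le> m)"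
    for f Z m
  proof (cases "e = rv f \<or> tgt e \<in> Z")
    case True
    then show ?thesis using f Z rv_rv by auto
  next
    case False
    then obtain ds where "walk (f # ds)" "tgt (last (f # ds)) = tgt e" "weight (f # ds) \<le> m" using e by blast
    then show ?thesis using f m node.hyps(1) by (intro disjI2 exI[of _ "f # ds"]) auto
  qed
  have "src e = tgt d \<Longrightarrow> e \<in> {rv d, d1, d2}" using node.prems(1) node.hyps(2) by blast
  then consider "e = d" | "src e \<in> X1 \<or> e = d1" | "src e \<in> X2 \<or> e = d2" using node.prems(2,3) by blast
  then show ?case
  proof cases
    case 1
    then show ?thesis by simp
  next
    case 2
    show ?thesis
      by (rule sub[OF d12(3,1) node.hyps(3)[symmetric] _ _ node.IH(1)[OF node.prems(1) 2]]) auto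
  next
    case 3
    show ?thesis
      by (rule sub[OF d12(4,2) node.hyps(4)[symmetric] _ _ node.IH(2)[OF node.prems(1) 3]]) auto
  qed
qed auto

lemma branch_src: "branch d X F i j \<Longrightarrow> i < 21 \<Longrightarrow> src d \<notin> X"
  using branch_walk[of d X F i j "src d"] long by fastforce

text \<open>A common vertex, or a dart from one tree to the other, gives two walks with different
  first darts and the same end, of total weight below 21. A dart that leaves one tree costs at most
  \<open>j\<close>, a vertex of the other at most \<open>i'\<close>, so only mixed sums have to be
  bounded.\<close>

lemma branch_sep:
  assumes "branch d X F i j" "branch e Y G i' j'" "src d = src e" "d \<noteq> e" "j + i' < 21" "i + j' < 21"
  shows "X \<inter> Y = {}"
    "\<And>f. f \<in> D \<Longrightarrow> src f \<in> X \<or> f = d \<Longrightarrow> f \<noteq> rv d \<Longrightarrow> tgt f \<notin> Y"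
proof -
  show dis: "X \<inter> Y = {}"
  proof (rule ccontr)
    assume "X \<inter> Y \<noteq> {}"
    then obtain v where "v \<in> X" "v \<in> Y" by blast
    from branch_walk[OF assms(1) this(1)] branch_walk[OF assms(2) this(2)]
    obtain ds es where "walk (d # ds)" "tgt (last (d # ds)) = v" "weight (d # ds) \<le> i"
      "walk (e # es)" "tgt (last (e # es)) = v" "weight (e # es) \<le> i'" by blast
    then show False using two_walks[of d ds e es] assms(3-6) branch_le[OF assms(1)] by simp
  qed
  fix f assume f: "f \<in> D" "src f \<in> X \<or> f = d" "f \<noteq> rv d"
  show "tgt f \<notin> Y"
  proof
    assume Y: "tgt f \<in> Y"
    then have "tgt f \<notin> X" using dis by blast
    then obtain ds where "walk (d # ds)" "tgt (last (d # ds)) = tgt f" "weight (d # ds) \<le> j"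
      using branch_exit[OF assms(1) f] by blast
    moreover obtain es where "walk (e # es)" "tgt (last (e # es)) = tgt f" "weight (e # es) \<le> i'"
      using branch_walk[OF assms(2) Y] by blast
    ultimately show False using two_walks[of d ds e es] assms(3-6) by simp
  qed
qed

lemma branch_no_return:
  assumes "branch d X F i j" "j < 21" "f \<in> D" "src f \<in> X \<or> f = d" "f \<noteq> rv d"
  shows "tgt f \<noteq> src d"
proof
  assume t: "tgt f = src d"
  have "src d \<notin> X" using branch_src[OF assms(1)] branch_le[OF assms(1)] assms(2) by simp
  then obtain ds where "walk (d # ds)" "tgt (last (d # ds)) = tgt f" "weight (d # ds) \<le> j"
    using branch_exit[OF assms(1,3-5)] t by metis
  then show False using long[of "d # ds"] t assms(2) by simp
qed

abbreviation completes ::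
    "('w \<Rightarrow> color) \<Rightarrow> ('d \<Rightarrow> color) \<Rightarrow> 'd \<Rightarrow> 'w set \<Rightarrow> color \<Rightarrow> color \<Rightarrow> ('w \<Rightarrow> color) \<Rightarrow> ('d \<Rightarrow> color) \<Rightarrow> bool" where
  "completes a r d X x y a' r' \<equiv> recolors X a r a' r' \<and>
    (\<forall>e\<in>D. src e \<in> X \<and> e \<noteq> rv d \<longrightarrow> dart_ok e a' r') \<and> linked (k d) (x, y) (a' (tgt d), r' (rv d))"

text \<open>The pair \<open>(x, y)\<close> at the source of \<open>d\<close> is a parameter and not
  read off from the coloring, because the source is colored only after the answers of all its
  branches are known. Therefore the link along \<open>d\<close> is stated separately and
  \<open>rv d\<close> is exempt.\<close>

definition allows :: "('w \<Rightarrow> color) \<Rightarrow> ('d \<Rightarrow> color) \<Rightarrow> 'd \<Rightarrow> 'w set \<Rightarrow> pset \<Rightarrow> bool" where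
  "allows a r d X S \<longleftrightarrow> (\<forall>x y. has S x y \<longrightarrow> (\<exists>a' r'. completes a r d X x y a' r'))"

text \<open>No dart joins two of the branches at \<open>u\<close>, so their colorings combine.\<close>

lemma branches_merge:
  fixes X :: "'d \<Rightarrow> 'w set" and s :: "'d \<Rightarrow> color" and Q :: "'d set" and u :: 'w
  defines "Y \<equiv> insert u (\<Union>b\<in>Q. X b)"
  assumes Q: "\<And>b. b \<in> Q \<Longrightarrow> branch b (X b) (F b) (i b) (j b) \<and> src b = u \<and> j b < 21"
    and ij: "\<And>b c. b \<in> Q \<Longrightarrow> c \<in> Q \<Longrightarrow> b \<noteq> c \<Longrightarrow> j b + i c < 21"
    and al: "\<And>b. b \<in> Q \<Longrightarrow> allows a r b (X b) (S b)" "\<And>b. b \<in> Q \<Longrightarrow> has (S b) x (s b)"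
    and s: "\<And>d. d \<in> D \<Longrightarrow> src d = u \<Longrightarrow> s d \<noteq> x"
      "\<And>d e. d \<in> D \<Longrightarrow> e \<in> D \<Longrightarrow> src d = u \<Longrightarrow> src e = u \<Longrightarrow> d \<noteq> e \<Longrightarrow> s d \<noteq> s e"
  shows "\<exists>a' r'. recolors Y a r a' r' \<and>
    (\<forall>e\<in>D. src e \<in> Y \<and> (src e = u \<longrightarrow> e \<in> Q) \<longrightarrow> dart_ok e a' r') \<and> a' u = x \<and> (\<forall>e\<in>D. src e = u \<longrightarrow> r' e = s e)"
proof -
  have "\<forall>b\<in>Q. \<exists>a' r'. completes a r b (X b) x (s b) a' r'"
    using al unfolding allows_def by simp
  from bchoice[OF this] obtain a1 where "\<forall>b\<in>Q. \<exists>r'. completes a r b (X b) x (s b) (a1 b) r'" ..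
  from bchoice[OF this] obtain r1 where ar: "\<forall>b\<in>Q. completes a r b (X b) x (s b) (a1 b) (r1 b)" ..
  have QD: "b \<in> D" "src b = u" if "b \<in> Q" for b using Q[OF that] branch_D by blast+
  have nu: "u \<notin> X b" if "b \<in> Q" for b
    using Q[OF that] branch_src[of b "X b" "F b" "i b" "j b"] branch_le[of b "X b" "F b" "i b" "j b"] by auto
  have base: "v \<notin> X b \<Longrightarrow> a1 b v = a v" "src e \<notin> X b \<Longrightarrow> r1 b e = r e" and ok: "locally_ok (X b) (a1 b) (r1 b)"
    and dok: "e \<in> D \<Longrightarrow> src e \<in> X b \<Longrightarrow> e \<noteq> rv b \<Longrightarrow> dart_ok e (a1 b) (r1 b)"
    and bok: "linked (k b) (x, s b) (a1 b (tgt b), r1 b (rv b))" if "b \<in> Q" for b e v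
    using ar that by simp_all
  have sep: "X b \<inter> X c = {}" "\<And>f. f \<in> D \<Longrightarrow> src f \<in> X b \<or> f = b \<Longrightarrow> f \<noteq> rv b \<Longrightarrow> tgt f \<notin> X c"
    if "b \<in> Q" "c \<in> Q" "b \<noteq> c" for b c
    using branch_sep[of b "X b" "F b" "i b" "j b" c "X c" "F c" "i c" "j c"] Q that ij[of b c] ij[of c b] by auto
  \<comment> \<open>A dart of branch \<open>b\<close> never ends at \<open>u\<close> or in another
    branch, so its far end lies in \<open>X b\<close> or keeps its old color.\<close>
  have cl: "tgt e \<in> X b \<or> tgt e \<notin> Y" if b: "b \<in> Q" and e: "e \<in> D" "src e \<in> X b \<or> e = b" "e \<noteq> rv b" for b e
  proof (rule disjCI)
    assume "\<not> tgt e \<notin> Y"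
    moreover have "tgt e \<noteq> u" using branch_no_return[of b "X b" "F b" "i b" "j b" e] Q[OF b] e by simp
    moreover have "tgt e \<notin> X c" if "c \<in> Q" "c \<noteq> b" for c
      using sep(2)[OF b that(1) that(2)[symmetric] e] .
    ultimately show "tgt e \<in> X b" unfolding Y_def by blast
  qed
  define br where "br v = (SOME b. b \<in> Q \<and> v \<in> X b)" for v
  have br: "br v = b" if "b \<in> Q" "v \<in> X b" for v b
    using someI[of "\<lambda>b. b \<in> Q \<and> v \<in> X b" b] sep(1)[of "br v" b] that unfolding br_def by blast
  define a' where "a' v = (if v = u then x else if v \<in> Y then a1 (br v) v else a v)" for v
  define r' where "r' e = (if src e = u then s e else if src e \<in> Y then r1 (br (src e)) e else r e)" for e
  \<comment> \<open>On \<open>X b\<close> and outside \<open>Y\<close> the merged coloring is the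
    one chosen for \<open>b\<close>, so every dart with both ends there inherits its link.\<close>
  have agree: "a' v = a1 b v" "src e = v \<Longrightarrow> r' e = r1 b e" if "b \<in> Q" "v \<in> X b \<or> v \<notin> Y" for b v e
  proof -
    have "v \<noteq> u" using that nu by (auto simp: Y_def)
    moreover have "v \<in> X b \<Longrightarrow> v \<in> Y" using that(1) by (auto simp: Y_def)
    moreover have "v \<notin> Y \<Longrightarrow> v \<notin> X b" using that(1) by (auto simp: Y_def)
    ultimately show "a' v = a1 b v" "src e = v \<Longrightarrow> r' e = r1 b e"
      using that br[OF that(1)] base[OF that(1)] by (auto simp: a'_def r'_def)
  qed
  have u: "a' u = x" "\<And>e. src e = u \<Longrightarrow> r' e = s e" by (auto simp: a'_def r'_def)
  have lok: "locally_ok Y a' r'"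
    unfolding locally_ok_def
  proof (intro ballI impI conjI)
    fix d assume d: "d \<in> D" "src d \<in> Y"
    show "r' d \<noteq> a' (src d)"
    proof (cases "src d = u")
      case True then show ?thesis using u s(1) d by simp
    next
      case False
      then obtain b where b: "b \<in> Q" "src d \<in> X b" using d by (auto simp: Y_def)
      then show ?thesis using ok[OF b(1)] agree(1)[of b "src d"] agree(2)[of b "src d" d] d(1) by (auto simp: locally_ok_def)
    qed
    fix e assume e: "e \<in> D" "src e = src d \<and> e \<noteq> d"
    show "r' e \<noteq> r' d"
    proof (cases "src d = u")
      case True then show ?thesis using u s(2)[of e d] d e by simp
    next
      case False
      then obtain b where b: "b \<in> Q" "src d \<in> X b" using d by (auto simp: Y_def)
      then show ?thesis using ok[OF b(1)] agree(2)[of b "src d" d] agree(2)[of b "src d" e] d(1) e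
        by (auto simp: locally_ok_def)
    qed
  qed
  have bq: "dart_ok b a' r'" if b: "b \<in> Q" for b
  proof -
    have "b \<noteq> rv b" using rv_neq[of b] QD[OF b] by auto
    then have "tgt b \<in> X b \<or> tgt b \<notin> Y" using cl[OF b, of b] QD[OF b] by blast
    then have "a' (tgt b) = a1 b (tgt b)" "r' (rv b) = r1 b (rv b)" using agree[OF b] by auto
    then show ?thesis using bok[OF b] u QD[OF b] by (simp add: dart_ok_def)
  qed
  have "dart_ok e a' r'" if e: "e \<in> D" "src e \<in> Y" "src e = u \<Longrightarrow> e \<in> Q" for e
  proof (cases "src e = u")
    case True
    then show ?thesis using bq e(3) by blast
  next
    case False
    then obtain b where b: "b \<in> Q" "src e \<in> X b" using e(2) by (auto simp: Y_def)
    show ?thesis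
    proof (cases "e = rv b")
      case True
      have "src e \<in> Y" "src b \<in> Y" using e(2) QD[OF b(1)] by (auto simp: Y_def)
      then have "r' b \<noteq> a' (src b)" "r' (rv b) \<noteq> a' (tgt b)"
        using lok QD[OF b(1)] e(1) True by (auto simp: locally_ok_def)
      then show ?thesis using dart_ok_rv[OF _ bq[OF b(1)]] QD[OF b(1)] True by simp
    next
      case False
      from cl[OF b(1) e(1) _ False] b(2) have "tgt e \<in> X b \<or> tgt e \<notin> Y" by blast
      then have "a' (tgt e) = a1 b (tgt e)" "r' (rv e) = r1 b (rv e)" using agree[OF b(1)] by auto
      moreover have "a' (src e) = a1 b (src e)" "r' e = r1 b e" using agree[OF b(1)] b(2) by auto
      ultimately show ?thesis using dok[OF b(1) e(1) b(2) False] by (simp add: dart_ok_def)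
    qed
  qed
  then show ?thesis
    using lok u by (intro exI[of _ a'] exI[of _ r']) (auto simp: a'_def r'_def Y_def)
qed

text \<open>The hypothesis says that the pairs at the attachments consist of distinct colors, so at
  each leaf one of the twelve sets of \<open>leaf\<close> applies. At a node the answers of the two
  subtrees are merged around the target of \<open>d\<close>.\<close>

lemma branch_allows:
  "branch d X F i j \<Longrightarrow> (\<And>e. e \<in> D \<Longrightarrow> src e \<in> X \<or> e = d \<Longrightarrow> e \<noteq> rv d \<Longrightarrow> tgt e \<notin> X \<Longrightarrow> a (tgt e) \<noteq> r (rv e)) \<Longrightarrow>
    \<exists>S\<in>set F. allows a r d X S"
proof (induction rule: branch.induct)
  case (leaf d)
  have "d \<noteq> rv d" using rv_neq leaf by metis
  then have q: "(a (tgt d), r (rv d)) \<in> set pairs" using leaf by (simp add: set_pairs)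
  let ?S = "push (k d) (mk (\<lambda>x y. x = a (tgt d) \<and> y = r (rv d)))"
  have "allows a r d {} ?S" by (auto simp: allows_def has_push locally_ok_def)
  moreover have "?S \<in> set (leaf (k d))" using q by (force simp: leaf_def)
  ultimately show ?case by blast
next
  case (weaken d X F i j G)
  obtain S where S: "S \<in> set F" "allows a r d X S" using weaken.IH weaken.prems by blast
  have "\<exists>T\<in>set G. sub T S"
    using weaken.hyps(2) S(1) by (simp add: covers_def list_all_iff list_ex_iff)
  then obtain T where T: "T \<in> set G" "sub T S" by blast
  have "allows a r d X T"
  proof (unfold allows_def, intro allI impI)
    fix x y assume "has T x y"
    then have "has S x y" using T(2) unfolding sub_iff by blast
    from S(2)[unfolded allows_def, rule_format, OF this]
    show "\<exists>a' r'. completes a r d X x y a' r'" .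
  qed
  then show ?case using T(1) by blast
next
  case (node d d1 d2 X1 F1 i1 o1 X2 F2 i2 o2)
  let ?u = "tgt d" and ?X = "insert (tgt d) (X1 \<union> X2)"
  have d12: "src d1 = tgt d" "src d2 = tgt d" "d1 \<in> D" "d2 \<in> D" using node.hyps(2) by auto
  have nu: "?u \<notin> X1" "?u \<notin> X2"
    using branch_src[OF node.hyps(6)] branch_src[OF node.hyps(7)] branch_le[OF node.hyps(6)]
      branch_le[OF node.hyps(7)] d12 node.hyps(10,11) by simp_all
  \<comment> \<open>A dart that leaves a subtree leaves the whole tree: it ends neither at
    \<open>?u\<close> nor in the sibling subtree.\<close>
  have outer: "a (tgt e) \<noteq> r (rv e)"
    if f: "branch f Y F i j" "branch f' Y' F' i' j'" "src f = ?u" "src f' = ?u" "f \<noteq> f'" "rv d \<noteq> f" "?u \<notin> Y"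
      and le: "j + i' < 21" "i + j' < 21" "j < 21" and X: "Y \<union> Y' = X1 \<union> X2"
      and e: "e \<in> D" "src e \<in> Y \<or> e = f" "e \<noteq> rv f" "tgt e \<notin> Y" for f f' Y Y' F F' i i' j j' e
  proof -
    have "tgt e \<noteq> ?u" using branch_no_return[OF f(1) le(3) e(1-3)] f(3) by simp
    moreover have "tgt e \<notin> Y'"
      using branch_sep(2)[OF f(1,2) _ f(5) le(1,2) e(1-3)] f(3,4) by simp
    ultimately have t: "tgt e \<notin> ?X" using e(4) X by blast
    have n: "e \<noteq> rv d"
    proof
      assume "e = rv d"
      then show False using e(2) f(6,7) by simp
    qed
    have "src e \<in> ?X \<or> e = d" using e(2) f(3) X by blast
    from node.prems[OF e(1) this n t] show ?thesis .
  qed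
  have "\<exists>S\<in>set F1. allows a r d1 X1 S"
    by (rule node.IH(1), rule outer[OF node.hyps(6,7)]) (use d12 nu node.hyps in auto)
  moreover have "\<exists>S\<in>set F2. allows a r d2 X2 S"
    by (rule node.IH(2), rule outer[OF node.hyps(7,6)]) (use d12 nu node.hyps in auto)
  ultimately obtain S1 S2 where S: "S1 \<in> set F1" "allows a r d1 X1 S1" "S2 \<in> set F2" "allows a r d2 X2 S2" by blast
  let ?S = "push (k d) (comb S1 S2)"
  have "allows a r d ?X ?S"
    unfolding allows_def
  proof (intro allI impI)
    fix x y assume "has ?S x y"
    then obtain x' y' where xy: "linked (k d) (x, y) (x', y')" "has (comb S1 S2) x' y'"
      unfolding has_push by blast
    then obtain z1 z2 where z: "x' \<noteq> y'" "has S1 x' z1" "has S2 x' z2" "z1 \<noteq> x'" "z1 \<noteq> y'" "z2 \<noteq> x'" "z2 \<noteq> y'" "z2 \<noteq> z1"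
      unfolding has_comb by (elim exE conjE)
    \<comment> \<open>The default \<open>y'\<close> is meant for \<open>rv d\<close>, the third dart
      at \<open>?u\<close>.\<close>
    define s where "s e = (if e = d1 then z1 else if e = d2 then z2 else y')" for e
    let ?f = "\<lambda>p q e. if e = d1 then p else q"
    have all: "e = rv d \<or> e = d1 \<or> e = d2" if "e \<in> D" "src e = ?u" for e using node.hyps(2) that by (metis (mono_tags, lifting) insertE mem_Collect_eq singletonD)
    have "\<exists>a' r'. recolors (insert ?u (\<Union>b\<in>{d1, d2}. ?f X1 X2 b)) a r a' r' \<and>
      (\<forall>e\<in>D. src e \<in> insert ?u (\<Union>b\<in>{d1, d2}. ?f X1 X2 b) \<and> (src e = ?u \<longrightarrow> e \<in> {d1, d2}) \<longrightarrow> dart_ok e a' r') \<and>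
      a' ?u = x' \<and> (\<forall>e\<in>D. src e = ?u \<longrightarrow> r' e = s e)"
    proof (rule branches_merge[where F = "?f F1 F2" and i = "?f i1 i2" and j = "?f o1 o2" and S = "?f S1 S2"])
      show "s e \<noteq> x'" if "e \<in> D" "src e = ?u" for e using all[OF that] z node.hyps(3-5) by (auto simp: s_def)
      show "s e \<noteq> s f" if "e \<in> D" "f \<in> D" "src e = ?u" "src f = ?u" "e \<noteq> f" for e f
        using all[OF that(1,3)] all[OF that(2,4)] that(5) z node.hyps(3-5) by (auto simp: s_def)
      show "branch b (?f X1 X2 b) (?f F1 F2 b) (?f i1 i2 b) (?f o1 o2 b) \<and> src b = ?u \<and> ?f o1 o2 b < 21"
        if "b \<in> {d1, d2}" for b using that node.hyps(5-7,10,11) d12 by auto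
      show "?f o1 o2 b + ?f i1 i2 c < 21" if "b \<in> {d1, d2}" "c \<in> {d1, d2}" "b \<noteq> c" for b c
        using that node.hyps(5,8,9) by auto
      show "allows a r b (?f X1 X2 b) (?f S1 S2 b)" if "b \<in> {d1, d2}" for b using that node.hyps(5) S by auto
      show "has (?f S1 S2 b) x' (s b)" if "b \<in> {d1, d2}" for b using that node.hyps(5) z by (auto simp: s_def)
    qed
    moreover have UN: "insert ?u (\<Union>b\<in>{d1, d2}. ?f X1 X2 b) = ?X" using node.hyps(5) by auto
    ultimately obtain a' r' where ar: "\<forall>v. v \<notin> ?X \<longrightarrow> a' v = a v" "\<forall>e. src e \<notin> ?X \<longrightarrow> r' e = r e"
       "locally_ok ?X a' r'" "\<forall>e\<in>D. src e \<in> ?X \<and> (src e = ?u \<longrightarrow> e \<in> {d1, d2}) \<longrightarrow> dart_ok e a' r'"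
      "a' ?u = x'" "\<forall>e\<in>D. src e = ?u \<longrightarrow> r' e = s e"
      unfolding UN by (elim exE conjE)
    have "r' (rv d) = y'" using ar(6) rv_D[OF node.hyps(1)] node.hyps(3,4) by (simp add: s_def)
    moreover have "\<forall>e\<in>D. src e \<in> ?X \<and> e \<noteq> rv d \<longrightarrow> dart_ok e a' r'" using ar(4) all by blast
    ultimately show "\<exists>a' r'. completes a r d ?X x y a' r'"
      using ar xy(1) by (intro exI[of _ a'] exI[of _ r']) simp
  qed
  moreover have "?S \<in> set (node (k d) F1 F2)" using S by (auto simp: node_def)
  ultimately show ?case by blast
qed

end

text \<open>Criticality in the language of darts. Only 3-vertices are deleted, because the inner
  vertices of threads enter through \<open>linked\<close> alone.\<close>

locale critical_darts = long_darts W D src rv k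
  for W :: "'w set" and D :: "'d set" and src :: "'d \<Rightarrow> 'w" and rv :: "'d \<Rightarrow> 'd" and k :: "'d \<Rightarrow> nat" +
  assumes crit: "S \<subseteq> W \<Longrightarrow> S \<noteq> {} \<Longrightarrow> \<exists>a r. valid (W - S) a r"
    and uncol: "\<not> valid W a r"
begin

text \<open>Everything except \<open>w\<close> and the three trees is colored by criticality, and
  each tree answers with a member of its family. If these answers had a common coloring at
  \<open>w\<close>, merging would color everything. The radii 6 and 12 keep the three trees
  apart.\<close>

lemma not_reducible:
  assumes w: "w \<in> W" "{e \<in> D. src e = w} = {d1, d2, d3}" "d1 \<noteq> d2" "d1 \<noteq> d3" "d2 \<noteq> d3"
    and b: "branch d1 X1 F1 i1 j1" "branch d2 X2 F2 i2 j2" "branch d3 X3 F3 i3 j3"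
    and le: "i1 \<le> 6" "i2 \<le> 6" "i3 \<le> 6" "j1 \<le> 12" "j2 \<le> 12" "j3 \<le> 12"
  shows "\<exists>S1\<in>set F1. \<exists>S2\<in>set F2. \<exists>S3\<in>set F3. \<not> meets S1 S2 S3"
proof -
  define X where "X e = (if e = d1 then X1 else if e = d2 then X2 else X3)" for e
  define F where "F e = (if e = d1 then F1 else if e = d2 then F2 else F3)" for e
  define i where "i e = (if e = d1 then i1 else if e = d2 then i2 else i3)" for e
  define j where "j e = (if e = d1 then j1 else if e = d2 then j2 else j3)" for e
  let ?Q = "{d1, d2, d3}"
  have src: "src d1 = w" "src d2 = w" "src d3 = w" using w(2) by blast+
  have br: "branch e (X e) (F e) (i e) (j e)" "src e = w" "i e \<le> 6" "j e \<le> 12" if "e \<in> ?Q" for e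
    using that b le w(3-5) src by (auto simp: X_def F_def i_def j_def)
  let ?S = "insert w (\<Union>b\<in>?Q. X b)"
  have "X e \<subseteq> W" if "e \<in> ?Q" for e using branch_W[OF br(1)[OF that]] .
  then have SW: "?S \<subseteq> W" using w(1) by (intro insert_subsetI UN_least)
  then obtain a r where ar: "valid (W - ?S) a r" using crit[of ?S] by blast
  have "\<forall>b\<in>?Q. \<exists>S. S \<in> set (F b) \<and> allows a r b (X b) S"
  proof
    fix b assume b: "b \<in> ?Q"
    have "\<exists>S\<in>set (F b). allows a r b (X b) S"
    proof (rule branch_allows[OF br(1)[OF b]])
      fix e assume e: "e \<in> D" "src e \<in> X b \<or> e = b" "e \<noteq> rv b" "tgt e \<notin> X b"
      have "tgt e \<noteq> w" using branch_no_return[OF br(1)[OF b] _ e(1-3)] br[OF b] by simp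
      moreover have "tgt e \<notin> X c" if c: "c \<in> ?Q" "b \<noteq> c" for c
        using branch_sep(2)[OF br(1)[OF b] br(1)[OF c(1)] _ _ _ _ e(1-3)] br(2-4)[OF b] br(2-4)[OF c(1)] c(2) by simp
      ultimately have "tgt e \<in> W - ?S" using e(4) src_W[OF rv_D[OF e(1)]] by blast
      then show "a (tgt e) \<noteq> r (rv e)" using ar rv_D[OF e(1)] unfolding valid_def locally_ok_def by metis
    qed
    then show "\<exists>S. S \<in> set (F b) \<and> allows a r b (X b) S" by blast
  qed
  from bchoice[OF this] obtain S where S: "\<And>b. b \<in> ?Q \<Longrightarrow> S b \<in> set (F b) \<and> allows a r b (X b) (S b)" by blast
  have "\<not> meets (S d1) (S d2) (S d3)"
  proof
    assume "meets (S d1) (S d2) (S d3)"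
    then obtain x z1 z2 z3 where z: "has (S d1) x z1" "has (S d2) x z2" "has (S d3) x z3"
      "z1 \<noteq> x" "z2 \<noteq> x" "z3 \<noteq> x" "z1 \<noteq> z2" "z1 \<noteq> z3" "z2 \<noteq> z3"
      unfolding meets_iff by metis
    define s where "s e = (if e = d1 then z1 else if e = d2 then z2 else z3)" for e
    have all: "e \<in> ?Q" if "e \<in> D" "src e = w" for e
      using that unfolding w(2)[symmetric] by simp
    have "\<exists>a' r'. recolors ?S a r a' r' \<and>
      (\<forall>e\<in>D. src e \<in> ?S \<and> (src e = w \<longrightarrow> e \<in> ?Q) \<longrightarrow> dart_ok e a' r') \<and> a' w = x \<and> (\<forall>e\<in>D. src e = w \<longrightarrow> r' e = s e)"
    proof (rule branches_merge[where F = F and i = i and j = j and S = S])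
      show "branch b (X b) (F b) (i b) (j b) \<and> src b = w \<and> j b < 21" if "b \<in> ?Q" for b using br[OF that] by simp
      show "j b + i c < 21" if "b \<in> ?Q" "c \<in> ?Q" for b c using br(3,4)[OF that(1)] br(3,4)[OF that(2)] by simp
      show "allows a r b (X b) (S b)" if "b \<in> ?Q" for b using S[OF that] by blast
      show "has (S b) x (s b)" if "b \<in> ?Q" for b using that z w(3-5) by (auto simp: s_def)
      show "s e \<noteq> x" if "e \<in> D" "src e = w" for e using all[OF that] z by (auto simp: s_def)
      show "s e \<noteq> s f" if "e \<in> D" "f \<in> D" "src e = w" "src f = w" "e \<noteq> f" for e f
        using all[OF that(1,3)] all[OF that(2,4)] that(5) z w(3-5) by (auto simp: s_def)
    qed
    then obtain a' r' where ar': "\<forall>v. v \<notin> ?S \<longrightarrow> a' v = a v" "\<forall>e. src e \<notin> ?S \<longrightarrow> r' e = r e"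
       "locally_ok ?S a' r'" "\<forall>e\<in>D. src e \<in> ?S \<and> (src e = w \<longrightarrow> e \<in> ?Q) \<longrightarrow> dart_ok e a' r'" by blast
    have lok: "locally_ok W a' r'"
      unfolding locally_ok_def
    proof (intro ballI impI)
      fix d assume d: "d \<in> D" "src d \<in> W"
      show "r' d \<noteq> a' (src d) \<and> (\<forall>e\<in>D. src e = src d \<and> e \<noteq> d \<longrightarrow> r' e \<noteq> r' d)"
      proof (cases "src d \<in> ?S")
        case True
        then show ?thesis using ar'(3) d(1) unfolding locally_ok_def by blast
      next
        case False
        then have "r d \<noteq> a (src d) \<and> (\<forall>e\<in>D. src e = src d \<and> e \<noteq> d \<longrightarrow> r e \<noteq> r d)"
          using ar d unfolding valid_def locally_ok_def by blast
        then show ?thesis using False ar'(1,2) by simp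
      qed
    qed
    have dS: "dart_ok d a' r'" if "d \<in> D" "src d \<in> ?S" for d
      using ar'(4) that all by blast
    have "dart_ok d a' r'" if d: "d \<in> D" for d
    proof -
      consider "src d \<in> ?S" | "tgt d \<in> ?S" | "src d \<notin> ?S" "tgt d \<notin> ?S" by blast
      then show ?thesis
      proof cases
        case 1
        then show ?thesis using dS d by blast
      next
        case 2
        have "dart_ok (rv d) a' r'" using dS[OF rv_D[OF d] 2] .
        moreover have "r' (rv d) \<noteq> a' (tgt d)" "r' d \<noteq> a' (src d)"
          using lok d rv_D[OF d] src_W unfolding locally_ok_def by blast+
        ultimately show ?thesis using dart_ok_rv[OF rv_D[OF d], of a' r'] rv_rv[OF d] by simp
      next
        case 3
        then have "src d \<in> W - ?S" "tgt d \<in> W - ?S" using src_W[OF d] src_W[OF rv_D[OF d]] by simp_all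
        then have "dart_ok d a r" using ar d unfolding valid_def by simp
        then show ?thesis using 3 ar'(1,2) by (simp add: dart_ok_def)
      qed
    qed
    then have "valid W a' r'" using lok by (simp add: valid_def)
    then show False using uncol by blast
  qed
  moreover have "S d1 \<in> set F1" "S d2 \<in> set F2" "S d3 \<in> set F3"
    using S[of d1] S[of d2] S[of d3] w(3-5) by (simp_all add: F_def)
  ultimately show ?thesis by blast
qed

end

section \<open>Discharging\<close>

text \<open>The alternating group, read as the colors of a 3-vertex and its three neighbors. It is
  sharply 2-transitive, so the colors at two positions determine the state.\<close>

definition even_states :: "(color \<times> color \<times> color \<times> color) list" where
  "even_states = [(C1,C2,C3,C4),(C1,C3,C4,C2),(C1,C4,C2,C3),(C2,C1,C4,C3),(C2,C3,C1,C4),(C2,C4,C3,C1),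
     (C3,C1,C2,C4),(C3,C2,C4,C1),(C3,C4,C1,C2),(C4,C1,C3,C2),(C4,C2,C1,C3),(C4,C3,C2,C1)]"

text \<open>Every pair of distinct colors extends to exactly one even permutation in each of the three ways, so
  each missing pair excludes only one of the twelve even states.\<close>

lemma meets_if_few_missing:
  assumes "missing S + missing T + missing U < 12"
  shows "meets S T U"
proof (rule ccontr)
  assume n: "\<not> meets S T U"
  let ?M = "\<lambda>S. filter (\<lambda>(a, x). \<not> has S a x) pairs"
  let ?E = "set even_states"
  have c12: "card ?E = 12" by (simp add: even_states_def)
  have bound: "card {e \<in> ?E. f e \<in> set M} \<le> length M" if "inj_on f ?E" for f :: "_ \<Rightarrow> color \<times> color" and M
  proof -
    have "card {e \<in> ?E. f e \<in> set M} \<le> card (set M)"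
      using that by (intro card_inj_on_le[of f]) (auto simp: inj_on_def)
    then show ?thesis using card_length[of M] by simp
  qed
  define f g h :: "color \<times> color \<times> color \<times> color \<Rightarrow> color \<times> color"
    where "f = (\<lambda>(a, x, y, z). (a, x))" and "g = (\<lambda>(a, x, y, z). (a, y))" and "h = (\<lambda>(a, x, y, z). (a, z))"
  have inj: "inj_on f ?E" "inj_on g ?E" "inj_on h ?E"
    by (simp_all add: even_states_def f_def g_def h_def)
  have len: "length (?M S') = missing S'" for S'
    by (cases S') (simp add: pairs_def)
  have "?E \<subseteq> {e \<in> ?E. f e \<in> set (?M S)} \<union> {e \<in> ?E. g e \<in> set (?M T)} \<union> {e \<in> ?E. h e \<in> set (?M U)}"
  proof
    fix e assume e: "e \<in> ?E"
    obtain a x y z where axyz: "e = (a, x, y, z)" by (cases e)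
    have d: "a \<noteq> x" "a \<noteq> y" "a \<noteq> z" "x \<noteq> y" "x \<noteq> z" "y \<noteq> z" using e axyz by (auto simp: even_states_def)
    show "e \<in> {e \<in> ?E. f e \<in> set (?M S)} \<union> {e \<in> ?E. g e \<in> set (?M T)} \<union> {e \<in> ?E. h e \<in> set (?M U)}"
    proof (rule ccontr)
      assume "\<not> ?thesis"
      then have "f e \<notin> set (?M S)" "g e \<notin> set (?M T)" "h e \<notin> set (?M U)" using e by auto
      then have "has S a x" "has T a y" "has U a z"
        using d by (simp_all add: axyz f_def g_def h_def set_pairs)
      then have "meets S T U" using d unfolding meets_iff by blast
      then show False using n by contradiction
    qed
  qed
  then have "12 \<le> card ({e \<in> ?E. f e \<in> set (?M S)} \<union> {e \<in> ?E. g e \<in> set (?M T)} \<union> {e \<in> ?E. h e \<in> set (?M U)})"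
    using c12 by (metis (no_types, lifting) List.finite_set card_mono finite_Un finite_subset mem_Collect_eq subsetI)
  also have "\<dots> \<le> length (?M S) + length (?M T) + length (?M U)"
    using bound[OF inj(1), of "?M S"] bound[OF inj(2), of "?M T"] bound[OF inj(3), of "?M U"]
    by (meson add_mono card_Un_le le_trans)
  finally show False using assms by (simp add: len)
qed

datatype cls = Leaf | F0 | F1 | F2 | F3 | F4 | F5

fun fam :: "nat \<times> cls \<Rightarrow> family" where
  "fam (n, Leaf) = leaf n"
| "fam (n, F0) = fam0"
| "fam (n, F1) = fam1"
| "fam (n, F2) = fam2"
| "fam (n, F3) = fam3"
| "fam (n, F4) = fam4"
| "fam (n, F5) = fam5"

text \<open>Bounds on the number of the twelve pairs that a member of the family lacks. For
  \<open>Leaf\<close> the list is indexed by the number of inner vertices between the vertex and the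
  fixed far end.\<close>

fun mis :: "nat \<times> cls \<Rightarrow> nat" where
  "mis (n, Leaf) = [11, 10, 8, 5, 2, 1] ! n"
| "mis (n, F0) = 4"
| "mis (n, F1) = 1"
| "mis (n, F2) = 2"
| "mis (n, F3) = 3"
| "mis (n, F4) = 2"
| "mis (n, F5) = 6"

text \<open>An incoming branch: thread length, family, and four times the charge that it brings.\<close>

definition branch_types :: "((nat \<times> cls) \<times> nat) list" where
  "branch_types = [((5, Leaf), 0), ((4, Leaf), 0), ((3, Leaf), 0),
     ((2, Leaf), 0), ((2, F3), 2), ((2, F4), 1), ((2, F4), 3), ((2, F1), 2),
     ((1, Leaf), 0), ((1, F1), 6), ((1, F3), 2), ((1, F5), 2),
     ((0, Leaf), 0), ((0, F2), 10), ((0, F2), 6), ((0, F2), 1), ((0, F0), 2)]"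

text \<open>The families other than leaves do not depend on the thread length, so the lookup in
  \<open>special\<close> drops it.\<close>

fun key :: "nat \<times> cls \<Rightarrow> nat \<times> cls" where
  "key (n, Leaf) = (n, Leaf)"
| "key (n, c) = (0, c)"

text \<open>In each of these triples the values of \<open>mis\<close> add up to at least 12, so
  counting missing pairs fails and all choices of members are evaluated.\<close>

definition special :: "((nat \<times> cls) \<times> (nat \<times> cls) \<times> (nat \<times> cls)) list" where
  "special = [((1, Leaf), (4, Leaf), (5, Leaf)),
     ((1, Leaf), (5, Leaf), (5, Leaf)),
     ((2, Leaf), (3, Leaf), (4, Leaf)),
     ((2, Leaf), (3, Leaf), (5, Leaf)),
     ((2, Leaf), (4, Leaf), (4, Leaf)),
     ((3, Leaf), (3, Leaf), (3, Leaf)),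
     ((3, Leaf), (3, Leaf), (4, Leaf)),
     ((1, Leaf), (0, F1), (5, Leaf)),
     ((1, Leaf), (0, F2), (5, Leaf)),
     ((2, Leaf), (0, F2), (4, Leaf)),
     ((3, Leaf), (0, F2), (3, Leaf)),
     ((1, Leaf), (0, F3), (5, Leaf)),
     ((2, Leaf), (0, F3), (4, Leaf)),
     ((2, Leaf), (0, F3), (5, Leaf)),
     ((3, Leaf), (0, F3), (3, Leaf)),
     ((1, Leaf), (0, F4), (4, Leaf)),
     ((1, Leaf), (0, F4), (5, Leaf)),
     ((2, Leaf), (0, F4), (3, Leaf)),
     ((2, Leaf), (0, F4), (4, Leaf)),
     ((3, Leaf), (0, F4), (3, Leaf)),
     ((3, Leaf), (0, F5), (4, Leaf)),
     ((3, Leaf), (0, F5), (5, Leaf)),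
     ((5, Leaf), (0, F5), (0, F5))]"

definition reducible_types :: "nat \<times> cls \<Rightarrow> nat \<times> cls \<Rightarrow> nat \<times> cls \<Rightarrow> bool" where
  "reducible_types s t u \<longleftrightarrow> mis s + mis t + mis u < 12 \<or>
     list_ex (\<lambda>p. List.member special p) [(key s, key t, key u), (key s, key u, key t), (key t, key s, key u),
       (key t, key u, key s), (key u, key s, key t), (key u, key t, key s)]"

text \<open>The last two alternatives need more than the types of the branches: a \<open>(5,2,0)\<close>-vertex that
  receives \<open>3\<close> through its \<open>2\<close>-thread passes on \<open>1\<close>, and a \<open>(5,2,1)\<close>-vertex receives nothing through
  its \<open>1\<close>-thread from a vertex of the same kind.\<close>

definition charge_ok :: "(nat \<times> cls) \<times> nat \<Rightarrow> (nat \<times> cls) \<times> nat \<Rightarrow> (nat \<times> cls) \<times> nat \<Rightarrow> bool" where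
  "charge_ok s t u \<longleftrightarrow> (let n = fst (fst s) + fst (fst t) + fst (fst u); q = snd s + snd t + snd u;
      has = (\<lambda>m. fst (fst s) = m \<or> fst (fst t) = m \<or> fst (fst u) = m) in
     q = 0 \<and> 8 \<le> n \<or> n \<le> 7 \<and> 4 * n + q \<le> 30 \<or> reducible_types (fst s) (fst t) (fst u) \<or>
     has 5 \<and> has 2 \<and> has 0 \<and> (s = ((2, F4), 3) \<or> t = ((2, F4), 3) \<or> u = ((2, F4), 3)) \<and> q \<le> 3 \<or>
     has 5 \<and> has 2 \<and> has 1 \<and> (s = ((1, F5), 2) \<or> t = ((1, F5), 2) \<or> u = ((1, F5), 2)))"

lemma charge_ok_all:
  "list_all (\<lambda>s. list_all (\<lambda>t. list_all (charge_ok s t) branch_types) branch_types) branch_types"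
  by code_simp

lemma special_reducible: "list_all (\<lambda>(s, t, u). reducible (fam s) (fam t) (fam u)) special"
  by code_simp

lemma mis_missing: "list_all (\<lambda>(t, _). missing_le (mis t) (fam t)) branch_types"
  by code_simp

text \<open>The vertices with at least 8 inner vertices on their threads that survive when only the
  threads are known, longest thread first. These eleven types have an excess, which
  \<open>tau\<close> is designed to send away.\<close>

lemma leaf_types:
  "list_all (\<lambda>a. list_all (\<lambda>b. list_all (\<lambda>c. c \<le> b \<and> b \<le> a \<and> 8 \<le> a + b + c \<longrightarrow>
     reducible_types (a, Leaf) (b, Leaf) (c, Leaf) \<or> List.member [(5,5,0),(5,4,0),(5,3,1),(5,2,2),(4,4,1),(5,3,0),
       (5,2,1),(4,4,0),(4,3,1),(4,2,2),(3,3,2)] (a, b, c)) [0,1,2,3,4,5]) [0,1,2,3,4,5]) [0,1,2,3,4,5::nat]"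
  by code_simp

section \<open>Irreducible vertices and the charge balance\<close>

context critical_darts
begin

definition brn :: "'d \<Rightarrow> family \<Rightarrow> nat \<Rightarrow> nat \<Rightarrow> bool" where
  "brn d F i j \<longleftrightarrow> (\<exists>X. branch d X F i j)"

definition br :: "'d \<Rightarrow> family \<Rightarrow> bool" where
  "br d F \<longleftrightarrow> (\<exists>i j. brn d F i j \<and> i \<le> 6 \<and> j \<le> 12)"

lemma brn_leaf: "d \<in> D \<Longrightarrow> brn d (leaf (k d)) 0 (k d + 1)"
  unfolding brn_def using branch.leaf by blast

lemma brn_covers: "brn d F i j \<Longrightarrow> covers F G \<Longrightarrow> brn d G i j"
  unfolding brn_def using branch.weaken by blast

lemma brn_node:
  assumes "d \<in> D" "{e \<in> D. src e = tgt d} = {rv d, d1, d2}" "rv d \<noteq> d1" "rv d \<noteq> d2" "d1 \<noteq> d2"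
    "brn d1 G1 i1 j1" "brn d2 G2 i2 j2" "j1 + i2 < 21" "i1 + j2 < 21" "j1 < 21" "j2 < 21"
  shows "brn d (node (k d) G1 G2) (k d + 1 + max i1 i2) (k d + 1 + max j1 j2)"
  using assms(6,7) branch.node[OF assms(1-5) _ _ assms(8-11)] unfolding brn_def by blast

lemma br_leaf: "d \<in> D \<Longrightarrow> br d (leaf (k d))"
  unfolding br_def using brn_leaf[of d] k_le[of d] by (intro exI conjI) auto

lemma br_not_meets:
  assumes "w \<in> W" "{e \<in> D. src e = w} = {d1, d2, d3}" "d1 \<noteq> d2" "d1 \<noteq> d3" "d2 \<noteq> d3" "br d1 G1" "br d2 G2" "br d3 G3"
  shows "\<exists>S1\<in>set G1. \<exists>S2\<in>set G2. \<exists>S3\<in>set G3. \<not> meets S1 S2 S3"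
proof -
  obtain X1 i1 j1 where 1: "branch d1 X1 G1 i1 j1" "i1 \<le> 6" "j1 \<le> 12" using assms(6) unfolding br_def brn_def by blast
  obtain X2 i2 j2 where 2: "branch d2 X2 G2 i2 j2" "i2 \<le> 6" "j2 \<le> 12" using assms(7) unfolding br_def brn_def by blast
  obtain X3 i3 j3 where 3: "branch d3 X3 G3 i3 j3" "i3 \<le> 6" "j3 \<le> 12" using assms(8) unfolding br_def brn_def by blast
  show ?thesis by (rule not_reducible[OF assms(1-5) 1(1) 2(1) 3(1) 1(2) 2(2) 3(2) 1(3) 2(3) 3(3)])
qed

lemma br_not_reducible:
  assumes "w \<in> W" "{e \<in> D. src e = w} = {d1, d2, d3}" "d1 \<noteq> d2" "d1 \<noteq> d3" "d2 \<noteq> d3" "br d1 G1" "br d2 G2" "br d3 G3"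
  shows "\<not> reducible G1 G2 G3"
  using br_not_meets[OF assms] by (auto simp: reducible_def meets_def list_all_iff)

lemma br_missing:
  assumes "w \<in> W" "{e \<in> D. src e = w} = {d1, d2, d3}" "d1 \<noteq> d2" "d1 \<noteq> d3" "d2 \<noteq> d3" "br d1 G1" "br d2 G2" "br d3 G3"
    and "missing_le n1 G1" "missing_le n2 G2" "missing_le n3 G3"
  shows "12 \<le> n1 + n2 + n3"
proof -
  obtain S1 S2 S3 where S: "S1 \<in> set G1" "S2 \<in> set G2" "S3 \<in> set G3" "\<not> meets S1 S2 S3"
    using br_not_meets[OF assms(1-8)] by blast
  then have "missing S1 \<le> n1" "missing S2 \<le> n2" "missing S3 \<le> n3"
    using assms(9-11) by (auto simp: missing_le_def list_all_iff)
  then show ?thesis using meets_if_few_missing[of S1 S2 S3] S(4) by linarith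
qed

lemma fam_key: "fam (key t) = fam t"
  by (cases t rule: key.cases) simp_all

lemma not_reducible_types:
  assumes w: "w \<in> W" "{e \<in> D. src e = w} = {d1, d2, d3}" "d1 \<noteq> d2" "d1 \<noteq> d3" "d2 \<noteq> d3"
    and b: "br d1 (fam t1)" "br d2 (fam t2)" "br d3 (fam t3)"
    and t: "(t1, q1) \<in> set branch_types" "(t2, q2) \<in> set branch_types" "(t3, q3) \<in> set branch_types"
  shows "\<not> reducible_types t1 t2 t3"
proof
  assume "reducible_types t1 t2 t3"
  moreover have "12 \<le> mis t1 + mis t2 + mis t3"
  proof -
    have "missing_le (mis t) (fam t)" if "(t, q) \<in> set branch_types" for t q
      using mis_missing that by (auto simp: list_all_iff)
    then show ?thesis using br_missing[OF w b] t by blast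
  qed
  moreover have sp: "\<not> reducible (fam s) (fam t) (fam u) \<Longrightarrow> \<not> List.member special (key s, key t, key u)" for s t u
  proof
    assume n: "\<not> reducible (fam s) (fam t) (fam u)" and "List.member special (key s, key t, key u)"
    then have "(key s, key t, key u) \<in> set special" by simp
    from special_reducible[unfolded list_all_iff, THEN bspec, OF this] n show False by (simp add: fam_key)
  qed
  have e: "{d1, d2, d3} = {d1, d3, d2}" "{d1, d2, d3} = {d2, d1, d3}" "{d1, d2, d3} = {d2, d3, d1}"
    "{d1, d2, d3} = {d3, d1, d2}" "{d1, d2, d3} = {d3, d2, d1}" by auto
  note n = w(3-5) w(3-5)[symmetric]
  have "\<not> List.member special (key t1, key t2, key t3)" "\<not> List.member special (key t1, key t3, key t2)"
    "\<not> List.member special (key t2, key t1, key t3)" "\<not> List.member special (key t2, key t3, key t1)"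
    "\<not> List.member special (key t3, key t1, key t2)" "\<not> List.member special (key t3, key t2, key t1)"
    by (rule sp, rule br_not_reducible[OF w(1)], rule w(2)[unfolded e(1)] w(2)[unfolded e(2)] w(2)[unfolded e(3)]
        w(2)[unfolded e(4)] w(2)[unfolded e(5)] w(2), (rule n b)+)+
  ultimately show False unfolding reducible_types_def by simp
qed

text \<open>If \<open>k e = n\<close>, the source of \<open>e\<close> is an
  \<open>(x,y,n)\<close>-vertex seen from its \<open>n\<close>-thread.\<close>

definition ty :: "'d \<Rightarrow> nat \<Rightarrow> nat \<Rightarrow> bool" where
  "ty e x y \<longleftrightarrow> (\<exists>d1 d2. {f \<in> D. src f = src e} = {e, d1, d2} \<and> e \<noteq> d1 \<and> e \<noteq> d2 \<and> d1 \<noteq> d2 \<and> k d1 = x \<and> k d2 = y)"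

lemma ty_iff:
  assumes "{f \<in> D. src f = src e} = {e, d1, d2}" "e \<noteq> d1" "e \<noteq> d2" "d1 \<noteq> d2"
  shows "ty e x y \<longleftrightarrow> k d1 = x \<and> k d2 = y \<or> k d1 = y \<and> k d2 = x"
proof
  assume "ty e x y"
  then obtain a b where ab: "{f \<in> D. src f = src e} = {e, a, b}" "e \<noteq> a" "e \<noteq> b" "a \<noteq> b" "k a = x" "k b = y"
    unfolding ty_def by blast
  have "{a, b} = {e, a, b} - {e}" using ab by auto
  also have "\<dots> = {e, d1, d2} - {e}" using ab(1) assms(1) by simp
  also have "\<dots> = {d1, d2}" using assms by auto
  finally show "k d1 = x \<and> k d2 = y \<or> k d1 = y \<and> k d2 = x" using ab(5,6) by (auto simp: doubleton_eq_iff)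
next
  assume "k d1 = x \<and> k d2 = y \<or> k d1 = y \<and> k d2 = x"
  moreover have "{f \<in> D. src f = src e} = {e, d2, d1}" using assms(1) by (simp add: insert_commute)
  ultimately show "ty e x y" unfolding ty_def using assms by metis
qed

text \<open>Four times the charge that the source of \<open>e\<close> sends along \<open>e\<close>.\<close>

definition tau :: "'d \<Rightarrow> nat" where
  "tau e = (if k e = 0 then
       if ty e 5 5 then 10 else if ty e 5 4 then 6 else if ty e 4 4 \<or> ty e 5 3 then 2
       else if ty e 5 2 \<and> (\<exists>d\<in>D. src d = src e \<and> d \<noteq> e \<and> k d = 2 \<and> ty (rv d) 5 2) then 1 else 0
     else if k e = 1 then
       if ty e 5 3 \<or> ty e 4 4 then 6 else if ty e 4 3 then 2 else if ty e 5 2 \<and> \<not> ty (rv e) 5 2 then 2 else 0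
     else if k e = 2 then
       if ty e 3 3 then 2 else if ty e 4 2 then 1 else if ty e 5 2 then 3
       else if ty e 5 1 \<and> (\<exists>d\<in>D. src d = src e \<and> d \<noteq> e \<and> k d = 1 \<and> ty (rv d) 5 2) then 2 else 0
     else 0)"

lemma ty_brn:
  assumes "d \<in> D" "ty (rv d) x y"
  shows "brn d (node (k d) (leaf x) (leaf y)) (k d + 1) (k d + 2 + max x y)"
proof -
  obtain d1 d2 where *: "{f \<in> D. src f = tgt d} = {rv d, d1, d2}" "rv d \<noteq> d1" "rv d \<noteq> d2" "d1 \<noteq> d2" "k d1 = x" "k d2 = y"
    using assms(2) unfolding ty_def by blast
  have "d1 \<in> D" "d2 \<in> D" using *(1) by blast+
  then have B: "brn d (node (k d) (leaf x) (leaf y)) (k d + 1 + max 0 0) (k d + 1 + max (x + 1) (y + 1))"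
    using brn_node[OF assms(1) *(1-4) brn_leaf[of d1] brn_leaf[of d2]] k_le[of d1] k_le[of d2] *(5,6) by simp
  have "k d + 1 + max (x + 1) (y + 1) = k d + 2 + max x y" "k d + 1 + max 0 0 = k d + 1" by (auto simp: max_def)
  with B show ?thesis by (simp only:)
qed

lemma ty_br:
  assumes "d \<in> D" "ty (rv d) x y" "covers (node (k d) (leaf x) (leaf y)) F" "x \<le> 5" "y \<le> 5"
  shows "br d F"
  using brn_covers[OF ty_brn[OF assms(1,2)] assms(3)] k_le[OF assms(1)] assms(4,5) unfolding br_def
  by (intro exI conjI) auto

text \<open>Trees with two 3-vertices, needed for \<open>k d = 0\<close>, \<open>x = 2\<close> and
  for \<open>k d = 2\<close>, \<open>x = 1\<close>. The condition \<open>x \<noteq> 5\<close>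
  identifies \<open>e\<close> among the two further threads, and \<open>k d + x \<le> 3\<close>
  keeps the tree within the radii of \<open>br\<close>.\<close>

lemma ty_nested:
  assumes d: "d \<in> D" "ty (rv d) 5 x" and e: "e \<in> D" "src e = tgt d" "e \<noteq> rv d" "k e = x" "x \<noteq> 5"
    and t: "ty (rv e) 5 2" and F: "covers (node x (leaf 5) (leaf 2)) F" "covers (node (k d) (leaf 5) F) G"
    and x: "k d + x \<le> 3"
  shows "br d G"
proof -
  obtain d1 d2 where *: "{f \<in> D. src f = tgt d} = {rv d, d1, d2}" "rv d \<noteq> d1" "rv d \<noteq> d2" "d1 \<noteq> d2" "k d1 = 5" "k d2 = x"
    using d(2) unfolding ty_def by blast
  have "e \<in> {rv d, d1, d2}" using e(1,2) *(1) by blast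
  then have e2: "e = d2" using e *(5) by auto
  have d1: "d1 \<in> D" using *(1) by blast
  have "brn d2 F (x + 1) (x + 7)"
    using brn_covers[OF ty_brn[OF e(1) t]] F(1) e(4) e2 by (simp add: add.commute)
  moreover have "brn d1 (leaf 5) 0 6" using brn_leaf[OF d1] *(5) by simp
  ultimately have "brn d (node (k d) (leaf 5) F) (k d + 1 + max 0 (x + 1)) (k d + 1 + max 6 (x + 7))"
    using x by (intro brn_node[OF d(1) *(1-4)]) auto
  from brn_covers[OF this F(2)] show ?thesis unfolding br_def using x by (intro exI conjI) auto
qed

lemma covers_append: "covers F (F @ G)" "covers F (G @ F)"
  by (auto simp: covers_def list_all_iff list_ex_iff sub_iff)

text \<open>Charge arrives only from a vertex of known type, so the tree behind \<open>d\<close> can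
  be taken beyond its first thread; without charge the leaf is used. The last two conjuncts keep
  what the classes forget: \<open>F4\<close> with charge 3 comes from a
  \<open>(5,2,2)\<close>-vertex, and \<open>F5\<close> never enters a \<open>(5,2,1)\<close>-vertex
  through its 1-thread.\<close>

lemma incoming:
  assumes d: "d \<in> D"
  shows "\<exists>c. ((k d, c), tau (rv d)) \<in> set branch_types \<and> br d (fam (k d, c)) \<and>
    (c = F4 \<and> tau (rv d) = 3 \<longrightarrow> ty (rv d) 5 2) \<and> (c = F5 \<longrightarrow> \<not> ty d 5 2)"
proof (cases "tau (rv d) = 0")
  case True
  have "k d \<in> {0, 1, 2, 3, 4, 5}" using k_le[OF d] by auto
  then show ?thesis using br_leaf[OF d] True by (intro exI[of _ Leaf]) (auto simp: branch_types_def)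
next
  case False
  have kr: "k (rv d) = k d" "rv (rv d) = d" using k_rv rv_rv d by auto
  have "k d = 0 \<or> k d = 1 \<or> k d = 2" using False unfolding tau_def kr by (auto split: if_splits)
  then consider "k d = 0" | "k d = 1" | "k d = 2" by (elim disjE) simp_all
  then show ?thesis
  proof cases
    case 1
    note T = ty_br[OF d, unfolded 1]
    consider "ty (rv d) 5 5" "tau (rv d) = 10" | "ty (rv d) 5 4" "tau (rv d) = 6" | "ty (rv d) 4 4" "tau (rv d) = 2"
      | "ty (rv d) 5 3" "tau (rv d) = 2"
      | e where "ty (rv d) 5 2" "e \<in> D" "src e = tgt d" "e \<noteq> rv d" "k e = 2" "ty (rv e) 5 2" "tau (rv d) = 1"
      using False unfolding tau_def kr 1 by (auto split: if_splits)
    then show ?thesis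
    proof cases
      case 1
      then show ?thesis using T[OF _ covers_computed(1)] \<open>k d = 0\<close>
        by (intro exI[of _ F2]) (simp add: branch_types_def)
    next
      case 2
      then show ?thesis using T[OF _ covers_computed(2)] \<open>k d = 0\<close>
        by (intro exI[of _ F2]) (simp add: branch_types_def)
    next
      case 3
      then show ?thesis using T[of 4 4 fam0] covers_append(1) \<open>k d = 0\<close>
        by (intro exI[of _ F0]) (simp add: branch_types_def fam0_def)
    next
      case 4
      then show ?thesis using T[of 5 3 fam0] covers_append(2) \<open>k d = 0\<close>
        by (intro exI[of _ F0]) (simp add: branch_types_def fam0_def)
    next
      case 5
      have "br d fam2"
        using ty_nested[OF d 5(1-5) _ 5(6) covers_computed(3)] covers_computed(5) \<open>k d = 0\<close> by simp
      then show ?thesis using 5 \<open>k d = 0\<close> by (intro exI[of _ F2]) (simp add: branch_types_def)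
    qed
  next
    case 2
    note T = ty_br[OF d, unfolded 2]
    consider "ty (rv d) 5 3" "tau (rv d) = 6" | "ty (rv d) 4 4" "tau (rv d) = 6" | "ty (rv d) 4 3" "tau (rv d) = 2"
      | "ty (rv d) 5 2" "\<not> ty d 5 2" "tau (rv d) = 2"
      using False unfolding tau_def kr 2 by (auto split: if_splits)
    then show ?thesis
    proof cases
      case 1
      then show ?thesis using T[OF _ covers_computed(6)] \<open>k d = 1\<close>
        by (intro exI[of _ F1]) (simp add: branch_types_def)
    next
      case 2
      then show ?thesis using T[OF _ covers_computed(7)] \<open>k d = 1\<close>
        by (intro exI[of _ F1]) (simp add: branch_types_def)
    next
      case 3
      then show ?thesis using T[OF _ covers_computed(10)] \<open>k d = 1\<close>
        by (intro exI[of _ F3]) (simp add: branch_types_def)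
    next
      case 4
      then show ?thesis using T[OF _ covers_computed(8)] \<open>k d = 1\<close>
        by (intro exI[of _ F5]) (simp add: branch_types_def)
    qed
  next
    case 3
    note T = ty_br[OF d, unfolded 3]
    consider "ty (rv d) 3 3" "tau (rv d) = 2" | "ty (rv d) 4 2" "tau (rv d) = 1" | "ty (rv d) 5 2" "tau (rv d) = 3"
      | e where "ty (rv d) 5 1" "e \<in> D" "src e = tgt d" "e \<noteq> rv d" "k e = 1" "ty (rv e) 5 2" "tau (rv d) = 2"
      using False unfolding tau_def kr 3 by (auto split: if_splits)
    then show ?thesis
    proof cases
      case 1
      then show ?thesis using T[OF _ covers_computed(11)] \<open>k d = 2\<close>
        by (intro exI[of _ F3]) (simp add: branch_types_def)
    next
      case 2
      then show ?thesis using T[OF _ covers_computed(4)] \<open>k d = 2\<close>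
        by (intro exI[of _ F4]) (simp add: branch_types_def)
    next
      case 3
      then show ?thesis using T[OF _ covers_computed(3)] \<open>k d = 2\<close>
        by (intro exI[of _ F4]) (simp add: branch_types_def)
    next
      case 4
      have "br d fam1"
        using ty_nested[OF d 4(1-5) _ 4(6) covers_computed(8)] covers_computed(9) \<open>k d = 2\<close> by simp
      then show ?thesis using 4 \<open>k d = 2\<close> by (intro exI[of _ F1]) (simp add: branch_types_def)
    qed
  qed
qed

lemma sorted_darts:
  assumes "w \<in> W"
  obtains d1 d2 d3 where "{e \<in> D. src e = w} = {d1, d2, d3}" "d1 \<noteq> d2" "d1 \<noteq> d3" "d2 \<noteq> d3" "k d3 \<le> k d2" "k d2 \<le> k d1"
proof -
  obtain a b c where abc: "{e \<in> D. src e = w} = {a, b, c}" "a \<noteq> b" "a \<noteq> c" "b \<noteq> c"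
    using three[OF assms] by (auto simp: card_3_iff)
  have e: "{a, b, c} = {a, c, b}" "{a, b, c} = {b, a, c}" "{a, b, c} = {b, c, a}"
    "{a, b, c} = {c, a, b}" "{a, b, c} = {c, b, a}" by auto
  consider "k c \<le> k b \<and> k b \<le> k a" | "k b \<le> k c \<and> k c \<le> k a" | "k c \<le> k a \<and> k a \<le> k b" | "k a \<le> k c \<and> k c \<le> k b"
    | "k b \<le> k a \<and> k a \<le> k c" | "k a \<le> k b \<and> k b \<le> k c" by linarith
  then show thesis
  proof cases
    case 1 then show thesis using that[of a b c] abc by simp
  next
    case 2 then show thesis using that[of a c b] abc e(1) by simp
  next
    case 3 then show thesis using that[of b a c] abc e(2) by simp
  next
    case 4 then show thesis using that[of b c a] abc e(3) by simp
  next
    case 5 then show thesis using that[of c a b] abc e(4) by simp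
  next
    case 6 then show thesis using that[of c b a] abc e(5) by simp
  qed
qed

text \<open>30 is four times 15/2. Irreducibility leaves light vertices, heavy vertices that receive
  nothing and send their excess, and the exceptions for which the types of the branches alone do not
  decide.\<close>

lemma vertex_charge:
  assumes w: "w \<in> W"
  shows "4 * (\<Sum>d | d \<in> D \<and> src d = w. k d) + (\<Sum>d | d \<in> D \<and> src d = w. tau (rv d))
    \<le> 30 + (\<Sum>d | d \<in> D \<and> src d = w. tau d)"
proof -
  obtain d1 d2 d3 where D3: "{e \<in> D. src e = w} = {d1, d2, d3}" "d1 \<noteq> d2" "d1 \<noteq> d3" "d2 \<noteq> d3" "k d3 \<le> k d2" "k d2 \<le> k d1"
    by (rule sorted_darts[OF w])
  have dD: "d1 \<in> D" "d2 \<in> D" "d3 \<in> D" "src d1 = w" "src d2 = w" "src d3 = w" using D3(1) by blast+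
  have T1: "ty d1 x y \<longleftrightarrow> k d2 = x \<and> k d3 = y \<or> k d2 = y \<and> k d3 = x" for x y
    by (rule ty_iff) (use D3 dD in auto)
  have T2: "ty d2 x y \<longleftrightarrow> k d1 = x \<and> k d3 = y \<or> k d1 = y \<and> k d3 = x" for x y
    by (rule ty_iff) (use D3 dD in auto)
  have T3: "ty d3 x y \<longleftrightarrow> k d1 = x \<and> k d2 = y \<or> k d1 = y \<and> k d2 = x" for x y
    by (rule ty_iff) (use D3 dD in auto)
  let ?n = "k d1 + k d2 + k d3" and ?q = "tau (rv d1) + tau (rv d2) + tau (rv d3)"
  have "4 * ?n + ?q \<le> 30 + (tau d1 + tau d2 + tau d3)"
  proof -
    have "\<forall>d\<in>D. \<exists>c. ((k d, c), tau (rv d)) \<in> set branch_types \<and> br d (fam (k d, c)) \<and>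
      (c = F4 \<and> tau (rv d) = 3 \<longrightarrow> ty (rv d) 5 2) \<and> (c = F5 \<longrightarrow> \<not> ty d 5 2)"
      using incoming by blast
    from bchoice[OF this] obtain c where c: "((k d, c d), tau (rv d)) \<in> set branch_types" "br d (fam (k d, c d))"
      "c d = F4 \<and> tau (rv d) = 3 \<longrightarrow> ty (rv d) 5 2" "c d = F5 \<longrightarrow> \<not> ty d 5 2" if "d \<in> D" for d by blast
    note c1 = c[OF dD(1)] and c2 = c[OF dD(2)] and c3 = c[OF dD(3)]
    let ?s = "((k d1, c d1), tau (rv d1))" and ?t = "((k d2, c d2), tau (rv d2))" and ?u = "((k d3, c d3), tau (rv d3))"
    have ok: "charge_ok ?s ?t ?u"
      using charge_ok_all c1(1) c2(1) c3(1) unfolding list_all_iff by blast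
    have nr: "\<not> reducible_types (k d1, c d1) (k d2, c d2) (k d3, c d3)"
      by (rule not_reducible_types[OF w D3(1-4) c1(2) c2(2) c3(2) c1(1) c2(1) c3(1)])
    define has where "has m \<longleftrightarrow> k d1 = m \<or> k d2 = m \<or> k d3 = m" for m
    have "?q = 0 \<and> 8 \<le> ?n \<or> 4 * ?n + ?q \<le> 30 \<or>
      has 5 \<and> has 2 \<and> has 0 \<and> (?s = ((2, F4), 3) \<or> ?t = ((2, F4), 3) \<or> ?u = ((2, F4), 3)) \<and> ?q \<le> 3 \<or>
      has 5 \<and> has 2 \<and> has 1 \<and> (?s = ((1, F5), 2) \<or> ?t = ((1, F5), 2) \<or> ?u = ((1, F5), 2))"
      using ok nr unfolding charge_ok_def Let_def has_def fst_conv snd_conv by metis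
    then consider "?q = 0" "8 \<le> ?n" | "4 * ?n + ?q \<le> 30"
      | "has 5 \<and> has 2 \<and> has 0" "?s = ((2, F4), 3) \<or> ?t = ((2, F4), 3) \<or> ?u = ((2, F4), 3)" "?q \<le> 3"
      | "has 5 \<and> has 2 \<and> has 1" "?s = ((1, F5), 2) \<or> ?t = ((1, F5), 2) \<or> ?u = ((1, F5), 2)" by argo
    then show ?thesis
    proof cases
      case 1
      have k6: "k d \<in> set [0, 1, 2, 3, 4, 5]" if "d \<in> D" for d using k_le[OF that] by auto
      have leaf_bt: "((k d, Leaf), 0) \<in> set branch_types" if "d \<in> D" for d
        using k6[OF that] by (auto simp: branch_types_def)
      have "\<not> reducible_types (k d1, Leaf) (k d2, Leaf) (k d3, Leaf)"
        by (rule not_reducible_types[OF w D3(1-4) _ _ _ leaf_bt[OF dD(1)] leaf_bt[OF dD(2)] leaf_bt[OF dD(3)]])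
          (simp_all add: br_leaf dD)
      moreover have "k d3 \<le> k d2 \<and> k d2 \<le> k d1 \<and> 8 \<le> k d1 + k d2 + k d3 \<longrightarrow>
         reducible_types (k d1, Leaf) (k d2, Leaf) (k d3, Leaf) \<or> List.member [(5,5,0),(5,4,0),(5,3,1),(5,2,2),(4,4,1),(5,3,0),
           (5,2,1),(4,4,0),(4,3,1),(4,2,2),(3,3,2)] (k d1, k d2, k d3)"
        using leaf_types k6[OF dD(1)] k6[OF dD(2)] k6[OF dD(3)] unfolding list_all_iff by blast
      ultimately have M: "(k d1, k d2, k d3) \<in> {(5,5,0),(5,4,0),(5,3,1),(5,2,2),(4,4,1),(5,3,0),
           (5,2,1),(4,4,0),(4,3,1),(4,2,2),(3,3,2)}"
        using D3(5,6) 1(2) by simp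
      \<comment> \<open>A \<open>(5,2,1)\<close>-vertex sends its excess 2 through the 1-thread,
        unless the vertex across is of the same kind; then it uses the 2-thread.\<close>
      show ?thesis
      proof (cases "(k d1, k d2, k d3) = (5, 2, 1)")
        case True
        then have "2 \<le> tau d2 + tau d3"
        proof (cases "ty (rv d3) 5 2")
          case t: True
          have "\<exists>d\<in>D. src d = src d2 \<and> d \<noteq> d2 \<and> k d = 1 \<and> ty (rv d) 5 2"
            using t True dD D3(4) by (intro bexI[of _ d3]) auto
          then have "tau d2 = 2" using True unfolding tau_def T2 by simp
          then show ?thesis by simp
        next
          case False
          then have "tau d3 = 2" using True unfolding tau_def T3 by simp
          then show ?thesis by simp
        qed
        then show ?thesis using True 1(1) by simp
      next
        case False
        then have "4 * ?n \<le> 30 + (tau d1 + tau d2 + tau d3)"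
          using M by (elim insertE emptyE) (simp_all add: tau_def T1 T2 T3)
        then show ?thesis using 1(1) by simp
      qed
    next
      case 2
      then show ?thesis by simp
    next
      case 3
      \<comment> \<open>Here \<open>28 + 3 \<le> 30 + 1\<close>: the charge 3 comes from a
        \<open>(5,2,2)\<close>-vertex across the 2-thread, which is the condition for sending 1
        along the 0-thread.\<close>
      have kk: "k d1 = 5" "k d2 = 2" "k d3 = 0" using 3(1) D3(5,6) unfolding has_def by auto
      then have "ty (rv d2) 5 2" using 3(2) c2(3) by auto
      then have "\<exists>d\<in>D. src d = src d3 \<and> d \<noteq> d3 \<and> k d = 2 \<and> ty (rv d) 5 2"
        using kk dD D3(4) by (intro bexI[of _ d2]) auto
      then have "tau d3 = 1" using kk unfolding tau_def T3 by simp
      then show ?thesis using kk 3(3) by simp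
    next
      case 4
      \<comment> \<open>Void: \<open>F5\<close> entering through the 1-thread contradicts that the
        vertex itself is a \<open>(5,2,1)\<close>-vertex.\<close>
      have kk: "k d1 = 5" "k d2 = 2" "k d3 = 1" using 4(1) D3(5,6) unfolding has_def by auto
      then have "\<not> ty d3 5 2" using 4(2) c3(4) by auto
      then show ?thesis using T3 kk by simp
    qed
  qed
  then show ?thesis using D3(2-4) unfolding D3(1) by simp
qed

text \<open>\<open>rv\<close> permutes the darts, so sent and received charge cancel in the sum over
  all vertices.\<close>

theorem total_length: "2 * (\<Sum>d\<in>D. k d) \<le> 15 * card W"
proof -
  have grp: "(\<Sum>w\<in>W. \<Sum>d | d \<in> D \<and> src d = w. f d) = sum f D" for f :: "'d \<Rightarrow> nat"
    using sum.group[OF finite_D finite_W, of src f] src_W by auto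
  have "bij_betw rv D D"
    by (rule bij_betw_byWitness[of _ rv]) (auto simp: rv_rv rv_D)
  then have "(\<Sum>d\<in>D. tau (rv d)) = (\<Sum>d\<in>D. tau d)" by (rule sum.reindex_bij_betw)
  moreover have "(\<Sum>w\<in>W. 4 * (\<Sum>d | d \<in> D \<and> src d = w. k d) + (\<Sum>d | d \<in> D \<and> src d = w. tau (rv d)))
      \<le> (\<Sum>w\<in>W. 30 + (\<Sum>d | d \<in> D \<and> src d = w. tau d))"
    by (rule sum_mono) (rule vertex_charge)
  ultimately show ?thesis by (simp add: sum.distrib grp flip: sum_distrib_left)
qed

end

section \<open>Threads of a minimal counterexample\<close>

text \<open>Two-distance colorings of the subgraph induced by \<open>S\<close>: the middle vertex of
  a path of length 2 must lie in \<open>S\<close> too, so deleted vertices impose no condition on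
  the rest.\<close>

definition col :: "'a set set \<Rightarrow> 'a set \<Rightarrow> ('a \<Rightarrow> color) \<Rightarrow> bool" where
  "col E S f \<longleftrightarrow> (\<forall>v\<in>S. \<forall>x\<in>S. {v, x} \<in> E \<longrightarrow> f x \<noteq> f v \<and> (\<forall>y\<in>S. {v, y} \<in> E \<and> y \<noteq> x \<longrightarrow> f y \<noteq> f x))"

lemma colD: "col E S f \<Longrightarrow> v \<in> S \<Longrightarrow> x \<in> S \<Longrightarrow> {v, x} \<in> E \<Longrightarrow> f x \<noteq> f v"
  "col E S f \<Longrightarrow> v \<in> S \<Longrightarrow> x \<in> S \<Longrightarrow> {v, x} \<in> E \<Longrightarrow> y \<in> S \<Longrightarrow> {v, y} \<in> E \<Longrightarrow> y \<noteq> x \<Longrightarrow> f y \<noteq> f x"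
  unfolding col_def by blast+

lemma fresh_color:
  assumes "finite X" "card X \<le> 3"
  obtains c :: color where "c \<notin> X"
proof -
  have U: "(UNIV :: color set) = {C1, C2, C3, C4}" using color.exhaust by blast
  have "card (UNIV :: color set) = 4" unfolding U by simp
  then have "X \<noteq> UNIV" using assms(2) by auto
  then show thesis using that by blast
qed

lemma color_permutation:
  fixes a b c d :: color
  assumes "a \<noteq> b" "c \<noteq> d"
  obtains h where "inj h" "h a = c" "h b = d"
proof -
  define b' where "b' = Transposition.transpose a c b"
  have "b' \<noteq> c" using assms(1) unfolding b'_def by (auto simp: Transposition.transpose_def)
  then have "Transposition.transpose b' d c = c" using assms(2) by (simp add: Transposition.transpose_def)
  then show thesis
    using that[of "Transposition.transpose b' d \<circ> Transposition.transpose a c"] unfolding b'_def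
    by (simp add: inj_compose)
qed

section \<open>Walks that do not turn back\<close>

fun nbwalk :: "'a set set \<Rightarrow> 'a list \<Rightarrow> bool" where
  "nbwalk E (x # y # z # r) \<longleftrightarrow> {x, y} \<in> E \<and> x \<noteq> z \<and> nbwalk E (y # z # r)"
| "nbwalk E [x, y] \<longleftrightarrow> {x, y} \<in> E"
| "nbwalk E _ \<longleftrightarrow> True"

lemma nbwalk_edges: "nbwalk E ws \<Longrightarrow> path_edges ws \<subseteq> E"
  by (induction E ws rule: nbwalk.induct) auto

lemma nbwalk_tl: "nbwalk E (x # r) \<Longrightarrow> nbwalk E r"
  by (cases "(E, x # r)" rule: nbwalk.cases) auto

lemma nbwalk_nth:
  assumes "\<And>i. Suc i < length ws \<Longrightarrow> {ws ! i, ws ! Suc i} \<in> E" "\<And>i. Suc (Suc i) < length ws \<Longrightarrow> ws ! i \<noteq> ws ! Suc (Suc i)"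
  shows "nbwalk E ws"
  using assms
proof (induction E ws rule: nbwalk.induct)
  case (1 E x y z r)
  have "nbwalk E (y # z # r)"
  proof (rule 1(1))
    fix i
    show "{(y # z # r) ! i, (y # z # r) ! Suc i} \<in> E" if "Suc i < length (y # z # r)"
      using 1(2)[of "Suc i"] that by simp
    show "(y # z # r) ! i \<noteq> (y # z # r) ! Suc (Suc i)" if "Suc (Suc i) < length (y # z # r)"
      using 1(3)[of "Suc i"] that by simp
  qed
  then show ?case using 1(2)[of 0] 1(3)[of 0] by simp
next
  case (2 E x y)
  then show ?case using 2(1)[of 0] by simp
qed auto

context plane_graph
begin

lemma edge_neq: "{x, y} \<in> E \<Longrightarrow> x \<noteq> y"
  using edgeE[of "{x, y}"] by (auto simp: doubleton_eq_iff)

lemma edge_V: "{x, y} \<in> E \<Longrightarrow> x \<in> V" "{x, y} \<in> E \<Longrightarrow> y \<in> V"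
  using E_subset by blast+

text \<open>Dropping vertices from the front until the tail is distinct isolates a first return.
  Loops are no edges and turning back is excluded, so the return is a cycle; its start is listed
  twice, hence the strict inequality.\<close>

lemma nbwalk_not_distinct:
  assumes girth: "\<And>vs. is_cycle vs \<Longrightarrow> g \<le> length vs"
  shows "nbwalk E ws \<Longrightarrow> \<not> distinct ws \<Longrightarrow> g < length ws"
proof (induction ws)
  case (Cons x r)
  show ?case
  proof (cases "distinct r")
    case False
    then show ?thesis using Cons nbwalk_tl[OF Cons(2)] by force
  next
    case True
    then have "x \<in> set r" using Cons(3) by simp
    then obtain a b where ab: "r = a @ x # b" by (auto simp: in_set_conv_decomp)
    have pe: "path_edges (x # a @ [x]) \<subseteq> E"
      using nbwalk_edges[OF Cons(2)] path_edges_split[of "x # a" x b] ab by auto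
    have d: "distinct (x # a)" using True ab by auto
    obtain y where y: "\<exists>a'. a = y # a'"
    proof (cases a)
      case Nil
      then have "{x, x} \<in> E" using pe by simp
      then show thesis using edge_neq by blast
    qed (use that in blast)
    then obtain a' where a': "a = y # a'" by blast
    have "a' \<noteq> []"
    proof
      assume "a' = []"
      then show False using Cons(2) ab a' by (cases b) auto
    qed
    then have "is_cycle (x # a)"
      using d pe a' unfolding is_cycle_def cycle_edges_def by (cases a') auto
    from girth[OF this] show ?thesis using ab by simp
  qed
qed simp

end

lemma linked_seq:
  fixes y :: "nat \<Rightarrow> color"
  assumes "\<And>i. i < k \<Longrightarrow> y (i + 2) \<noteq> y i \<and> y (i + 2) \<noteq> y (i + 1)"
  shows "linked k (y 0, y 1) (y (k + 1), y k)"
  using assms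
proof (induction k arbitrary: y)
  case (Suc k)
  have "linked k (y 1, y 2) (y (k + 2), y (k + 1))"
    using Suc.IH[of "\<lambda>i. y (i + 1)"] Suc.prems[of "Suc _"] by (simp add: numeral_2_eq_2)
  then show ?case using Suc.prems[of 0] by (auto simp: numeral_2_eq_2 intro!: exI[of _ "y 2"])
qed simp

lemma seq_linked:
  assumes "linked k (a, b) (q, r)"
  shows "\<exists>y. y 0 = a \<and> y 1 = b \<and> y (k + 1) = q \<and> y k = r \<and> (\<forall>i<k. y (i + 2) \<noteq> y i \<and> y (i + 2) \<noteq> y (i + 1))"
  using assms
proof (induction k arbitrary: a b)
  case 0
  then show ?case by (intro exI[of _ "\<lambda>i. if i = 0 then a else b"]) auto
next
  case (Suc k)
  then obtain x where x: "x \<noteq> a" "x \<noteq> b" "linked k (b, x) (q, r)" by auto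
  from Suc.IH[OF x(3)] obtain y where y: "y 0 = b" "y 1 = x" "y (k + 1) = q" "y k = r"
    "\<forall>i<k. y (i + 2) \<noteq> y i \<and> y (i + 2) \<noteq> y (i + 1)" by blast
  define z where "z i = (case i of 0 \<Rightarrow> a | Suc j \<Rightarrow> y j)" for i
  have "z (i + 2) \<noteq> z i \<and> z (i + 2) \<noteq> z (i + 1)" if "i < Suc k" for i
    using that x(1,2) y by (cases i) (auto simp: z_def)
  then show ?case using y by (intro exI[of _ z]) (auto simp: z_def)
qed

text \<open>Six inner vertices put no restriction on the pairs at the two ends, by evaluation. This
  is the origin of the bound 5 on the threads.\<close>

lemma linked_6: "a \<noteq> b \<Longrightarrow> q \<noteq> r \<Longrightarrow> linked 6 (a, b) (q, r)"
proof -
  assume "a \<noteq> b" "q \<noteq> r"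
  have "list_all (\<lambda>(q, r). push 6 (mk (\<lambda>x y. x = q \<and> y = r)) = mk (\<lambda>x y. True)) pairs" by code_simp
  then have "push 6 (mk (\<lambda>x y. x = q \<and> y = r)) = mk (\<lambda>x y. True)"
    using \<open>q \<noteq> r\<close> by (force simp: list_all_iff set_pairs)
  then have "has (push 6 (mk (\<lambda>x y. x = q \<and> y = r))) a b" using \<open>a \<noteq> b\<close> by simp
  then show ?thesis unfolding has_push by auto
qed

lemma nbwalk_join:
  "nbwalk E (xs @ [v]) \<Longrightarrow> nbwalk E (v # u # ys) \<Longrightarrow> xs = [] \<or> last xs \<noteq> u \<Longrightarrow> nbwalk E (xs @ v # u # ys)"
proof (induction xs)
  case (Cons x xs)
  have "nbwalk E (xs @ [v])" using nbwalk_tl[of E x "xs @ [v]"] Cons.prems(1) by simp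
  then have *: "nbwalk E (xs @ v # u # ys)" using Cons by (auto split: if_splits)
  show ?case
  proof (cases xs)
    case Nil
    then show ?thesis using Cons.prems by simp
  next
    case c: (Cons y zs)
    then show ?thesis using * Cons.prems(1) by (cases zs) auto
  qed
qed simp

text \<open>At most three neighbors and the vertex itself fit into four colors, so a partial
  coloring of a neighborhood can be completed.\<close>

lemma injective_extension:
  fixes f :: "'a \<Rightarrow> color"
  assumes "finite N" "card N \<le> 3" "M \<subseteq> N" "inj_on f M" "q \<notin> f ` M"
  shows "\<exists>g. inj_on g N \<and> q \<notin> g ` N \<and> (\<forall>x\<in>M. g x = f x)"
proof -
  have U: "(UNIV :: color set) = {C1, C2, C3, C4}" using color.exhaust by blast
  have c4: "card (UNIV :: color set) = 4" unfolding U by simp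
  have fM: "finite M" using assms finite_subset by blast
  have fU: "finite (UNIV :: color set)" unfolding U by simp
  have "card (insert q (f ` M)) = Suc (card M)" using assms(4,5) fM by (simp add: card_image)
  then have "card (UNIV - insert q (f ` M)) = 4 - Suc (card M)"
    using c4 fU by (subst card_Diff_subset) (auto simp: fM)
  moreover have "card (N - M) = card N - card M" using card_Diff_subset[OF fM assms(3)] .
  ultimately have "card (N - M) \<le> card (UNIV - insert q (f ` M))" using assms(2) by simp
  then obtain h where h: "h ` (N - M) \<subseteq> UNIV - insert q (f ` M)" "inj_on h (N - M)"
    using card_le_inj[of "N - M" "UNIV - insert q (f ` M)"] assms(1) fU finite_subset[OF subset_UNIV fU]
    by (metis finite_Diff)
  define g where "g x = (if x \<in> M then f x else h x)" for x
  have "f ` M \<inter> h ` (N - M) = {}" using h(1) by blast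
  from inj_on_disjoint_Un[OF assms(4) h(2) this] have "inj_on g N"
    using assms(3) by (simp add: g_def[abs_def] Un_absorb1)
  moreover have "q \<notin> g ` N" using h(1) assms(5) by (auto simp: g_def)
  ultimately show ?thesis by (intro exI[of _ g]) (simp add: g_def)
qed

section \<open>Minimal counterexamples: degrees and bridges\<close>

locale minimal_graph = plane_graph V E p c
  for V :: "'a set" and E :: "'a set set" and p :: "'a \<Rightarrow> complex" and c :: "'a set \<Rightarrow> real \<Rightarrow> complex" +
  assumes deg_le: "v \<in> V \<Longrightarrow> card {x. {v, x} \<in> E} \<le> 3"
    and girth21: "is_cycle vs \<Longrightarrow> 21 \<le> length vs"
    and crit_col: "S \<subset> V \<Longrightarrow> \<exists>f. col E S f"
    and no_col: "\<not> col E V f"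
begin

definition nbs :: "'a \<Rightarrow> 'a set" where "nbs v = {x. {v, x} \<in> E}"

lemma nbs_V: "nbs v \<subseteq> V" and finite_nbs [simp]: "finite (nbs v)" and in_nbs: "x \<in> nbs v \<longleftrightarrow> {v, x} \<in> E"
proof -
  show 1: "nbs v \<subseteq> V" using edge_V by (auto simp: nbs_def)
  show "finite (nbs v)" using finite_subset[OF 1 finite_V] .
qed (simp add: nbs_def)

lemma nbs_sym: "x \<in> nbs v \<longleftrightarrow> v \<in> nbs x" by (simp add: in_nbs insert_commute)

lemma nbs_irrefl: "x \<in> nbs v \<Longrightarrow> x \<noteq> v" using edge_neq by (auto simp: in_nbs)

lemma card_nbs: "v \<in> V \<Longrightarrow> card (nbs v) \<le> 3" using deg_le by (simp add: nbs_def)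

lemma col_nbs: "col E S f \<longleftrightarrow> (\<forall>v\<in>S. \<forall>x\<in>nbs v \<inter> S. f x \<noteq> f v \<and> (\<forall>y\<in>nbs v \<inter> S. y \<noteq> x \<longrightarrow> f y \<noteq> f x))"
  unfolding col_def nbs_def by blast

text \<open>\<open>col\<close> concerns one vertex and its neighbors at a time, so it suffices that
  around each vertex the coloring agrees with some correct one.\<close>

lemma col_local:
  assumes "\<And>v. v \<in> V \<Longrightarrow> \<exists>U g. v \<in> U \<and> nbs v \<subseteq> U \<and> col E U g \<and> (\<forall>x\<in>U. f x = g x)"
  shows "col E V f"
  unfolding col_nbs
proof
  fix v assume "v \<in> V"
  from assms[OF this] obtain U g where U: "v \<in> U" "nbs v \<subseteq> U" "col E U g" "\<And>x. x \<in> U \<Longrightarrow> f x = g x" by blast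
  have "nbs v \<inter> V = nbs v" "nbs v \<inter> U = nbs v" using nbs_V[of v] U(2) by blast+
  then show "\<forall>x\<in>nbs v \<inter> V. f x \<noteq> f v \<and> (\<forall>y\<in>nbs v \<inter> V. y \<noteq> x \<longrightarrow> f y \<noteq> f x)"
    using U(1,3)[unfolded col_nbs] U(2,4) by (metis subsetD)
qed

lemma V_nonempty: "V \<noteq> {}"
  using no_col by (auto simp: col_def)

text \<open>A vertex with a single neighbor \<open>u\<close> has to avoid \<open>u\<close> and the
  at most two other neighbors of \<open>u\<close>, which leaves a fourth color.\<close>

lemma min_deg:
  assumes v: "v \<in> V" shows "2 \<le> card (nbs v)"
proof (rule ccontr)
  assume "\<not> ?thesis"
  then have "card (nbs v) \<le> 1" by simp
  then obtain u where u: "nbs v \<subseteq> {u}" by (metis card_le_Suc0_iff_eq finite_nbs One_nat_def subsetI singleton_iff)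
  obtain f where f: "col E (V - {v}) f" using crit_col[of "V - {v}"] v by auto
  \<comment> \<open>If \<open>v\<close> is isolated, nothing has to be avoided.\<close>
  let ?X = "f ` (if u \<in> nbs v then insert u (nbs u - {v}) else {})"
  have card3: "card ?X \<le> 3"
  proof (cases "u \<in> nbs v")
    case True
    then have "v \<in> nbs u" "u \<in> V" using nbs_sym nbs_V by auto
    then have "card (nbs u - {v}) \<le> 2" using card_nbs[of u] by simp
    then have "card (insert u (nbs u - {v})) \<le> 3" using card_insert_le_m1[of 3 "nbs u - {v}" u] by simp
    then show ?thesis using True card_image_le[of "insert u (nbs u - {v})" f] by (simp del: card_insert_if)
  qed simp
  have "finite ?X" by simp
  from fresh_color[OF this card3] obtain q where q: "q \<notin> ?X" by blast
  define h where "h = f(v := q)"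
  have "col E V h"
    unfolding col_nbs
  proof (intro ballI conjI impI)
    fix w x assume w: "w \<in> V" and x: "x \<in> nbs w \<inter> V"
    have xw: "x \<noteq> w" "w \<in> nbs x" using nbs_irrefl x nbs_sym by auto
    show "h x \<noteq> h w"
    proof (cases "x = v \<or> w = v")
      case True
      then consider "x = v" "w = u" "u \<in> nbs v" | "w = v" "x = u" "u \<in> nbs v" using u xw x by auto
      then show ?thesis using q xw by cases (auto simp: h_def)
    next
      case False
      then show ?thesis using f w x unfolding col_nbs h_def by auto
    qed
    fix y assume y: "y \<in> nbs w \<inter> V" "y \<noteq> x"
    show "h y \<noteq> h x"
    proof (cases "w = v")
      case True
      then show ?thesis using u x y by auto
    next
      case wv: False
      have vw: "w = u \<and> u \<in> nbs v" if "x = v \<or> y = v" using that x y u nbs_sym by auto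
      consider "x = v" | "y = v" | "x \<noteq> v" "y \<noteq> v" by blast
      then show ?thesis
      proof cases
        case 1
        then show ?thesis using vw q y by (auto simp: h_def)
      next
        case 2
        then show ?thesis using vw q x y by (auto simp: h_def)
      next
        case 3
        then show ?thesis using f w x y wv unfolding col_nbs h_def by auto
      qed
    qed
  qed
  then show False using no_col by blast
qed

text \<open>Colorings of the two sides of a bridge \<open>{u, v}\<close> are glued after permuting the colors of one side.\<close>

lemma glue:
  assumes S: "S \<subset> V" "S \<noteq> {}" and e: "\<And>x y. x \<in> S \<Longrightarrow> y \<in> V - S \<Longrightarrow> y \<in> nbs x \<Longrightarrow> x = u \<and> y = v"
  shows False
proof (cases "u \<in> S \<and> v \<in> V - S \<and> v \<in> nbs u")
  case False
  then have n: "x \<notin> nbs w" if "w \<in> S" "x \<in> V - S" for w x using e[OF that] that by auto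
  obtain f1 where f1: "col E S f1" using crit_col S(1) by blast
  obtain f2 where f2: "col E (V - S) f2" using crit_col[of "V - S"] S by auto
  have "col E V (\<lambda>x. if x \<in> S then f1 x else f2 x)"
  proof (rule col_local)
    fix w assume w: "w \<in> V"
    show "\<exists>U g. w \<in> U \<and> nbs w \<subseteq> U \<and> col E U g \<and> (\<forall>x\<in>U. (if x \<in> S then f1 x else f2 x) = g x)"
    proof (cases "w \<in> S")
      case True
      then have "nbs w \<subseteq> S" using n[OF True] nbs_V by blast
      then show ?thesis using True f1 by (intro exI[of _ S] exI[of _ f1]) simp
    next
      case False
      then have "nbs w \<subseteq> V - S" using n[of _ w] nbs_sym w nbs_V by blast
      then show ?thesis using False w f2 by (intro exI[of _ "V - S"] exI[of _ f2]) simp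
    qed
  qed
  then show False using no_col by blast
next
  case True
  then have uv: "u \<in> S" "v \<in> V - S" "v \<in> nbs u" "u \<in> nbs v" using nbs_sym by auto
  \<comment> \<open>A second neighbor at each end of the bridge makes each side, enlarged by the far
    end of the bridge, a proper subset, so both enlarged sides have colorings.\<close>
  have more: "\<exists>z\<in>nbs w. z \<noteq> y" if "w \<in> V" for w y
  proof (rule ccontr)
    assume "\<not> ?thesis"
    then have "nbs w \<subseteq> {y}" by auto
    then have "card (nbs w) \<le> 1" using card_mono[of "{y}" "nbs w"] by simp
    then show False using min_deg[OF that] by simp
  qed
  obtain z1 where z1: "z1 \<in> nbs u" "z1 \<noteq> v" using more[of u v] uv S(1) by auto
  have "z1 \<in> S" using e[of u z1] z1 uv nbs_V by auto
  then have "insert u (V - S) \<subset> V" using uv S(1) z1 nbs_irrefl[OF z1(1)] by auto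
  then obtain f2 where f2: "col E (insert u (V - S)) f2" using crit_col by blast
  obtain z2 where z2: "z2 \<in> nbs v" "z2 \<noteq> u" using more[of v u] uv by auto
  have "z2 \<notin> S"
  proof
    assume "z2 \<in> S"
    then show False using e[of z2 v] z2 uv nbs_sym by auto
  qed
  moreover have "z2 \<in> V" using z2 nbs_V by auto
  ultimately have "insert v S \<subset> V" using uv S(1) nbs_irrefl[OF z2(1)] by auto
  then obtain f1 where f1: "col E (insert v S) f1" using crit_col by blast
  have "f1 v \<noteq> f1 u" "f2 v \<noteq> f2 u"
    using colD(1)[OF f1, of u v] colD(1)[OF f2, of u v] uv by (auto simp: in_nbs)
  then obtain h where h: "inj h" "h (f2 u) = f1 u" "h (f2 v) = f1 v"
    using color_permutation[of "f2 u" "f2 v" "f1 u" "f1 v"] by metis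
  define f where "f x = (if x \<in> S then f1 x else h (f2 x))" for x
  have fS: "f x = f1 x" if "x \<in> insert v S" for x using that uv h by (auto simp: f_def)
  have fS': "f x = (h \<circ> f2) x" if "x \<in> insert u (V - S)" for x using that uv h by (auto simp: f_def)
  have hf2: "col E (insert u (V - S)) (h \<circ> f2)" using f2 h(1) unfolding col_def by (simp add: inj_eq)
  have "col E V f"
  proof (rule col_local)
    fix w assume w: "w \<in> V"
    show "\<exists>U g. w \<in> U \<and> nbs w \<subseteq> U \<and> col E U g \<and> (\<forall>x\<in>U. f x = g x)"
    proof (cases "w \<in> S")
      case True
      then have "nbs w \<subseteq> insert v S" using e[OF True] nbs_V by blast
      then show ?thesis using True f1 fS by (intro exI[of _ "insert v S"] exI[of _ f1]) simp
    next
      case False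
      then have "nbs w \<subseteq> insert u (V - S)" using e[of _ w] nbs_sym w nbs_V by blast
      then show ?thesis using False w hf2 fS' by (intro exI[of _ "insert u (V - S)"] exI[of _ "h \<circ> f2"]) simp
    qed
  qed
  then show False using no_col by blast
qed

lemma connected_graph:
  assumes "v \<in> V" "w \<in> V" shows "(v, w) \<in> {(x, y). {x, y} \<in> E}\<^sup>*"
proof (rule ccontr)
  let ?A = "{(x, y). {x, y} \<in> E}"
  let ?S = "{x \<in> V. (v, x) \<in> ?A\<^sup>*}"
  assume "(v, w) \<notin> ?A\<^sup>*"
  then have "?S \<subset> V" "?S \<noteq> {}" using assms by auto
  moreover have "y \<notin> nbs x" if "x \<in> ?S" "y \<in> V - ?S" for x y
    using that rtrancl.rtrancl_into_rtrancl[of v x ?A y] by (auto simp: in_nbs)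
  \<comment> \<open>As \<open>v\<close> itself lies in the component, taking \<open>v\<close> for
    both ends expresses that no edge leaves it.\<close>
  ultimately show False using glue[of ?S v v] by blast
qed

lemma no_bridge:
  assumes e: "{u, v} \<in> E" shows "(u, v) \<in> {(x, y). {x, y} \<in> E \<and> {x, y} \<noteq> {u, v}}\<^sup>*"
proof (rule ccontr)
  let ?A = "{(x, y). {x, y} \<in> E \<and> {x, y} \<noteq> {u, v}}"
  let ?S = "{x \<in> V. (u, x) \<in> ?A\<^sup>*}"
  assume n: "(u, v) \<notin> ?A\<^sup>*"
  then have "?S \<subset> V" "?S \<noteq> {}" using edge_V[OF e] by auto
  moreover have "x = u \<and> y = v" if "x \<in> ?S" "y \<in> V - ?S" "y \<in> nbs x" for x y
  proof -
    have "(x, y) \<notin> ?A" using that rtrancl.rtrancl_into_rtrancl[of u x ?A y] by auto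
    then have "{x, y} = {u, v}" using that(3) by (auto simp: in_nbs)
    then show ?thesis using that n by (auto simp: doubleton_eq_iff)
  qed
  ultimately show False using glue[of ?S u v] by blast
qed

lemma nbwalk_distinct: "nbwalk E ws \<Longrightarrow> length ws \<le> 21 \<Longrightarrow> distinct ws"
  using nbwalk_not_distinct[of 21 ws] girth21 by force

section \<open>Threads as darts\<close>

definition W :: "'a set" where "W = {v \<in> V. card (nbs v) = 3}"

lemma two_nbs: "v \<in> V \<Longrightarrow> v \<notin> W \<Longrightarrow> card (nbs v) = 2"
  using min_deg[of v] card_nbs[of v] by (auto simp: W_def)

text \<open>At a 2-vertex the continuation is forced; at a 3-vertex an arbitrary edge other than the
  one just used is taken.\<close>

definition nxt :: "'a \<times> 'a \<Rightarrow> 'a \<times> 'a" where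
  "nxt a = (snd a, SOME z. z \<in> nbs (snd a) \<and> z \<noteq> fst a)"

definition is_arc :: "'a \<times> 'a \<Rightarrow> bool" where "is_arc a \<longleftrightarrow> {fst a, snd a} \<in> E"

lemma is_arc_nbs: "is_arc a \<longleftrightarrow> snd a \<in> nbs (fst a)" "is_arc a \<longleftrightarrow> fst a \<in> nbs (snd a)"
  by (simp_all add: is_arc_def in_nbs insert_commute)

lemma is_arc_V: "is_arc a \<Longrightarrow> fst a \<in> V" "is_arc a \<Longrightarrow> snd a \<in> V"
  unfolding is_arc_def using edge_V by blast+

lemma nxt_props:
  assumes "is_arc a"
  shows "fst (nxt a) = snd a" "snd (nxt a) \<noteq> fst a" "is_arc (nxt a)"
proof -
  have "2 \<le> card (nbs (snd a))" using min_deg is_arc_V[OF assms] by blast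
  then have "\<not> nbs (snd a) \<subseteq> {fst a}" using card_mono[of "{fst a}" "nbs (snd a)"] by auto
  then have "\<exists>z. z \<in> nbs (snd a) \<and> z \<noteq> fst a" by blast
  from someI_ex[OF this] show "fst (nxt a) = snd a" "snd (nxt a) \<noteq> fst a" "is_arc (nxt a)"
    by (auto simp: nxt_def is_arc_nbs)
qed

lemma nxt_unique:
  assumes "is_arc a" "snd a \<notin> W" "z \<in> nbs (snd a)" "z \<noteq> fst a"
  shows "nxt a = (snd a, z)" "nbs (snd a) = {fst a, z}"
proof -
  have "card (nbs (snd a)) = 2" using two_nbs assms(2) is_arc_V[OF assms(1)] by blast
  moreover have "{fst a, z} \<subseteq> nbs (snd a)" using assms is_arc_nbs by auto
  ultimately show n: "nbs (snd a) = {fst a, z}" using assms(4) card_subset_eq[of "nbs (snd a)" "{fst a, z}"] by auto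
  have "snd (nxt a) \<in> nbs (snd a)" "snd (nxt a) \<noteq> fst a"
    using nxt_props[OF assms(1)] is_arc_nbs(1)[of "nxt a"] by auto
  then show "nxt a = (snd a, z)" using n nxt_props(1)[OF assms(1)] by (metis insertE prod.collapse singletonD)
qed

definition swp :: "'a \<times> 'a \<Rightarrow> 'a \<times> 'a" where "swp a = (snd a, fst a)"

lemma swp_simps [simp]: "fst (swp a) = snd a" "snd (swp a) = fst a" "swp (swp a) = a"
  by (simp_all add: swp_def)

lemma is_arc_swp [simp]: "is_arc (swp a) \<longleftrightarrow> is_arc a"
  by (simp add: is_arc_def insert_commute)

lemma nxt_swp:
  assumes "is_arc a" "snd a \<notin> W" shows "nxt (swp (nxt a)) = swp a"
proof -
  have "is_arc (swp (nxt a))" using nxt_props[OF assms(1)] by simp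
  from nxt_unique(1)[OF this, of "fst a"] show ?thesis
    using nxt_props[OF assms(1)] is_arc_nbs(2)[of a] assms by (simp add: swp_def)
qed

lemma is_arc_funpow: "is_arc a \<Longrightarrow> is_arc ((nxt ^^ i) a)"
  by (induction i) (auto simp: nxt_props)

definition vx :: "'a \<times> 'a \<Rightarrow> nat \<Rightarrow> 'a" where "vx a i = fst ((nxt ^^ i) a)"

lemma vx_simps: "is_arc a \<Longrightarrow> snd ((nxt ^^ i) a) = vx a (Suc i)" "vx a 0 = fst a" "is_arc a \<Longrightarrow> vx a 1 = snd a"
  by (simp_all add: vx_def nxt_props is_arc_funpow)

lemma vx_edge: "is_arc a \<Longrightarrow> {vx a i, vx a (Suc i)} \<in> E" "is_arc a \<Longrightarrow> vx a i \<noteq> vx a (Suc (Suc i))"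
  using is_arc_funpow[of a i] nxt_props(2)[of "(nxt ^^ i) a"] vx_simps(1)[of a i] vx_simps(1)[of a "Suc i"]
  by (simp_all add: is_arc_def vx_def)

lemma vx_V: "is_arc a \<Longrightarrow> vx a i \<in> V"
  using is_arc_V is_arc_funpow unfolding vx_def by blast

lemma vx_nbwalk: "is_arc a \<Longrightarrow> nbwalk E (map (vx a) [0..<n])"
  by (rule nbwalk_nth) (auto simp: vx_edge)

lemma vx_distinct: "is_arc a \<Longrightarrow> i \<le> 20 \<Longrightarrow> j \<le> 20 \<Longrightarrow> vx a i = vx a j \<Longrightarrow> i = j"
  using nbwalk_distinct[OF vx_nbwalk, of a 21] by (auto simp: distinct_map inj_on_def)

lemma vx_nbs: "is_arc a \<Longrightarrow> vx a (Suc i) \<notin> W \<Longrightarrow> nbs (vx a (Suc i)) = {vx a i, vx a (Suc (Suc i))}"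
  using nxt_unique(2)[of "(nxt ^^ i) a" "vx a (Suc (Suc i))"] is_arc_funpow[of a i] vx_simps(1)[of a i]
    vx_edge[of a "Suc i"] vx_edge(2)[of a i]
  by (simp add: in_nbs vx_def)

text \<open>\<open>vx a 2\<close> to \<open>vx a 5\<close> are deleted and the rest is colored;
  whatever the colors of the two remaining vertices at each end, six inner vertices allow the
  completion. The girth makes the eight vertices distinct.\<close>

lemma no_long_thread:
  assumes a: "is_arc a" and n: "\<And>i. 1 \<le> i \<Longrightarrow> i \<le> 6 \<Longrightarrow> vx a i \<notin> W"
  shows False
proof -
  let ?x = "vx a" and ?X = "vx a ` {2..5}"
  have X: "?x i \<in> V" "?x 2 \<in> ?X" for i using vx_V[OF a] by auto
  then have "V - ?X \<subset> V" by blast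
  then obtain f where f: "col E (V - ?X) f" using crit_col by blast
  have inj: "i = j" if "?x i = ?x j" "i \<le> 7" "j \<le> 7" for i j using vx_distinct[OF a _ _ that(1)] that by simp
  have nX: "nbs (?x (Suc i)) = {?x i, ?x (Suc (Suc i))}" if "i < 6" for i using vx_nbs[OF a] n that by simp
  have ends: "?x i \<in> V - ?X" if "i \<in> {0, 1, 6, 7}" for i using inj[of i] that X(1) by force
  have "f (?x 0) \<noteq> f (?x 1)" "f (?x 7) \<noteq> f (?x 6)"
    using colD(1)[OF f ends ends, of 1 0] colD(1)[OF f ends ends, of 6 7] vx_edge(1)[OF a, of 0] vx_edge(1)[OF a, of 6]
    by (simp_all add: insert_commute)
  from seq_linked[OF linked_6[OF this]] obtain y :: "nat \<Rightarrow> color"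
    where y: "y 0 = f (?x 0)" "y 1 = f (?x 1)" "y 7 = f (?x 7)"
    "y 6 = f (?x 6)" "\<forall>i<6. y (i + 2) \<noteq> y i \<and> y (i + 2) \<noteq> y (i + 1)" by auto
  define h where "h v = (if v \<in> ?X then y (SOME i. i \<le> 7 \<and> v = ?x i) else f v)" for v
  have hX: "h (?x i) = y i" if i: "i \<le> 7" for i
  proof (cases "i \<in> {0, 1, 6, 7}")
    case True
    then show ?thesis using ends[OF True] y by (auto simp: h_def)
  next
    case False
    have "(SOME j. j \<le> 7 \<and> ?x i = ?x j) = i"
      by (rule some_equality) (use i inj in auto)
    moreover have "?x i \<in> ?X" using i False by auto
    ultimately show ?thesis by (simp add: h_def)
  qed
  have "col E V h"
    unfolding col_nbs
  proof (rule ballI)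
    fix v assume v: "v \<in> V"
    have "\<forall>z\<in>nbs v. h z \<noteq> h v \<and> (\<forall>z'\<in>nbs v. z' \<noteq> z \<longrightarrow> h z' \<noteq> h z)"
    proof (cases "\<exists>i<6. v = ?x (Suc i)")
      case True
      then obtain i where i: "i < 6" "v = ?x (Suc i)" by blast
      have "y (Suc i) \<noteq> y i"
      proof (cases i)
        case 0
        then show ?thesis using y(1,2) \<open>f (?x 0) \<noteq> f (?x 1)\<close> by simp
      next
        case (Suc j)
        then show ?thesis using y(5)[rule_format, of j] i(1) by simp
      qed
      moreover have "y (i + 2) \<noteq> y i" "y (i + 2) \<noteq> y (i + 1)" using y(5) i(1) by auto
      ultimately show ?thesis using hX[of i] hX[of "Suc i"] hX[of "Suc (Suc i)"] i(1) unfolding i(2) nX[OF i(1)]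
        by auto
    next
      case False
      have "z \<in> V - ?X" if z: "z \<in> nbs v" for z
      proof -
        have "z \<notin> ?X"
        proof
          assume "z \<in> ?X"
          then obtain j where "2 \<le> j" "j \<le> 5" "z = ?x j" by auto
          then obtain i where i: "1 \<le> i" "i < 5" "z = ?x (Suc i)" by (cases j) auto
          then have "v = ?x (Suc (i - 1)) \<or> v = ?x (Suc (Suc i))" using z nX[of i] nbs_sym[of z v] by auto
          moreover have "i - 1 < 6" "Suc i < 6" using i(2) by simp_all
          ultimately show False using False by blast
        qed
        then show ?thesis using z nbs_V by blast
      qed
      moreover from this have "v \<in> V - ?X"
      proof -
        have "\<exists>i<6. ?x j = ?x (Suc i)" if "j \<in> {2..5}" for j
          using that by (intro exI[of _ "j - 1"]) auto
        then show ?thesis using False v by blast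
      qed
      ultimately show ?thesis using f unfolding col_nbs h_def by (simp add: subset_iff)
    qed
    then show "\<forall>x\<in>nbs v \<inter> V. h x \<noteq> h v \<and> (\<forall>y\<in>nbs v \<inter> V. y \<noteq> x \<longrightarrow> h y \<noteq> h x)" by blast
  qed
  then show False using no_col by blast
qed

text \<open>The start is \<open>vx a 0\<close>, the inner vertices are \<open>vx a 1\<close> to
  \<open>vx a (K a)\<close>, and the 3-vertex at the end is \<open>vx a (Suc (K a))\<close>.\<close>

definition K :: "'a \<times> 'a \<Rightarrow> nat" where "K a = (LEAST j. vx a (Suc j) \<in> W)"
definition rv :: "'a \<times> 'a \<Rightarrow> 'a \<times> 'a" where "rv a = swp ((nxt ^^ K a) a)"
definition Ds :: "('a \<times> 'a) set" where "Ds = {a. is_arc a \<and> fst a \<in> W}"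

lemma K_props:
  assumes "is_arc a"
  shows "vx a (Suc (K a)) \<in> W" "K a \<le> 5" "j < K a \<Longrightarrow> vx a (Suc j) \<notin> W"
proof -
  obtain i where i: "1 \<le> i" "i \<le> 6" "vx a i \<in> W" using no_long_thread[OF assms] by blast
  then have "vx a (Suc (i - 1)) \<in> W" by simp
  from LeastI[of "\<lambda>j. vx a (Suc j) \<in> W", OF this] Least_le[of "\<lambda>j. vx a (Suc j) \<in> W", OF this] i
  show "vx a (Suc (K a)) \<in> W" "K a \<le> 5" unfolding K_def by auto
  show "j < K a \<Longrightarrow> vx a (Suc j) \<notin> W" unfolding K_def by (rule not_less_Least)
qed

lemma K_eq: "is_arc a \<Longrightarrow> vx a (Suc n) \<in> W \<Longrightarrow> (\<And>j. j < n \<Longrightarrow> vx a (Suc j) \<notin> W) \<Longrightarrow> K a = n"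
  using K_props(1,3)[of a] by (metis linorder_neqE_nat)

lemma rv_arc: "is_arc a \<Longrightarrow> is_arc (rv a)"
  by (simp add: rv_def is_arc_funpow)

lemma fst_rv: "is_arc a \<Longrightarrow> fst (rv a) = vx a (Suc (K a))"
  by (simp add: rv_def vx_simps)

lemma snd_rv: "snd (rv a) = vx a (K a)"
  by (simp add: rv_def vx_def)

lemma nxt_rv:
  assumes a: "is_arc a" shows "i \<le> K a \<Longrightarrow> (nxt ^^ i) (rv a) = swp ((nxt ^^ (K a - i)) a)"
proof (induction i)
  case (Suc i)
  define m where "m = K a - Suc i"
  have m: "K a - i = Suc m" "m < K a" using Suc.prems by (auto simp: m_def)
  have "(nxt ^^ Suc i) (rv a) = nxt (swp (nxt ((nxt ^^ m) a)))" using Suc m by simp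
  also have "\<dots> = swp ((nxt ^^ m) a)"
    using nxt_swp[OF is_arc_funpow[OF a]] K_props(3)[OF a m(2)] by (simp add: vx_simps(1)[OF a])
  finally show ?case by (simp add: m_def)
qed (simp add: rv_def)

lemma vx_rv:
  assumes a: "is_arc a" "i \<le> Suc (K a)" shows "vx (rv a) i = vx a (Suc (K a) - i)"
proof (cases "i = Suc (K a)")
  case True
  have "vx (rv a) (Suc (K a)) = snd ((nxt ^^ K a) (rv a))" using vx_simps(1)[OF rv_arc[OF a(1)]] by simp
  also have "\<dots> = fst a" using nxt_rv[OF a(1), of "K a"] by simp
  finally show ?thesis using True by (simp add: vx_simps)
next
  case False
  then have "i \<le> K a" using a(2) by simp
  then show ?thesis using nxt_rv[OF a(1), of i] vx_simps(1)[OF a(1), of "K a - i"]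
    by (simp add: vx_def[of "rv a"] Suc_diff_le)
qed

lemma Ds_arc: "d \<in> Ds \<Longrightarrow> is_arc d" by (simp add: Ds_def)

lemma K_rv: "d \<in> Ds \<Longrightarrow> K (rv d) = K d"
proof (rule K_eq)
  assume d: "d \<in> Ds"
  note a = Ds_arc[OF d]
  show "is_arc (rv d)" by (rule rv_arc[OF a])
  show "vx (rv d) (Suc (K d)) \<in> W" using vx_rv[OF a, of "Suc (K d)"] d by (simp add: vx_simps Ds_def)
  fix j assume j: "j < K d"
  then have "vx (rv d) (Suc j) = vx d (Suc (K d - Suc j))" using vx_rv[OF a, of "Suc j"] by (simp add: Suc_diff_Suc)
  then show "vx (rv d) (Suc j) \<notin> W" using K_props(3)[OF a, of "K d - Suc j"] j by simp
qed

lemma rv_Ds: "d \<in> Ds \<Longrightarrow> rv d \<in> Ds"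
  using rv_arc fst_rv K_props(1) by (simp add: Ds_def)

lemma rv_rv: "d \<in> Ds \<Longrightarrow> rv (rv d) = d"
  using nxt_rv[of d "K d"] K_rv[of d] Ds_arc[of d] by (simp add: rv_def[of "rv d"])

lemma rv_neq: "d \<in> Ds \<Longrightarrow> rv d \<noteq> d"
proof
  assume d: "d \<in> Ds" and "rv d = d"
  then have "vx d (Suc (K d)) = vx d 0" using fst_rv[OF Ds_arc[OF d]] by (simp add: vx_simps)
  then show False using vx_distinct[OF Ds_arc[OF d], of "Suc (K d)" 0] K_props(2)[OF Ds_arc[OF d]] by simp
qed

lemma W_V: "W \<subseteq> V" by (auto simp: W_def)

lemma finite_arcs: "finite {a. is_arc a}"
proof (rule finite_subset)
  show "{a. is_arc a} \<subseteq> V \<times> V" using is_arc_V by (force simp: mem_Times_iff)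
qed (simp add: finite_V)

lemma Ds_at: "w \<in> W \<Longrightarrow> {d \<in> Ds. fst d = w} = Pair w ` nbs w"
  by (auto simp: Ds_def is_arc_nbs(1))

interpretation H: darts W Ds fst rv K
proof
  show "finite W" using finite_subset[OF W_V finite_V] .
  show "finite Ds" by (rule finite_subset[OF _ finite_arcs]) (auto simp: Ds_def)
  show "card {d \<in> Ds. fst d = w} = 3" if "w \<in> W" for w
    using that by (simp add: Ds_at[OF that] card_image inj_on_def) (simp add: W_def)
  show "fst d \<in> W" if "d \<in> Ds" for d using that by (simp add: Ds_def)
  show "rv d \<in> Ds" if "d \<in> Ds" for d using rv_Ds[OF that] .
  show "rv (rv d) = d" if "d \<in> Ds" for d using rv_rv[OF that] .
  show "rv d \<noteq> d" if "d \<in> Ds" for d using rv_neq[OF that] .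
  show "K d \<le> 5" if "d \<in> Ds" for d using K_props(2)[OF Ds_arc[OF that]] .
  show "K (rv d) = K d" if "d \<in> Ds" for d using K_rv[OF that] .
qed

definition pl :: "'a \<times> 'a \<Rightarrow> 'a list" where "pl d = map (vx d) [0..<Suc (K d)]"

lemma pl_props:
  assumes "is_arc d"
  shows "pl d @ [fst (rv d)] = map (vx d) [0..<Suc (Suc (K d))]" "pl d \<noteq> []" "hd (pl d) = fst d"
    "last (pl d) = snd (rv d)" "length (pl d) = K d + 1"
proof -
  show "pl d @ [fst (rv d)] = map (vx d) [0..<Suc (Suc (K d))]" by (simp add: pl_def fst_rv[OF assms])
  show "pl d \<noteq> []" "length (pl d) = K d + 1" by (simp_all add: pl_def)
  show "hd (pl d) = fst d" by (simp add: pl_def hd_map vx_simps(2) del: upt_Suc)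
  show "last (pl d) = snd (rv d)" by (simp add: pl_def snd_rv)
qed

definition vl :: "('a \<times> 'a) list \<Rightarrow> 'a list" where "vl ds = concat (map pl ds) @ [fst (rv (last ds))]"

lemma vl_Cons: "r \<noteq> [] \<Longrightarrow> vl (d # r) = pl d @ vl r"
  by (simp add: vl_def)

lemma vl_length: "H.walk ds \<Longrightarrow> length (vl ds) = H.weight ds + 1"
proof -
  assume "H.walk ds"
  then have "set ds \<subseteq> Ds" using H.walk_D by blast
  then have "length (concat (map pl ds)) = H.weight ds"
    by (induction ds) (auto simp: pl_props(5) Ds_arc)
  then show ?thesis by (simp add: vl_def)
qed

text \<open>The second vertex matters at junctions: distinct darts with the same source have
  distinct second vertices, so the vertex list of a walk of darts never turns back.\<close>

lemma vl_start:
  assumes "H.walk (d # r)" shows "\<exists>t. vl (d # r) = fst d # snd d # t"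
proof -
  have d: "is_arc d" using H.walk_D[OF assms] Ds_arc by simp
  show ?thesis
  proof (cases "K d")
    case 0
    then have p: "pl d = [fst d]" by (simp add: pl_def vx_simps(2))
    have t: "fst (rv d) = snd d" using fst_rv[OF d] 0 vx_simps(3)[OF d] by simp
    show ?thesis
    proof (cases r)
      case Nil
      then show ?thesis using p t by (simp add: vl_def)
    next
      case (Cons e s)
      then have "fst e = fst (rv d)" "is_arc e" using assms H.walk_D[of "e # s" e] Ds_arc by auto
      then have "\<exists>t. pl e = fst e # t" using pl_props(2,3)[of e] by (cases "pl e") auto
      then show ?thesis using p t Cons \<open>fst e = fst (rv d)\<close> by (auto simp: vl_def)
    qed
  next
    case (Suc n)
    then have "pl d = vx d 0 # vx d 1 # map (vx d) [2..<Suc (K d)]"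
      by (simp add: pl_def upt_conv_Cons numeral_2_eq_2 del: upt_Suc)
    then show ?thesis using vx_simps(3)[OF d] by (simp add: vl_def vx_simps(2))
  qed
qed

lemma vl_nbwalk: "H.walk ds \<Longrightarrow> ds \<noteq> [] \<Longrightarrow> nbwalk E (vl ds)"
proof (induction ds)
  case (Cons d r)
  have d: "is_arc d" using H.walk_D[OF Cons.prems(1)] Ds_arc by simp
  have 1: "nbwalk E (pl d @ [fst (rv d)])" unfolding pl_props(1)[OF d] by (rule vx_nbwalk[OF d])
  show ?case
  proof (cases r)
    case Nil
    then show ?thesis using 1 by (simp add: vl_def)
  next
    case c: (Cons e s)
    then have w: "H.walk r" "fst e = fst (rv d)" "e \<noteq> rv d" using Cons.prems by auto
    then obtain t where t: "vl r = fst e # snd e # t" using vl_start c by blast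
    have "snd e \<noteq> snd (rv d)" using w(2,3) by (auto simp: prod_eq_iff)
    then have "nbwalk E (pl d @ fst (rv d) # snd e # t)"
      using Cons.IH[OF w(1)] c 1 t w(2) pl_props(4)[OF d] by (intro nbwalk_join) auto
    then show ?thesis using vl_Cons[of r d] c t w(2) by simp
  qed
qed simp

lemma thread_nbs:
  assumes "is_arc d" "i < K d"
  shows "nbs (vx d (Suc i)) = {vx d i, vx d (Suc (Suc i))}"
  using vx_nbs[OF assms(1) K_props(3)[OF assms]] .

lemma long_threads:
  assumes ds: "H.walk ds" "ds \<noteq> []" "fst (rv (last ds)) = fst (hd ds)"
  shows "21 \<le> H.weight ds"
proof -
  obtain d r where dr: "ds = d # r" using ds(2) by (cases ds) auto
  then obtain t where t: "vl ds = fst d # snd d # t" using vl_start ds(1) by blast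
  have "last (vl ds) = fst d" using ds(3) dr by (simp add: vl_def)
  then have "fst d \<in> set (snd d # t)" using t by (metis last_ConsR last_in_set list.distinct(1))
  then have "\<not> distinct (vl ds)" using t by simp
  from nbwalk_not_distinct[OF girth21 vl_nbwalk[OF ds(1,2)] this] vl_length[OF ds(1)]
  show "21 \<le> H.weight ds" by simp
qed

section \<open>Transfer of colorings between the graph and its darts\<close>

lemma thread_colored:
  assumes d: "d \<in> Ds" and f: "col E U f" and U: "\<And>i. i \<le> Suc (K d) \<Longrightarrow> vx d i \<in> U"
  shows "linked (K d) (f (fst d), f (snd d)) (f (fst (rv d)), f (snd (rv d)))"
proof -
  note a = Ds_arc[OF d]
  have "f (vx d (i + 2)) \<noteq> f (vx d i) \<and> f (vx d (i + 2)) \<noteq> f (vx d (i + 1))" if "i < K d" for i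
  proof -
    have n: "vx d i \<in> nbs (vx d (Suc i))" "vx d (Suc (Suc i)) \<in> nbs (vx d (Suc i))" "vx d (Suc (Suc i)) \<noteq> vx d i"
      using thread_nbs[OF a that] vx_edge(2)[OF a, of i] by auto
    have u: "vx d i \<in> U" "vx d (Suc i) \<in> U" "vx d (Suc (Suc i)) \<in> U" using U that by auto
    show ?thesis
      using colD(1)[OF f u(2,3)] colD(2)[OF f u(2,1) _ u(3)] n by (simp add: in_nbs)
  qed
  from linked_seq[of "K d" "\<lambda>i. f (vx d i)", OF this]
  show ?thesis using vx_simps(3)[OF a] by (simp add: fst_rv[OF a] snd_rv vx_simps(2))
qed

text \<open>A coloring of \<open>V - S\<close> gives the colors of the 3-vertices. A dart at a
  remaining 3-vertex may begin with an edge into \<open>S\<close>; it gets a color that is free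
  around its source.\<close>

lemma critical:
  assumes S: "S \<subseteq> W" "S \<noteq> {}" shows "\<exists>a r. H.valid (W - S) a r"
proof -
  have "V - S \<subset> V" using S W_V by blast
  then obtain f where f: "col E (V - S) f" using crit_col by blast
  have "\<forall>v\<in>W - S. \<exists>g. inj_on g (nbs v) \<and> f v \<notin> g ` nbs v \<and> (\<forall>x\<in>nbs v - S. g x = f x)"
  proof
    fix v assume v: "v \<in> W - S"
    then have vV: "v \<in> V - S" using W_V by blast
    have n: "x \<in> V - S" "{v, x} \<in> E" if "x \<in> nbs v - S" for x
      using that nbs_V[of v] in_nbs[of x v] by auto
    show "\<exists>g. inj_on g (nbs v) \<and> f v \<notin> g ` nbs v \<and> (\<forall>x\<in>nbs v - S. g x = f x)"
    proof (rule injective_extension)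
      show "card (nbs v) \<le> 3" using card_nbs vV by blast
      show "inj_on f (nbs v - S)"
      proof (rule inj_onI, rule ccontr)
        fix x y assume xy: "x \<in> nbs v - S" "y \<in> nbs v - S" "f x = f y" "x \<noteq> y"
        show False using colD(2)[OF f vV n[OF xy(1)] n[OF xy(2)]] xy(3,4) by simp
      qed
      show "f v \<notin> f ` (nbs v - S)" using colD(1)[OF f vV n] by force
    qed auto
  qed
  from bchoice[OF this] obtain g where g: "\<And>v. v \<in> W - S \<Longrightarrow> inj_on (g v) (nbs v) \<and> f v \<notin> g v ` nbs v \<and> (\<forall>x\<in>nbs v - S. g v x = f x)"
    by blast
  define r where "r d = g (fst d) (snd d)" for d
  have "H.locally_ok (W - S) f r"
    unfolding H.locally_ok_def
  proof (intro ballI impI conjI)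
    fix d assume d: "d \<in> Ds" "fst d \<in> W - S"
    have dn: "snd d \<in> nbs (fst d)" using Ds_arc[OF d(1)] is_arc_nbs by blast
    then show "r d \<noteq> f (fst d)" using g[OF d(2)] by (force simp: r_def)
    fix e assume e: "e \<in> Ds" "fst e = fst d \<and> e \<noteq> d"
    then have "snd e \<in> nbs (fst d)" "snd e \<noteq> snd d" using Ds_arc[OF e(1)] is_arc_nbs(1)[of e] by (auto simp: prod_eq_iff)
    then have "g (fst d) (snd e) \<noteq> g (fst d) (snd d)" using g[OF d(2)] dn inj_onD[of "g (fst d)" "nbs (fst d)" "snd e" "snd d"] by blast
    then show "r e \<noteq> r d" using e(2) by (simp add: r_def)
  qed
  moreover have "H.dart_ok d f r" if d: "d \<in> Ds" "fst d \<in> W - S" "fst (rv d) \<in> W - S" for d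
  proof -
    note a = Ds_arc[OF d(1)]
    have U: "vx d i \<in> V - S" if i: "i \<le> Suc (K d)" for i
    proof -
      consider "i = 0" | "i = Suc (K d)" | j where "i = Suc j" "j < K d"
        using i by (metis le_less less_Suc_eq_le not0_implies_Suc Suc_less_eq)
      then show ?thesis
      proof cases
        case 3
        then have "vx d i \<notin> W" using K_props(3)[OF a] by simp
        then show ?thesis using vx_V[OF a, of i] S(1) by blast
      qed (use d W_V fst_rv[OF a] in \<open>auto simp: vx_simps(2)\<close>)
    qed
    have "snd d \<in> V - S" using U[of 1] vx_simps(3)[OF a] by simp
    moreover have "snd (rv d) \<in> V - S" using U[of "K d"] by (simp add: snd_rv)
    moreover have "snd d \<in> nbs (fst d)" "snd (rv d) \<in> nbs (fst (rv d))"
      using is_arc_nbs(1)[of d] is_arc_nbs(1)[of "rv d"] a rv_arc[OF a] by simp_all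
    ultimately have "r d = f (snd d)" "r (rv d) = f (snd (rv d))" using g[OF d(2)] g[OF d(3)] by (simp_all add: r_def)
    then show ?thesis using thread_colored[OF d(1) f U] by (simp add: H.dart_ok_def)
  qed
  ultimately show ?thesis unfolding H.valid_def by blast
qed

text \<open>Walking from \<open>fst A\<close> in the other direction ends at a 3-vertex; the reverse
  of this walk is a dart that passes through \<open>A\<close> one step after retracing it.\<close>

lemma on_thread:
  assumes A: "is_arc A" "fst A \<notin> W"
  obtains d i where "d \<in> Ds" "1 \<le> i" "i \<le> K d" "(nxt ^^ i) d = A"
proof -
  let ?B = "nxt (swp A)"
  have B: "is_arc ?B" "fst ?B = fst A" using nxt_props[of "swp A"] A(1) by auto
  have rB: "is_arc (rv ?B)" by (rule rv_arc[OF B(1)])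
  have d: "rv ?B \<in> Ds" using rB fst_rv[OF B(1)] K_props(1)[OF B(1)] by (simp add: Ds_def)
  have n: "(nxt ^^ Suc (K ?B)) (rv ?B) = A"
    using nxt_rv[OF B(1), of "K ?B"] nxt_swp[of "swp A"] A by simp
  have "vx (rv ?B) (Suc j) \<notin> W" if j: "j < Suc (K ?B)" for j
  proof (cases "j = K ?B")
    case True
    then have "vx (rv ?B) (Suc j) = fst ((nxt ^^ Suc (K ?B)) (rv ?B))" by (simp only: vx_def)
    then show ?thesis using n A(2) by simp
  next
    case False
    then have "vx (rv ?B) (Suc j) = vx ?B (Suc (K ?B - Suc j))" using vx_rv[OF B(1), of "Suc j"] j by (simp add: Suc_diff_Suc)
    then show ?thesis using K_props(3)[OF B(1), of "K ?B - Suc j"] j False by simp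
  qed
  then have "\<not> K (rv ?B) < Suc (K ?B)" using K_props(1)[OF rB] by blast
  then show thesis using that[OF d _ _ n] by simp
qed

text \<open>An arc determines the rest of its thread, hence the end \<open>rv d\<close> and the
  number \<open>K d - i\<close> of remaining inner vertices.\<close>

lemma thread_unique:
  assumes d: "d \<in> Ds" "i \<le> K d" and e: "e \<in> Ds" "j \<le> K e" and eq: "(nxt ^^ i) d = (nxt ^^ j) e"
  shows "d = e \<and> i = j"
proof -
  have K: "K ((nxt ^^ i) d) = K d - i" "rv ((nxt ^^ i) d) = rv d" if "d \<in> Ds" "i \<le> K d" for d i
  proof -
    note a = Ds_arc[OF that(1)]
    have v: "vx ((nxt ^^ i) d) j = vx d (i + j)" for j by (simp add: vx_def funpow_add[symmetric] add.commute flip: comp_apply[of "nxt ^^ _" "nxt ^^ _"])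
    show k: "K ((nxt ^^ i) d) = K d - i"
    proof (rule K_eq[OF is_arc_funpow[OF a]])
      show "vx ((nxt ^^ i) d) (Suc (K d - i)) \<in> W" using v that(2) K_props(1)[OF a] by simp
      show "vx ((nxt ^^ i) d) (Suc j) \<notin> W" if "j < K d - i" for j
        using v[of "Suc j"] K_props(3)[OF a, of "i + j"] that by simp
    qed
    have "(nxt ^^ (K d - i)) ((nxt ^^ i) d) = (nxt ^^ (K d - i + i)) d" by (simp only: funpow_add comp_apply)
    then show "rv ((nxt ^^ i) d) = rv d" using k that(2) by (simp add: rv_def)
  qed
  have "rv d = rv e" using K(2)[OF d] K(2)[OF e] eq by simp
  then have "d = e" using rv_rv d(1) e(1) by metis
  moreover have "K d - i = K e - j" using K(1)[OF d] K(1)[OF e] eq by simp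
  ultimately show ?thesis using d(2) e(2) by simp
qed

lemma thread_vertex_unique:
  assumes d: "d \<in> Ds" "1 \<le> i" "i \<le> K d" and e: "e \<in> Ds" "1 \<le> j" "j \<le> K e" and eq: "vx d i = vx e j"
  shows "d = e \<and> i = j \<or> d = rv e \<and> i = Suc (K e) - j"
proof -
  obtain j' where j': "j = Suc j'" "j' < K e" using e by (cases j) auto
  note a = Ds_arc[OF d(1)] and b = Ds_arc[OF e(1)]
  have "vx d (Suc i) \<in> nbs (vx e j)" using vx_edge(1)[OF a, of i] eq by (simp add: in_nbs)
  then consider "vx d (Suc i) = vx e (Suc j)" | "vx d (Suc i) = vx e j'" using thread_nbs[OF b j'(2)] j' by auto
  then show ?thesis
  proof cases
    case 1
    then have "(nxt ^^ i) d = (nxt ^^ j) e"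
      using eq vx_simps(1)[OF a, of i] vx_simps(1)[OF b, of j] by (auto simp: prod_eq_iff vx_def)
    from thread_unique[OF d(1,3) e(1,3) this] show ?thesis by blast
  next
    case 2
    have r: "(nxt ^^ (K e - j')) (rv e) = swp ((nxt ^^ j') e)" using nxt_rv[OF b, of "K e - j'"] j' by simp
    have "(nxt ^^ i) d = swp ((nxt ^^ j') e)"
      using 2 eq vx_simps(1)[OF a, of i] vx_simps(1)[OF b, of j'] j' by (auto simp: prod_eq_iff vx_def)
    then have "(nxt ^^ i) d = (nxt ^^ (K e - j')) (rv e)" using r by simp
    from thread_unique[OF d(1,3) rv_Ds[OF e(1)] _ this] show ?thesis using K_rv[OF e(1)] j' by auto
  qed
qed

text \<open>The links of \<open>d\<close> and \<open>rv d\<close> may be realized by different color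
  sequences, so one direction of each thread is selected and only its sequence is used.\<close>

lemma uncolorable: "\<not> H.valid W a r"
proof
  assume v: "H.valid W a r"
  have lok: "r d \<noteq> a (fst d)" "e \<in> Ds \<Longrightarrow> fst e = fst d \<Longrightarrow> e \<noteq> d \<Longrightarrow> r e \<noteq> r d" if "d \<in> Ds" for d e
  proof -
    have "fst d \<in> W" using that by (simp add: Ds_def)
    then show "r d \<noteq> a (fst d)" "e \<in> Ds \<Longrightarrow> fst e = fst d \<Longrightarrow> e \<noteq> d \<Longrightarrow> r e \<noteq> r d"
      using v that unfolding H.valid_def H.locally_ok_def by simp_all
  qed
  have "\<forall>d\<in>Ds. \<exists>y. y 0 = a (fst d) \<and> y 1 = r d \<and> y (K d + 1) = a (fst (rv d)) \<and> y (K d) = r (rv d) \<and>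
    (\<forall>i<K d. y (i + 2) \<noteq> y i \<and> y (i + 2) \<noteq> y (i + 1))"
  proof
    fix d assume d: "d \<in> Ds"
    have "fst d \<in> W" "fst (rv d) \<in> W" using d rv_Ds[OF d] by (simp_all add: Ds_def)
    then have "H.dart_ok d a r" using v d unfolding H.valid_def by simp
    then show "\<exists>y. y 0 = a (fst d) \<and> y 1 = r d \<and> y (K d + 1) = a (fst (rv d)) \<and> y (K d) = r (rv d) \<and>
      (\<forall>i<K d. y (i + 2) \<noteq> y i \<and> y (i + 2) \<noteq> y (i + 1))"
      unfolding H.dart_ok_def by (rule seq_linked)
  qed
  from bchoice[OF this] obtain Y where Y: "\<And>d. d \<in> Ds \<Longrightarrow> Y d 0 = a (fst d) \<and> Y d 1 = r d \<and>
    Y d (K d + 1) = a (fst (rv d)) \<and> Y d (K d) = r (rv d) \<and>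
    (\<forall>i<K d. Y d (i + 2) \<noteq> Y d i \<and> Y d (i + 2) \<noteq> Y d (i + 1))" by blast
  \<comment> \<open>The choice depends only on the set \<open>{d, rv d}\<close>, which is the same
    for both directions.\<close>
  define rep where "rep d = (SOME e. e \<in> {d, rv d})" for d
  define R where "R = {d \<in> Ds. rep d = d}"
  have R: "d \<in> R \<or> rv d \<in> R" "d \<in> R \<Longrightarrow> rv d \<notin> R" if "d \<in> Ds" for d
  proof -
    have "{rv d, rv (rv d)} = {d, rv d}" using rv_rv[OF that] by auto
    then have "rep (rv d) = rep d" by (simp add: rep_def)
    moreover have "rep d \<in> {d, rv d}" unfolding rep_def by (rule someI[of _ d]) simp
    ultimately show "d \<in> R \<or> rv d \<in> R" "d \<in> R \<Longrightarrow> rv d \<notin> R"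
      using that rv_Ds[OF that] rv_neq[OF that] by (auto simp: R_def)
  qed
  have RD: "d \<in> Ds" if "d \<in> R" for d using that by (simp add: R_def)
  define pos where "pos v = (SOME di. fst di \<in> R \<and> 1 \<le> snd di \<and> snd di \<le> K (fst di) \<and> vx (fst di) (snd di) = v)" for v
  define f where "f v = (if v \<in> W then a v else Y (fst (pos v)) (snd (pos v)))" for v
  have inner: "f (vx d i) = Y d i" if d: "d \<in> R" "1 \<le> i" "i \<le> K d" for d i
  proof -
    obtain i' where i': "i = Suc i'" "i' < K d" using d by (cases i) auto
    then have nW: "vx d i \<notin> W" using K_props(3)[OF Ds_arc[OF RD[OF d(1)]]] by simp
    have "fst (d, i) \<in> R \<and> 1 \<le> snd (d, i) \<and> snd (d, i) \<le> K (fst (d, i)) \<and> vx (fst (d, i)) (snd (d, i)) = vx d i" using d by simp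
    from someI[of "\<lambda>di. fst di \<in> R \<and> 1 \<le> snd di \<and> snd di \<le> K (fst di) \<and> vx (fst di) (snd di) = vx d i", OF this]
    have P: "fst (pos (vx d i)) \<in> R \<and> 1 \<le> snd (pos (vx d i)) \<and> snd (pos (vx d i)) \<le> K (fst (pos (vx d i))) \<and>
        vx (fst (pos (vx d i))) (snd (pos (vx d i))) = vx d i" unfolding pos_def .
    obtain e j where ej: "pos (vx d i) = (e, j)" by (cases "pos (vx d i)")
    have e: "e \<in> R" "1 \<le> j" "j \<le> K e" "vx e j = vx d i" using P unfolding ej by simp_all
    have "e = d \<and> j = i"
      using thread_vertex_unique[OF RD[OF e(1)] e(2,3) RD[OF d(1)] d(2,3) e(4)] R(2)[OF RD[OF d(1)] d(1)] e(1) by blast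
    then show ?thesis using nW ej by (simp add: f_def)
  qed
  have all: "f (vx d i) = Y d i" if d: "d \<in> R" and i: "i \<le> Suc (K d)" for d i
  proof -
    note D = RD[OF d] and A = Ds_arc[OF RD[OF d]]
    consider "i = 0" | "1 \<le> i" "i \<le> K d" | "i = Suc (K d)" using i by linarith
    then show ?thesis
    proof cases
      case 1
      then show ?thesis using Y[OF D] D by (simp add: f_def vx_simps(2) Ds_def)
    next
      case 2
      then show ?thesis using inner[OF d] by blast
    next
      case 3
      then show ?thesis using Y[OF D] K_props(1)[OF A] by (simp add: f_def fst_rv[OF A])
    qed
  qed
  have "col E V f"
    unfolding col_nbs
  proof
    fix v assume vV: "v \<in> V"
    show "\<forall>x\<in>nbs v \<inter> V. f x \<noteq> f v \<and> (\<forall>y\<in>nbs v \<inter> V. y \<noteq> x \<longrightarrow> f y \<noteq> f x)"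
    proof (cases "v \<in> W")
      case True
      have d: "(v, x) \<in> Ds \<and> f x = r (v, x)" if "x \<in> nbs v" for x
      proof -
        have d: "(v, x) \<in> Ds" using that True by (simp add: Ds_def is_arc_nbs)
        note x = vx_simps(3)[OF Ds_arc[OF d], simplified]
        show ?thesis
        proof (cases "(v, x) \<in> R")
          case True
          then show ?thesis using d all[OF True, of 1] Y[OF d] x by simp
        next
          case False
          then have q: "rv (v, x) \<in> R" using R(1)[OF d] by blast
          have "vx (rv (v, x)) (K (v, x)) = x" using vx_rv[OF Ds_arc[OF d], of "K (v, x)"] x by simp
          then show ?thesis
            using d all[OF q, of "K (v, x)"] Y[OF rv_Ds[OF d]] K_rv[OF d] rv_rv[OF d] by simp
        qed
      qed
      have fv: "f v = a v" using True by (simp add: f_def)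
      have "f x \<noteq> f v" if "x \<in> nbs v" for x using d[OF that] lok(1)[of "(v, x)"] fv by simp
      moreover have "f y \<noteq> f x" if "x \<in> nbs v" "y \<in> nbs v" "y \<noteq> x" for x y
        using d[OF that(1)] d[OF that(2)] lok(2)[of "(v, x)" "(v, y)"] that(3) by simp
      ultimately show ?thesis by blast
    next
      case False
      obtain x where "x \<in> nbs v" using min_deg[OF vV] by (metis card.empty equals0I not_numeral_le_zero)
      then have "is_arc (v, x)" by (simp add: is_arc_nbs)
      from on_thread[OF this] False obtain e i where e: "e \<in> Ds" "1 \<le> i" "i \<le> K e" "(nxt ^^ i) e = (v, x)" by auto
      then have ve: "vx e i = v" by (simp add: vx_def)
      obtain d i where d: "d \<in> R" "1 \<le> i" "i \<le> K d" "vx d i = v"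
      proof (cases "e \<in> R")
        case True
        then show thesis using that[of e i] e ve by simp
      next
        case False
        then have "rv e \<in> R" using R(1)[OF e(1)] by blast
        then show thesis using that[of "rv e" "Suc (K e) - i"] e ve K_rv[OF e(1)] vx_rv[OF Ds_arc[OF e(1)], of "Suc (K e) - i"]
          by simp
      qed
      obtain j where j: "i = Suc j" "j < K d" using d by (cases i) auto
      note D = RD[OF d(1)]
      have vd: "v = vx d (Suc j)" using d(4) j(1) by simp
      have n: "nbs v = {vx d j, vx d (Suc (Suc j))}" using thread_nbs[OF Ds_arc[OF D] j(2)] vd by simp
      have "Y d (j + 2) \<noteq> Y d j" "Y d (j + 2) \<noteq> Y d (j + 1)" using Y[OF D] j(2) by blast+
      moreover have "Y d (j + 1) \<noteq> Y d j"
      proof (cases j)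
        case 0
        then show ?thesis using Y[OF D] lok(1)[OF D] by simp
      next
        case (Suc m)
        then show ?thesis using Y[OF D] j(2) by (metis Suc_lessD add_2_eq_Suc' Suc_eq_plus1)
      qed
      ultimately show ?thesis
        using all[OF d(1), of j] all[OF d(1), of "Suc j"] all[OF d(1), of "Suc (Suc j)"] j(2) vd unfolding n by auto
    qed
  qed
  then show False using no_col by blast
qed

interpretation H: critical_darts W Ds fst rv K
proof
  show "21 \<le> H.weight ds" if "H.walk ds" "ds \<noteq> []" "fst (rv (last ds)) = fst (hd ds)" for ds
    by (rule long_threads[OF that])
  show "\<exists>a r. H.valid (W - S) a r" if "S \<subseteq> W" "S \<noteq> {}" for S by (rule critical[OF that])
  show "\<not> H.valid W a r" for a r by (rule uncolorable)
qed

section \<open>The final count\<close>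

lemma incident_card: "card {e \<in> E. v \<in> e} = card (nbs v)"
proof -
  have "{e \<in> E. v \<in> e} = (\<lambda>x. {v, x}) ` nbs v"
  proof
    show "{e \<in> E. v \<in> e} \<subseteq> (\<lambda>x. {v, x}) ` nbs v"
    proof
      fix e assume e: "e \<in> {e \<in> E. v \<in> e}"
      then obtain x y where "e = {x, y}" using edgeE by blast
      then have "e = {v, x} \<or> e = {v, y}" using e by auto
      then show "e \<in> (\<lambda>x. {v, x}) ` nbs v" using e by (auto simp: in_nbs)
    qed
  qed (auto simp: in_nbs)
  moreover have "inj_on (\<lambda>x. {v, x}) (nbs v)" by (auto simp: inj_on_def doubleton_eq_iff)
  ultimately show ?thesis by (simp add: card_image)
qed

interpretation P: plane_graph23 V E p c 21
proof
  show "card {e \<in> E. v \<in> e} \<in> {2, 3}" if "v \<in> V" for v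
    using min_deg[OF that] card_nbs[OF that] by (auto simp: incident_card)
qed (use connected_graph no_bridge V_nonempty girth21 in auto)

theorem impossible: False
proof -
  have fW: "finite W" using finite_subset[OF W_V finite_V] .
  have hs: "(\<Sum>v\<in>V. card {e \<in> E. v \<in> e}) = 2 * card E"
  proof (rule sum_multicount[OF finite_V finite_E])
    show "\<forall>e\<in>E. card {v \<in> V. v \<in> e} = 2"
    proof
      fix e assume e: "e \<in> E"
      then obtain x y where xy: "x \<noteq> y" "e = {x, y}" using edgeE by blast
      have "{v \<in> V. v \<in> e} = e" using E_subset[OF e] by auto
      then show "card {v \<in> V. v \<in> e} = 2" using xy by simp
    qed
  qed
  have "(\<Sum>v\<in>V. card {e \<in> E. v \<in> e}) = (\<Sum>v\<in>W. card (nbs v)) + (\<Sum>v\<in>V - W. card (nbs v))"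
    using sum.subset_diff[OF W_V finite_V, of "\<lambda>v. card (nbs v)"] by (simp add: incident_card add.commute)
  also have "(\<Sum>v\<in>W. card (nbs v)) = 3 * card W" by (simp add: W_def)
  also have s2: "(\<Sum>v\<in>V - W. card (nbs v)) = 2 * card (V - W)" using two_nbs by simp
  finally have e: "2 * card E = 3 * card W + 2 * card (V - W)" using hs by simp
  have V: "card V = card W + card (V - W)" using card_Diff_subset[OF fW W_V] card_mono[OF finite_V W_V] by simp
  \<comment> \<open>Two arcs leave each 2-vertex, and each of them occurs at an inner position of
    some dart.\<close>
  have "2 * card (V - W) = card (SIGMA v:V - W. nbs v)" using s2 finite_V by simp
  also have "\<dots> \<le> card ((\<lambda>(d, i). (nxt ^^ i) d) ` (SIGMA d:Ds. {1..K d}))"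
  proof (rule card_mono)
    show "finite ((\<lambda>(d, i). (nxt ^^ i) d) ` (SIGMA d:Ds. {1..K d}))" using H.finite_D by auto
    show "(SIGMA v:V - W. nbs v) \<subseteq> (\<lambda>(d, i). (nxt ^^ i) d) ` (SIGMA d:Ds. {1..K d})"
    proof
      fix A assume "A \<in> (SIGMA v:V - W. nbs v)"
      then have "is_arc A" "fst A \<notin> W" by (auto simp: is_arc_nbs)
      from on_thread[OF this] obtain d i where "d \<in> Ds" "1 \<le> i" "i \<le> K d" "(nxt ^^ i) d = A" by blast
      then show "A \<in> (\<lambda>(d, i). (nxt ^^ i) d) ` (SIGMA d:Ds. {1..K d})" by force
    qed
  qed
  also have "\<dots> \<le> card (SIGMA d:Ds. {1..K d})" using H.finite_D by (intro card_image_le) auto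
  also have "\<dots> = (\<Sum>d\<in>Ds. K d)" using H.finite_D by simp
  finally have "2 * card (V - W) \<le> (\<Sum>d\<in>Ds. K d)" .
  \<comment> \<open>With \<open>n\<close> vertices of degree 3 and \<open>m\<close> of degree 2, the
    discharging gives \<open>4 m \<le> 15 n\<close> and the face bound
    \<open>15 n + 84 \<le> 4 m\<close>.\<close>
  then show False using H.total_length P.euler_bound e V by simp
qed

end

section \<open>Two-distance colorings\<close>

context pair_graph
begin

lemma in_edges_iff: "{x, y} \<in> edges G \<longleftrightarrow> (x, y) \<in> parcs G"
  unfolding edges_def using arcs_symmetric by (force simp: doubleton_eq_iff)

lemma pcas_zip: "pcas x (zip (x # xs) xs) (last (x # xs))"
  by (induction xs arbitrary: x) auto

lemma pawalk_verts_zip: "pawalk_verts x (zip (x # xs) xs) = x # xs"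
  by (induction xs arbitrary: x) auto

lemma set_zip_subset: "path_edges (x # xs) \<subseteq> edges G \<Longrightarrow> set (zip (x # xs) xs) \<subseteq> parcs G"
proof (induction xs arbitrary: x)
  case (Cons y r)
  then show ?case using in_edges_iff[of x y] by simp
qed simp

lemma girth_le_cycle:
  assumes "distinct vs" "3 \<le> length vs" "cycle_edges vs \<subseteq> edges G"
  shows "girth G \<le> enat (length vs)"
proof -
  obtain x r where vs: "vs = x # r" using assms(2) by (cases vs) auto
  define q where "q = zip (x # r @ [x]) (r @ [x])"
  have q: "set q \<subseteq> parcs G"
    unfolding q_def by (rule set_zip_subset) (use assms(3) in \<open>simp add: vs cycle_edges_def\<close>)
  have len: "length q = length vs" by (simp add: q_def vs)
  have "(x, hd (r @ [x])) \<in> set q" unfolding q_def by (cases r) auto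
  then have "x \<in> pverts G" using q in_arcsD1 by blast
  moreover have "pcas x q x" using pcas_zip[of x "r @ [x]"] unfolding q_def by simp
  ultimately have "awalk x q x" using q unfolding awalk_def by simp
  moreover have "pawalk_verts x q = x # r @ [x]" unfolding q_def by (rule pawalk_verts_zip)
  then have "distinct (tl (pawalk_verts x q))" using assms(1) vs by simp
  moreover have "q \<noteq> []" using len assms(2) by auto
  ultimately have "cycle q" unfolding cycle_def by blast
  then show ?thesis unfolding girth_def using len assms(2) by (intro INF_lower2[of q]) auto
qed

lemma card_neighbors_le:
  assumes "v \<in> pverts G"
  shows "card {x. {v, x} \<in> edges G} \<le> max_degree G"
proof -
  have "{e \<in> parcs G. fst e = v} = Pair v ` {x. {v, x} \<in> edges G}"
    unfolding in_edges_iff by force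
  then have "out_degree (with_proj G) v = card {x. {v, x} \<in> edges G}"
    unfolding out_degree_def out_arcs_def by (simp add: card_image inj_on_def)
  moreover have "out_degree (with_proj G) v \<le> max_degree G"
    unfolding max_degree_def using assms pair_finite_verts by (intro Max_ge) auto
  ultimately show ?thesis by simp
qed

text \<open>The distance is an infimum over walks; if each had at least three arcs, it would be at
  least 3.\<close>

lemma graph_dist_le_2:
  assumes "graph_dist G u v \<le> 2" "u \<noteq> v"
  shows "(u, v) \<in> parcs G \<or> (\<exists>w. (u, w) \<in> parcs G \<and> (w, v) \<in> parcs G)"
proof -
  have "\<exists>q. awalk u q v \<and> length q \<le> 2"
  proof (rule ccontr)
    assume a: "\<not> ?thesis"
    have "ereal 3 \<le> graph_dist G u v"
      unfolding graph_dist_def \<mu>_def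
    proof (rule INF_greatest)
      fix q assume "q \<in> {q. awalk u q v}"
      then have "3 \<le> length q" using a by (metis mem_Collect_eq not_less_eq_eq numeral_2_eq_2 numeral_3_eq_3)
      moreover have "awalk_cost (\<lambda>_. 1) q = length q" unfolding awalk_cost_def by (simp add: sum_list_triv)
      ultimately show "ereal 3 \<le> ereal (awalk_cost (\<lambda>_. 1) q)" by simp
    qed
    then have "ereal 3 \<le> 2" using assms(1) by (rule order_trans)
    then show False by simp
  qed
  then obtain q where q: "set q \<subseteq> parcs G" "pcas u q v" "length q \<le> 2" unfolding awalk_def by auto
  consider "q = []" | e where "q = [e]" | e e' where "q = [e, e']"
  proof (cases q)
    case (Cons e r)
    show thesis
    proof (cases r)
      case Nil
      then show thesis using that(2) Cons by simp
    next
      fix e' r' assume "r = e' # r'"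
      then show thesis using that(3) Cons q(3) by simp
    qed
  qed (rule that(1))
  then show ?thesis
  proof cases
    case 1
    then show ?thesis using q assms(2) by simp
  next
    case (2 e)
    then show ?thesis using q by (cases e) auto
  next
    case (3 e e')
    then show ?thesis using q by (cases e, cases e') auto
  qed
qed

lemma two_distance_coloring_if_col:
  assumes "col (edges G) (pverts G) f"
  shows "two_distance_coloring G 4 (\<lambda>v. case f v of C1 \<Rightarrow> 1 | C2 \<Rightarrow> 2 | C3 \<Rightarrow> 3 | C4 \<Rightarrow> 4)"
    (is "two_distance_coloring G 4 ?\<phi>")
proof -
  have inj: "f u = f v" if "?\<phi> u = ?\<phi> v" for u v
    using that by (cases "f u"; cases "f v") auto
  have "f u \<noteq> f v" if "u \<in> pverts G" "v \<in> pverts G" "u \<noteq> v" "graph_dist G u v \<le> 2" for u v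
    using graph_dist_le_2[OF that(4,3)]
  proof (elim disjE exE conjE)
    assume "(u, v) \<in> parcs G"
    then have "{u, v} \<in> edges G" by (simp add: in_edges_iff)
    from colD(1)[OF assms that(1,2) this] show ?thesis by simp
  next
    fix w assume w: "(u, w) \<in> parcs G" "(w, v) \<in> parcs G"
    then have e: "{w, u} \<in> edges G" "{w, v} \<in> edges G"
      using arcs_symmetric by (simp_all add: in_edges_iff)
    have "w \<in> pverts G" using w(1) by (rule in_arcsD2)
    from colD(2)[OF assms this that(2) e(2) that(1) e(1) that(3)] show ?thesis .
  qed
  moreover have "?\<phi> v \<in> {1..4}" for v by (cases "f v") auto
  ultimately show ?thesis unfolding two_distance_coloring_def using inj by blast
qed

lemma col_restrict: "S \<subseteq> U \<Longrightarrow> col {e \<in> E. e \<subseteq> U} S f \<longleftrightarrow> col E S f"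
  unfolding col_def by (intro ball_cong refl) (auto simp: subset_iff)

lemma plane_graph_restrict:
  assumes d: "plane_drawing G p c" and U: "U \<subseteq> pverts G"
  shows "plane_graph U {e \<in> edges G. e \<subseteq> U} p c"
proof
  have d: "inj_on p (pverts G)"
    "\<And>e. e \<in> edges G \<Longrightarrow> Path_Connected.arc (c e) \<and> {pathstart (c e), pathfinish (c e)} = p ` e \<and>
        path_image (c e) \<inter> p ` pverts G = p ` e"
    "\<And>e f. e \<in> edges G \<Longrightarrow> f \<in> edges G \<Longrightarrow> e \<noteq> f \<Longrightarrow> path_image (c e) \<inter> path_image (c f) = p ` (e \<inter> f)"
    using d unfolding plane_drawing_def by blast+
  show "finite U" using finite_subset[OF U pair_finite_verts] .
  show "inj_on p U" using inj_on_subset[OF d(1) U] .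
  fix e assume "e \<in> {e \<in> edges G. e \<subseteq> U}"
  then have e: "e \<in> edges G" "e \<subseteq> U" by simp_all
  then obtain x y where xy: "e = {x, y}" "(x, y) \<in> parcs G" unfolding edges_def by auto
  show "\<exists>x y. x \<noteq> y \<and> e = {x, y} \<and> x \<in> U \<and> y \<in> U"
    using xy e(2) pair_no_loops[OF xy(2)] by auto
  show "Path_Connected.arc (c e)" "{pathstart (c e), pathfinish (c e)} = p ` e" using d(2)[OF e(1)] by simp_all
  have v: "path_image (c e) \<inter> p ` pverts G = p ` e" using d(2)[OF e(1)] by simp
  show "path_image (c e) \<inter> p ` U = p ` e"
  proof
    show "path_image (c e) \<inter> p ` U \<subseteq> p ` e"
      unfolding v[symmetric] using U by (intro Int_mono image_mono) simp_all
    have "p ` e \<subseteq> path_image (c e)" unfolding v[symmetric] by (rule Int_lower1)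
    then show "p ` e \<subseteq> path_image (c e) \<inter> p ` U" using e(2) by (simp add: image_mono)
  qed
  fix f assume "f \<in> {e \<in> edges G. e \<subseteq> U}" "e \<noteq> f"
  then show "path_image (c e) \<inter> path_image (c f) = p ` (e \<inter> f)" using d(3)[OF e(1)] by simp
qed

text \<open>The minimal counterexample is a smallest uncolorable vertex set of the fixed graph; its
  induced subgraph inherits the drawing, the degree bound and the girth bound.\<close>

lemma ex_col:
  assumes "planar G" "max_degree G \<le> 3" "girth G \<ge> 21"
  shows "\<exists>f. col (edges G) (pverts G) f"
proof (rule ccontr)
  assume n: "\<not> ?thesis"
  let ?P = "\<lambda>U. U \<subseteq> pverts G \<and> (\<nexists>f. col (edges G) U f)"
  define U where "U = arg_min card ?P"
  have "?P (pverts G)" using n by simp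
  then have PU: "?P U" and least: "\<And>S. ?P S \<Longrightarrow> card U \<le> card S"
    unfolding U_def using arg_min_nat_lemma[of ?P "pverts G" card] by blast+
  let ?E = "{e \<in> edges G. e \<subseteq> U}"
  have U: "U \<subseteq> pverts G" "finite U" using PU finite_subset[OF _ pair_finite_verts] by blast+
  obtain p c where d: "plane_drawing G p c" using assms(1) unfolding planar_def by blast
  interpret P: plane_graph U ?E p c using plane_graph_restrict[OF d U(1)] .
  have "minimal_graph U ?E p c"
  proof
    fix v assume "v \<in> U"
    then have v: "v \<in> pverts G" using U(1) by blast
    have "{x. {v, x} \<in> edges G} \<subseteq> pverts G" using in_arcsD2 by (auto simp: in_edges_iff)
    from finite_subset[OF this pair_finite_verts]
    have "card {x. {v, x} \<in> ?E} \<le> card {x. {v, x} \<in> edges G}" by (rule card_mono) blast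
    then show "card {x. {v, x} \<in> ?E} \<le> 3" using card_neighbors_le[OF v] assms(2) by linarith
  next
    fix vs assume "P.is_cycle vs"
    then have "distinct vs" "3 \<le> length vs" "cycle_edges vs \<subseteq> edges G"
      unfolding P.is_cycle_def by blast+
    then have "girth G \<le> enat (length vs)" by (rule girth_le_cycle)
    with assms(3) have "21 \<le> enat (length vs)" by (rule order_trans)
    then show "21 \<le> length vs" by (simp add: numeral_eq_enat)
  next
    fix S assume S: "S \<subset> U"
    have "\<not> ?P S" using least[of S] psubset_card_mono[OF U(2) S] by (meson leD)
    then have "\<exists>f. col (edges G) S f" using S U(1) by blast
    then show "\<exists>f. col ?E S f" using col_restrict[of S U] S by blast
  next
    fix f show "\<not> col ?E U f" using PU col_restrict[of U U "edges G" f] by blast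
  qed
  then show False by (rule minimal_graph.impossible)
qed

end

theorem theorem4:
  fixes G :: "'a pair_pre_digraph"
  assumes "pair_graph G"
    and "planar G"
    and "subcubic G"
    and "girth G \<ge> 21"
  shows "two_distance_chromatic_number G \<le> 4 \<and> (\<exists>\<phi>. two_distance_coloring G 4 \<phi>)"
proof -
  interpret pair_graph G by fact
  have "\<exists>\<phi>. two_distance_coloring G 4 \<phi>"
    using ex_col[OF assms(2) _ assms(4)] two_distance_coloring_if_col assms(3) unfolding subcubic_def by auto
  then show ?thesis unfolding two_distance_chromatic_number_def by (auto intro: Least_le)
qed

end
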